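(* Under the assumptions stated in the context (Assumption 1, Assumption 3$^*$ and Assumption 4(i), in the limit $N,T \rightarrow \infty$ with $N/T \rightarrow \kappa^2$, $0<\kappa<\infty$), and with $W_{NT}$ and $C_{NT}$ as defined in the context, the score function satisfies \begin{align*} \nabla L_{NT}(\beta) \, &= \, 2 \, W_{NT} \, (\beta-\beta^0) \, - \, \frac 2 {\sqrt{NT}} \, C_{NT} \, + \frac 1 {NT} \, \nabla R_{NT}(\beta) \; , \end{align*} where the remainder $\nabla R_{NT}(\beta)$ satisfies for any sequence $\eta_{NT}\rightarrow 0$: \begin{align*} \sup_{\{\beta :\left\| \beta -\beta^{0} \right\| \leq \eta_{NT}\}} \frac{ \left\| \nabla R_{NT}(\beta) \right\| } { \sqrt{NT} \left(1 + \sqrt{NT} \, \left\| \beta -\beta^{0} \right\| \right) } = o_{p}\left( 1 \right) . \end{align*}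
   Context: Model: $Y = \beta^0\cdot X + \lambda^0 f^{0\prime} + e$, with $Y$, $X_k$ ($k=1,\ldots,K$), $e$ being $N\times T$ matrices, $\beta\cdot X=\sum_k \beta_k X_k$, $\lambda^0$ an $N\times R$ matrix of factor loadings and $f^0$ a $T\times R$ matrix of factors ($R$ known). The profile objective function is $L_{NT}(\beta)=\min_{\lambda,f}\frac{1}{NT}\|Y-\beta\cdot X-\lambda f'\|_F^2$. Assumptions: (Assumption 1) $\mathrm{plim}_{N,T\to\infty}\lambda^{0\prime}\lambda^0/N>0$ and $\mathrm{plim}_{N,T\to\infty} f^{0\prime}f^0/T>0$; (Assumption 3$^*$) $\|e\|=o_p(N^{2/3})$ (spectral norm); (Assumption 4(i)) $\mathrm{plim}_{N,T\to\infty}(NT)^{-1}\sum_{i,t}X_{it}X_{it}'>0$; limit $N,T\to\infty$ with $N/T\to\kappa^2$, $0<\kappa<\infty$. $M_A=\mathbb{I}-A(A'A)^{\dagger}A'$. $W_{NT}$ is the $K\times K$ matrix with $W_{NT,k_1k_2}=(NT)^{-1}\mathrm{Tr}(M_{f^0}X_{k_1}'M_{\lambda^0}X_{k_2})$, and $C_{NT}$ is the $K$-vector with $C_{NT,k}=C^{(1)}_k+C^{(2)}_k$, where $C^{(1)}_k=\frac{1}{\sqrt{NT}}\mathrm{Tr}(M_{f^0}e'M_{\lambda^0}X_k)$ and $C^{(2)}_k=-\frac{1}{\sqrt{NT}}\big[\mathrm{Tr}(eM_{f^0}e'M_{\lambda^0}X_kf^0(f^{0\prime}f^0)^{-1}(\lambda^{0\prime}\lambda^0)^{-1}\lambda^{0\prime})+\mathrm{Tr}(e'M_{\lambda^0}eM_{f^0}X_k'\lambda^0(\lambda^{0\prime}\lambda^0)^{-1}(f^{0\prime}f^0)^{-1}f^{0\prime})+\mathrm{Tr}(e'M_{\lambda^0}X_kM_{f^0}e'\lambda^0(\lambda^{0\prime}\lambda^0)^{-1}(f^{0\prime}f^0)^{-1}f^{0\prime})\big]$.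 $\nabla$ denotes the gradient with respect to $\beta$; $R_{NT}(\beta)$ is defined by $L_{NT}(\beta)=L_{NT}(\beta^0)-\frac{2}{\sqrt{NT}}(\beta-\beta^0)'C_{NT}+(\beta-\beta^0)'W_{NT}(\beta-\beta^0)+(NT)^{-1}R_{NT}(\beta)$. *)

theory Defs
  imports "HOL-Analysis.Analysis" "HOL-Probability.Probability" "Jordan_Normal_Form.Matrix"
begin

definition mtrace :: "real mat \<Rightarrow> real" where
  "mtrace A = (\<Sum>i<dim_row A. A $$ (i, i))"

definition fro_norm :: "real mat \<Rightarrow> real" where
  "fro_norm A = sqrt (\<Sum>i<dim_row A. \<Sum>j<dim_col A. (A $$ (i, j))\<^sup>2)"

definition vnorm :: "real vec \<Rightarrow> real" where
  "vnorm v = sqrt (v \<bullet> v)"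

definition spec_norm :: "real mat \<Rightarrow> real" where
  "spec_norm A = Sup {vnorm (A *\<^sub>v v) | v. v \<in> carrier_vec (dim_col A) \<and> vnorm v \<le> 1}"

definition pinv :: "real mat \<Rightarrow> real mat" where
  "pinv A = (THE B. B \<in> carrier_mat (dim_col A) (dim_row A) \<and>
      A * B * A = A \<and> B * A * B = B \<and> (A * B)\<^sup>T = A * B \<and> (B * A)\<^sup>T = B * A)"

definition Mproj :: "real mat \<Rightarrow> real mat" where
  "Mproj A = 1\<^sub>m (dim_row A) - A * pinv (A\<^sup>T * A) * A\<^sup>T"

definition pos_def_mat :: "real mat \<Rightarrow> bool" where
  "pos_def_mat S \<longleftrightarrow> (\<forall>v \<in> carrier_vec (dim_row S). v \<noteq> 0\<^sub>v (dim_row S) \<longrightarrow> v \<bullet> (S *\<^sub>v v) > 0)"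

definition pos_def_cart :: "real^'k^'k \<Rightarrow> bool" where
  "pos_def_cart S \<longleftrightarrow> (\<forall>v. v \<noteq> 0 \<longrightarrow> v \<bullet> (S *v v) > 0)"

definition bdotX :: "nat \<Rightarrow> nat \<Rightarrow> real^'k \<Rightarrow> ('k \<Rightarrow> real mat) \<Rightarrow> real mat" where
  "bdotX N T b X = mat N T (\<lambda>(i, t). \<Sum>k\<in>UNIV. b $ k * X k $$ (i, t))"

text \<open>Inner probability (allows non-measurable events, e.g. events defined by suprema)\<close>
definition inner_prob :: "'a measure \<Rightarrow> 'a set \<Rightarrow> real" where
  "inner_prob M S = Sup (measure M ` {A \<in> sets M. A \<subseteq> S})"

definition wpa1 :: "'a measure \<Rightarrow> (nat \<Rightarrow> 'a \<Rightarrow> bool) \<Rightarrow> bool" where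
  "wpa1 M P \<longleftrightarrow> (\<lambda>n. inner_prob M {\<omega> \<in> space M. P n \<omega>}) \<longlonglongrightarrow> 1"

definition plim_to :: "'a measure \<Rightarrow> (nat \<Rightarrow> 'a \<Rightarrow> real) \<Rightarrow> real \<Rightarrow> bool" where
  "plim_to M Z c \<longleftrightarrow> (\<forall>\<epsilon>>0. wpa1 M (\<lambda>n \<omega>. \<bar>Z n \<omega> - c\<bar> < \<epsilon>))"

definition small_op :: "'a measure \<Rightarrow> (nat \<Rightarrow> 'a \<Rightarrow> real) \<Rightarrow> (nat \<Rightarrow> real) \<Rightarrow> bool" where
  "small_op M Z a \<longleftrightarrow> plim_to M (\<lambda>n \<omega>. Z n \<omega> / a n) 0"

text \<open>Profile objective function \<open>L_NT(\<beta>)\<close>, with \<open>Y = \<beta>^0\<cdot>X + \<lambda>^0 f^0' + e\<close>\<close>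
definition LNT :: "nat \<Rightarrow> nat \<Rightarrow> nat \<Rightarrow> real mat \<Rightarrow> ('k \<Rightarrow> real mat) \<Rightarrow> real^'k \<Rightarrow> real" where
  "LNT N T R Y X b = Inf {(1 / (real N * real T)) * (fro_norm (Y - bdotX N T b X - lam * f\<^sup>T))\<^sup>2 | lam f.
       lam \<in> carrier_mat N R \<and> f \<in> carrier_mat T R}"

definition WNT :: "nat \<Rightarrow> nat \<Rightarrow> ('k \<Rightarrow> real mat) \<Rightarrow> real mat \<Rightarrow> real mat \<Rightarrow> real^'k^'k" where
  "WNT N T X lam0 f0 = (\<chi> k1 k2. (1 / (real N * real T)) *
      mtrace (Mproj f0 * (X k1)\<^sup>T * Mproj lam0 * X k2))"

definition CNT1 :: "nat \<Rightarrow> nat \<Rightarrow> ('k \<Rightarrow> real mat) \<Rightarrow> real mat \<Rightarrow> real mat \<Rightarrow> real mat \<Rightarrow> real^'k" where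
  "CNT1 N T X lam0 f0 e = (\<chi> k. (1 / sqrt (real N * real T)) *
      mtrace (Mproj f0 * e\<^sup>T * Mproj lam0 * X k))"

definition CNT2 :: "nat \<Rightarrow> nat \<Rightarrow> ('k \<Rightarrow> real mat) \<Rightarrow> real mat \<Rightarrow> real mat \<Rightarrow> real mat \<Rightarrow> real^'k" where
  "CNT2 N T X lam0 f0 e = (\<chi> k. - (1 / sqrt (real N * real T)) *
      ( mtrace (e * Mproj f0 * e\<^sup>T * Mproj lam0 * X k * f0 * pinv (f0\<^sup>T * f0)
                 * pinv (lam0\<^sup>T * lam0) * lam0\<^sup>T)
      + mtrace (e\<^sup>T * Mproj lam0 * e * Mproj f0 * (X k)\<^sup>T * lam0 * pinv (lam0\<^sup>T * lam0)
                 * pinv (f0\<^sup>T * f0) * f0\<^sup>T)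
      + mtrace (e\<^sup>T * Mproj lam0 * X k * Mproj f0 * e\<^sup>T * lam0 * pinv (lam0\<^sup>T * lam0)
                 * pinv (f0\<^sup>T * f0) * f0\<^sup>T)))"

definition CNT :: "nat \<Rightarrow> nat \<Rightarrow> ('k \<Rightarrow> real mat) \<Rightarrow> real mat \<Rightarrow> real mat \<Rightarrow> real mat \<Rightarrow> real^'k" where
  "CNT N T X lam0 f0 e = CNT1 N T X lam0 f0 e + CNT2 N T X lam0 f0 e"

text \<open>Remainder \<open>R_NT(\<beta>)\<close> defined by the expansion of \<open>L_NT\<close>\<close>
definition RNT :: "nat \<Rightarrow> nat \<Rightarrow> nat \<Rightarrow> real^'k \<Rightarrow> ('k \<Rightarrow> real mat) \<Rightarrow> real mat \<Rightarrow> real mat \<Rightarrow> real mat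
     \<Rightarrow> real^'k \<Rightarrow> real" where
  "RNT N T R b0 X lam0 f0 e b =
     (let Y = bdotX N T b0 X + lam0 * f0\<^sup>T + e in
      (real N * real T) * (LNT N T R Y X b - LNT N T R Y X b0
        + (2 / sqrt (real N * real T)) * ((b - b0) \<bullet> CNT N T X lam0 f0 e)
        - (b - b0) \<bullet> (WNT N T X lam0 f0 *v (b - b0))))"

end

theory Submission
  imports Defs "Jordan_Normal_Form.Determinant"
begin

text \<open>Write $Z = G + E$ with $G = \lambda^0 f^{0\prime}$ and $E = e - (\beta - \beta^0) \cdot X$, so that
  $NT \cdot L_{NT}(\beta)$ is the squared Frobenius distance $F(Z)$ from $Z$ to the matrices of rank
  at most $R$. If $P$ is the projector of a best approximation $PZ$ and $B = Z - PZ$, then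
  $B (PZ)' = 0$ and $B' (PZ) = 0$. Optimality against the projector of $\lambda^0$ bounds $(1 - P) G$, and
  hence $B$, by a multiple of the spectral norm of $E$. The resulting spectral gap makes $P$ a
  quadratically growing minimum, so $F$ is differentiable at $Z$ with gradient $2 B$. Solving the two
  orthogonality relations for the blocks of $B$ gives
  $B = M_\lambda E M_f - (\text{quadratic terms in } E) + O(\|E\|^3 / (NT))$ in Frobenius norm, because every
  remainder term contains the small low-rank factor $K = f (f'f)^{-1} (\lambda'\lambda)^{-1} \lambda'$.
  Pairing with $X_k$, the linear and quadratic terms at $E = e$ produce $W_{NT}$ and $C_{NT}$, and
  $\|e\| = o(N^{2/3})$ is just what makes the cubic remainder negligible.\<close>

section \<open>A ring of finitely supported matrices\<close>

text \<open>The regressors are controlled only in Frobenius norm, of order sqrt(NT), so B must be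
  expanded in Frobenius norm too, while E is small only in spectral norm and in general has full
  rank. The estimates mix both norms: one factor of low rank carries the Frobenius norm, all others
  a spectral bound. With a spectral bound y for E and signal strength s of order sqrt(NT), the cubic
  remainder is of order y^3 / s^2. Paired with a regressor it must be o(sqrt(NT)) at \<beta>^0, that
  is y^3 = o(NT), which is the rate N^(2/3) when N and T are comparable. The expansion is made in E,
  but C_NT is evaluated at e. The change of argument costs a term proportional to the distance from
  \<beta>^0, absorbed by the factor 1 + sqrt(NT) ||\<beta> - \<beta>^0|| in the denominator. No
  power series of eigenvalues or projectors occurs: F is an infimum of quadratic functions, and
  growth around the minimiser bounds its increments from both sides. All estimates are deterministic
  on one event free of \<beta>, so uniformity in \<beta> comes at no cost.\<close>

text \<open>The dimensions $N$ and $T$ vary along the sequence, so they cannot be types. Embedding matrices of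
  all sizes into one type of finitely supported infinite matrices gives a (non-unital) normed algebra
  with the Frobenius inner product; the predicate \<open>dims\<close> remembers the size.\<close>

typedef fmat = "{A :: nat \<Rightarrow> nat \<Rightarrow> real. \<exists>n. \<forall>i j. A i j \<noteq> 0 \<longrightarrow> i < n \<and> j < n}"
  morphisms entry Fmat
  by (rule exI[of _ "\<lambda>_ _. 0"]) auto

setup_lifting type_definition_fmat

lemma fmat_eqI: "(\<And>i j. entry A i j = entry B i j) \<Longrightarrow> A = B"
  by (metis entry_inject ext)

text \<open>Only a bound on the support, hence monotone in both sizes: finitely many matrices can be
  regarded as square of a common size \<open>n\<close>, which is how the ring and inner product laws
  are proved.\<close>

definition dims :: "fmat \<Rightarrow> nat \<Rightarrow> nat \<Rightarrow> bool" where
  "dims A m n \<longleftrightarrow> (\<forall>i j. entry A i j \<noteq> 0 \<longrightarrow> i < m \<and> j < n)"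

lemma dims_entry: "dims A m n \<Longrightarrow> \<not> (i < m \<and> j < n) \<Longrightarrow> entry A i j = 0"
  unfolding dims_def by blast

lemma dims_mono: "dims A m n \<Longrightarrow> m \<le> m' \<Longrightarrow> n \<le> n' \<Longrightarrow> dims A m' n'"
  unfolding dims_def by force

lemma ex_dims: "\<exists>n. dims A n n"
  using entry[of A] unfolding dims_def by simp

lemma ex_dims2: "\<exists>n. dims A n n \<and> dims B n n"
proof -
  obtain a b where "dims A a a" "dims B b b" using ex_dims by meson
  then have "dims A (max a b) (max a b)" "dims B (max a b) (max a b)"
    by (auto intro: dims_mono)
  then show ?thesis by blast
qed

lemma ex_dims3: "\<exists>n. dims A n n \<and> dims B n n \<and> dims C n n"
proof -
  obtain a b where "dims A a a" "dims B a a" "dims C b b" using ex_dims ex_dims2 by meson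
  then have "dims A (max a b) (max a b)" "dims B (max a b) (max a b)" "dims C (max a b) (max a b)"
    by (auto intro: dims_mono)
  then show ?thesis by blast
qed

lemma entry_Fmat:
  assumes "\<And>i j. f i j \<noteq> 0 \<Longrightarrow> i < n \<and> j < (n :: nat)"
  shows "entry (Fmat f) = f"
  by (rule Fmat_inverse) (use assms in blast)

instantiation fmat :: real_vector
begin

lift_definition zero_fmat :: fmat is "\<lambda>_ _. 0" by simp

lift_definition plus_fmat :: "fmat \<Rightarrow> fmat \<Rightarrow> fmat" is "\<lambda>A B i j. A i j + B i j"
proof -
  fix A B :: "nat \<Rightarrow> nat \<Rightarrow> real"
  assume "\<exists>n. \<forall>i j. A i j \<noteq> 0 \<longrightarrow> i < n \<and> j < n" "\<exists>n. \<forall>i j. B i j \<noteq> 0 \<longrightarrow> i < n \<and> j < n"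
  then obtain a b where "\<forall>i j. A i j \<noteq> 0 \<longrightarrow> i < a \<and> j < a" "\<forall>i j. B i j \<noteq> 0 \<longrightarrow> i < b \<and> j < b"
    by blast
  then have "\<forall>i j. A i j + B i j \<noteq> 0 \<longrightarrow> i < max a b \<and> j < max a b"
    by (metis add_0 less_max_iff_disj)
  then show "\<exists>n. \<forall>i j. A i j + B i j \<noteq> 0 \<longrightarrow> i < n \<and> j < n" by blast
qed

lift_definition uminus_fmat :: "fmat \<Rightarrow> fmat" is "\<lambda>A i j. - A i j" by simp

definition minus_fmat :: "fmat \<Rightarrow> fmat \<Rightarrow> fmat" where "minus_fmat A B = A + - B"

lift_definition scaleR_fmat :: "real \<Rightarrow> fmat \<Rightarrow> fmat" is "\<lambda>c A i j. c * A i j"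
  by auto

lemma entry_real_vector [simp]:
  "entry 0 i j = 0"
  "entry (A + B) i j = entry A i j + entry B i j"
  "entry (- A) i j = - entry A i j"
  "entry (A - B) i j = entry A i j - entry B i j"
  "entry (c *\<^sub>R A) i j = c * entry A i j"
proof -
  show plus: "entry (A + B) i j = entry A i j + entry B i j" for A B by transfer simp
  show "entry (- A) i j = - entry A i j" for A by transfer simp
  then show "entry (A - B) i j = entry A i j - entry B i j"
    by (simp add: minus_fmat_def plus)
  show "entry 0 i j = 0" by transfer simp
  show "entry (c *\<^sub>R A) i j = c * entry A i j" by transfer simp
qed

instance
  by standard (rule fmat_eqI; simp add: algebra_simps)+

end

instantiation fmat :: real_algebra
begin

text \<open>Summation runs over the support of a row of \<open>A\<close>, which is finite, so the
  product is total without reference to a size; \<open>entry_mult\<close> recovers the usual sum as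
  soon as one factor bounds the inner index.\<close>

definition times_fmat :: "fmat \<Rightarrow> fmat \<Rightarrow> fmat" where
  "A * B = Fmat (\<lambda>i j. \<Sum>k\<in>{k. entry A i k \<noteq> 0}. entry A i k * entry B k j)"

lemma entry_mult:
  assumes "dims A m n \<or> dims B n p"
  shows "entry (A * B) i j = (\<Sum>k<n. entry A i k * entry B k j)"
proof -
  obtain N where N: "dims A N N" "dims B N N" using ex_dims2 by blast
  have fin: "finite {k. entry A i k \<noteq> 0}" for i
    by (rule finite_subset[of _ "{..<N}"]) (use N in \<open>auto simp: dims_def\<close>)
  have "entry (A * B) i j = (\<Sum>k\<in>{k. entry A i k \<noteq> 0}. entry A i k * entry B k j)"
    unfolding times_fmat_def
  proof (subst entry_Fmat[where n = N])
    fix i j assume "(\<Sum>k | entry A i k \<noteq> 0. entry A i k * entry B k j) \<noteq> 0"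
    then obtain k where "entry A i k * entry B k j \<noteq> 0" by (meson sum.not_neutral_contains_not_neutral)
    then show "i < N \<and> j < N" using N unfolding dims_def by auto
  qed simp
  also have "\<dots> = (\<Sum>k<n. entry A i k * entry B k j)"
  proof (rule sum.mono_neutral_cong[OF _ fin])
    show "entry A i k * entry B k j = 0" if "k \<in> {k. entry A i k \<noteq> 0} - {..<n}" for k
      using assms that dims_entry by auto
  qed auto
  finally show ?thesis .
qed

instance
proof
  fix A B C :: fmat and c :: real
  obtain n where n: "dims A n n" "dims B n n" "dims C n n" using ex_dims3 by blast
  have e: "entry (A * D) i j = (\<Sum>k<n. entry A i k * entry D k j)"
    "entry (B * D) i j = (\<Sum>k<n. entry B i k * entry D k j)"
    "entry (D * C) i j = (\<Sum>k<n. entry D i k * entry C k j)" for D i j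
    using n entry_mult by blast+
  show "A * B * C = A * (B * C)"
    apply (rule fmat_eqI)
    apply (simp only: e sum_distrib_left sum_distrib_right)
    apply (subst sum.swap)
    apply (simp add: mult_ac)
    done
  show "(A + B) * C = A * C + B * C"
    by (rule fmat_eqI) (simp only: e entry_real_vector sum.distrib[symmetric] distrib_right)
  show "A * (B + C) = A * B + A * C"
    by (rule fmat_eqI) (simp only: e entry_real_vector sum.distrib[symmetric] distrib_left)
  have ec: "entry ((c *\<^sub>R A) * B) i j = (\<Sum>k<n. entry (c *\<^sub>R A) i k * entry B k j)" for i j
    by (rule entry_mult) (use n in \<open>auto simp: dims_def\<close>)
  show "c *\<^sub>R A * B = c *\<^sub>R (A * B)"
    by (rule fmat_eqI) (simp add: ec e sum_distrib_left mult_ac)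
  show "A * c *\<^sub>R B = c *\<^sub>R (A * B)"
    by (rule fmat_eqI) (simp add: e sum_distrib_left mult_ac)
qed

end

lift_definition tr :: "fmat \<Rightarrow> fmat" is "\<lambda>A i j. A j i" by blast

lemma entry_tr [simp]: "entry (tr A) i j = entry A j i" by transfer simp

lemma tr_real_vector [simp]:
  "tr (tr A) = A" "tr 0 = 0" "tr (A + B) = tr A + tr B" "tr (A - B) = tr A - tr B"
  "tr (- A) = - tr A" "tr (c *\<^sub>R A) = c *\<^sub>R tr A"
  by (rule fmat_eqI; simp)+

lemma dims_tr [simp]: "dims (tr A) m n \<longleftrightarrow> dims A n m"
  unfolding dims_def by auto

lemma tr_mult [simp]: "tr (A * B) = tr B * tr A"
proof -
  obtain n where n: "dims A n n" "dims B n n" using ex_dims2 by blast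
  show ?thesis
    by (rule fmat_eqI) (simp add: entry_mult[of A n n] entry_mult[of "tr B" n n] n mult.commute)
qed

lemma dims_zero [simp]: "dims 0 m n"
  and dims_add [intro]: "dims A m n \<Longrightarrow> dims B m n \<Longrightarrow> dims (A + B) m n"
  and dims_diff [intro]: "dims A m n \<Longrightarrow> dims B m n \<Longrightarrow> dims (A - B) m n"
  and dims_uminus [intro]: "dims A m n \<Longrightarrow> dims (- A) m n"
  and dims_scaleR [intro]: "dims A m n \<Longrightarrow> dims (c *\<^sub>R A) m n"
  by (simp_all add: dims_def) (metis add_0 | blast)+

lemma dims_mult [intro]:
  assumes "dims A m n" "dims B p q" shows "dims (A * B) m q"
  unfolding dims_def
proof (intro allI impI)
  fix i j assume "entry (A * B) i j \<noteq> 0"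
  then obtain k where "entry A i k * entry B k j \<noteq> 0"
    using entry_mult[of A m n] assms(1) by (metis (lifting) sum.neutral)
  then show "i < m \<and> j < q" using assms unfolding dims_def by auto
qed

lemma dims_sum [intro]: "(\<And>i. i \<in> I \<Longrightarrow> dims (f i) m n) \<Longrightarrow> dims (sum f I) m n"
  by (induction I rule: infinite_finite_induct) auto

section \<open>Frobenius inner product and submultiplicative norm\<close>

instantiation fmat :: real_inner
begin

definition inner_fmat :: "fmat \<Rightarrow> fmat \<Rightarrow> real" where
  "inner A B = (\<Sum>(i, j)\<in>{(i, j). entry A i j \<noteq> 0}. entry A i j * entry B i j)"

definition norm_fmat :: "fmat \<Rightarrow> real" where "norm_fmat A = sqrt (inner A A)"
definition sgn_fmat :: "fmat \<Rightarrow> fmat" where "sgn_fmat A = A /\<^sub>R norm A"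
definition dist_fmat :: "fmat \<Rightarrow> fmat \<Rightarrow> real" where "dist_fmat A B = norm (A - B)"
definition uniformity_fmat :: "(fmat \<times> fmat) filter" where
  "uniformity_fmat = (INF e\<in>{0<..}. principal {(x, y). dist x y < e})"
definition open_fmat :: "fmat set \<Rightarrow> bool" where
  "open_fmat S \<longleftrightarrow> (\<forall>x\<in>S. \<forall>\<^sub>F (x', y) in uniformity. x' = x \<longrightarrow> y \<in> S)"

lemma inner_fmat_entries:
  assumes "dims A m n \<or> dims B m n"
  shows "inner A B = (\<Sum>i<m. \<Sum>j<n. entry A i j * entry B i j)"
proof -
  obtain N where N: "dims A N N" using ex_dims by blast
  have fin: "finite {(i, j). entry A i j \<noteq> 0}"
    by (rule finite_subset[of _ "{..<N} \<times> {..<N}"]) (use N in \<open>auto simp: dims_def\<close>)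
  show ?thesis
    unfolding inner_fmat_def sum.cartesian_product
  proof (rule sum.mono_neutral_cong[OF _ fin])
    show "(case x of (i, j) \<Rightarrow> entry A i j * entry B i j) = 0"
      if "x \<in> {(i, j). entry A i j \<noteq> 0} - {..<m} \<times> {..<n}" for x
      using assms that dims_entry by fastforce
  qed auto
qed

instance
proof
  fix A B C :: fmat and c :: real
  obtain n where n: "dims A n n" "dims B n n" "dims C n n" using ex_dims3 by blast
  have e: "inner A D = (\<Sum>i<n. \<Sum>j<n. entry A i j * entry D i j)"
    "inner B D = (\<Sum>i<n. \<Sum>j<n. entry B i j * entry D i j)"
    "inner D C = (\<Sum>i<n. \<Sum>j<n. entry D i j * entry C i j)" 
    "inner (c *\<^sub>R A) D = (\<Sum>i<n. \<Sum>j<n. entry (c *\<^sub>R A) i j * entry D i j)" for D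
    using n dims_scaleR[OF n(1), of c] by (blast intro: inner_fmat_entries)+
  show "inner A B = inner B A"
    by (simp only: e mult.commute)
  show "inner (A + B) C = inner A C + inner B C"
    by (simp add: e sum.distrib algebra_simps)
  show "inner (c *\<^sub>R A) B = c * inner A B"
    by (simp add: e sum_distrib_left mult_ac)
  show "0 \<le> inner A A"
    by (simp add: e sum_nonneg)
  show "inner A A = 0 \<longleftrightarrow> A = 0"
  proof
    assume "inner A A = 0"
    then have "entry A i j = 0" if "i < n" "j < n" for i j
      using that by (simp add: e sum_nonneg_eq_0_iff sum_nonneg)
    then have "entry A i j = 0" for i j using dims_entry[OF n(1)] by metis
    then show "A = 0" by (intro fmat_eqI) simp
  qed (simp add: inner_fmat_def)
qed (simp_all add: norm_fmat_def sgn_fmat_def dist_fmat_def uniformity_fmat_def open_fmat_def)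

end

lemma inner_tr [simp]: "inner (tr A) (tr B) = inner A B"
proof -
  obtain n where n: "dims A n n" using ex_dims by blast
  then have "inner (tr A) (tr B) = (\<Sum>i<n. \<Sum>j<n. entry A j i * entry B j i)"
    by (subst inner_fmat_entries[of _ n n]) auto
  also have "\<dots> = inner A B"
    by (subst sum.swap) (use n in \<open>simp add: inner_fmat_entries[of A n n]\<close>)
  finally show ?thesis .
qed

lemma norm_tr [simp]: "norm (tr A) = norm (A :: fmat)"
  by (simp add: norm_eq_sqrt_inner)

text \<open>The adjoint of multiplication by \<open>C\<close> from the right. This rule and its
  mirror image \<open>inner_mult_left\<close> do the work of the cyclic invariance of the
  trace.\<close>

lemma inner_mult_right: "inner A (B * C) = inner (A * tr C) (B :: fmat)"
proof -
  obtain n where n: "dims A n n" "dims B n n" "dims C n n" using ex_dims3 by blast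
  then have d: "dims (A * tr C) n n" by (auto intro: dims_mult)
  have "inner A (B * C) = (\<Sum>i<n. \<Sum>j<n. \<Sum>k<n. entry A i j * (entry B i k * entry C k j))"
    by (simp add: inner_fmat_entries[of _ n n] n entry_mult[of B n n] sum_distrib_left)
  also have "\<dots> = (\<Sum>i<n. \<Sum>k<n. \<Sum>j<n. entry A i j * (entry B i k * entry C k j))"
    by (intro sum.cong refl sum.swap)
  also have "\<dots> = inner (A * tr C) B"
    by (simp add: inner_fmat_entries[of _ n n] n d entry_mult[of A n n] sum_distrib_left mult_ac)
  finally show ?thesis .
qed

lemma inner_mult_left: "inner A (B * C) = inner (tr B * A) (C :: fmat)"
  using inner_mult_right[of "tr A" "tr C" "tr B"] inner_tr[of A "B * C"] inner_tr[of "tr B * A" C]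
  by simp

lemma power2_norm_fmat:
  fixes A :: fmat
  assumes "dims A m n" shows "(norm A)\<^sup>2 = (\<Sum>i<m. \<Sum>j<n. (entry A i j)\<^sup>2)"
  using assms by (subst power2_norm_eq_inner, subst inner_fmat_entries) (auto simp: power2_eq_square)

instance fmat :: real_normed_algebra
proof
  fix A B :: fmat
  obtain n where n: "dims A n n" "dims B n n" using ex_dims2 by blast
  then have "(norm (A * B))\<^sup>2 = (\<Sum>i<n. \<Sum>j<n. (\<Sum>k<n. entry A i k * entry B k j)\<^sup>2)"
    by (simp add: power2_norm_fmat[OF dims_mult] entry_mult[OF disjI1])
  also have "\<dots> \<le> (\<Sum>i<n. \<Sum>j<n. (\<Sum>k<n. (entry A i k)\<^sup>2) * (\<Sum>k<n. (entry B k j)\<^sup>2))"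
    by (intro sum_mono Cauchy_Schwarz_ineq_sum)
  also have "\<dots> = (\<Sum>i<n. \<Sum>k<n. (entry A i k)\<^sup>2) * (\<Sum>j<n. \<Sum>k<n. (entry B k j)\<^sup>2)"
    by (simp add: sum_product)
  also have "(\<Sum>j<n. \<Sum>k<n. (entry B k j)\<^sup>2) = (\<Sum>k<n. \<Sum>j<n. (entry B k j)\<^sup>2)"
    by (rule sum.swap)
  also have "(\<Sum>i<n. \<Sum>k<n. (entry A i k)\<^sup>2) * \<dots> = (norm A * norm B)\<^sup>2"
    by (simp add: power_mult_distrib power2_norm_fmat[OF n(1)] power2_norm_fmat[OF n(2)])
  finally show "norm (A * B) \<le> norm A * norm B"
    by (rule power2_le_imp_le) simp
qed

section \<open>Best low-rank approximation\<close>

text \<open>Matrix units. The product \<open>A * eunit j 0\<close> turns column \<open>j\<close> of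
  \<open>A\<close> into a column vector, which is how columns are extracted.\<close>

definition eunit :: "nat \<Rightarrow> nat \<Rightarrow> fmat" where
  "eunit i j = Fmat (\<lambda>a b. if a = i \<and> b = j then 1 else 0)"

text \<open>The algebra has no unit; \<open>idf n\<close> acts as one from the left on matrices with
  at most \<open>n\<close> rows and from the right on those with at most \<open>n\<close>
  columns.\<close>

definition idf :: "nat \<Rightarrow> fmat" where
  "idf n = Fmat (\<lambda>a b. if a = b \<and> a < n then 1 else 0)"

lemma entry_eunit [simp]: "entry (eunit i j) a b = (if a = i \<and> b = j then 1 else 0)"
  unfolding eunit_def by (subst entry_Fmat[where n = "Suc (max i j)"]) (auto split: if_splits)

lemma entry_idf [simp]: "entry (idf n) a b = (if a = b \<and> a < n then 1 else 0)"
  unfolding idf_def by (subst entry_Fmat[where n = n]) (auto split: if_splits)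

lemma dims_eunit [intro]: "i < m \<Longrightarrow> j < n \<Longrightarrow> dims (eunit i j) m n"
  and dims_idf [simp, intro]: "dims (idf n) n n"
  by (simp_all add: dims_def)

lemma tr_eunit [simp]: "tr (eunit i j) = eunit j i"
  and tr_idf [simp]: "tr (idf n) = idf n"
  by (rule fmat_eqI; simp; fail)+

lemma entry_mult_eunit [simp]: "entry (A * eunit i j) a b = (if b = j then entry A a i else 0)"
  by (subst entry_mult[of _ 0 "Suc i" _ "Suc j"]) (auto simp: dims_def if_distrib cong: if_cong)

lemma idf_mult [simp]:
  assumes "dims A n m" shows "idf n * A = A"
proof (rule fmat_eqI)
  fix i j
  have "entry (idf n * A) i j = (\<Sum>k<n. if k = i then entry A k j else 0)"
    by (subst entry_mult[OF disjI1[OF dims_idf]], intro sum.cong refl) auto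
  then show "entry (idf n * A) i j = entry A i j" using dims_entry[OF assms, of i j] by auto
qed

lemma mult_idf [simp]:
  assumes "dims A m n" shows "A * idf n = A"
  using idf_mult[of "tr A" n m] assms by (metis dims_tr tr_idf tr_mult tr_real_vector(1))

lemma norm_idf: "(norm (idf n))\<^sup>2 = real n"
proof -
  have "(norm (idf n))\<^sup>2 = (\<Sum>i<n. \<Sum>j<n. if j = i then 1 else 0)"
    by (subst power2_norm_fmat[OF dims_idf], intro sum.cong refl) auto
  then show ?thesis by simp
qed

section \<open>Orthonormal frames and their projectors\<close>

lemma gram_column:
  assumes "dims w n 1" shows "tr w * w = (norm w)\<^sup>2 *\<^sub>R idf 1"
proof (rule fmat_eqI)
  fix i j
  have d: "dims (tr w) 1 n" "dims (tr w * w) 1 1" using assms by auto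
  show "entry (tr w * w) i j = entry ((norm w)\<^sup>2 *\<^sub>R idf 1) i j"
  proof (cases "i = 0 \<and> j = 0")
    case True
    then show ?thesis
      by (simp add: power2_norm_fmat[OF assms] entry_mult[OF disjI1[OF d(1)]]) (simp add: power2_eq_square)
  next
    case False
    then show ?thesis using dims_entry[OF d(2), of i j] by auto
  qed
qed

text \<open>A projector of rank \<open>R\<close> is handled through a frame \<open>U\<close> of its
  range: the frame makes the rank explicit and supplies the factors over which
  \<open>rank_dist\<close> minimises.\<close>

definition orth :: "nat \<Rightarrow> nat \<Rightarrow> fmat \<Rightarrow> bool" where
  "orth N R U \<longleftrightarrow> dims U N R \<and> tr U * U = idf R"

lemma orthD:
  assumes "orth N R U"
  shows "dims U N R" "tr U * U = idf R" "U * idf R = U" "idf R * tr U = tr U"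
    "tr U * (U * (tr U * x)) = tr U * x"
proof -
  show d: "dims U N R" "tr U * U = idf R" using assms by (auto simp: orth_def)
  show "U * idf R = U" using d by simp
  show *: "idf R * tr U = tr U" using d by simp
  show "tr U * (U * (tr U * x)) = tr U * x"
    using d(2) * by (metis mult.assoc)
qed

lemma orth_norm:
  assumes "orth N R U" shows "(norm U)\<^sup>2 = real R"
proof -
  have "inner U U = inner U (U * idf R)" using orthD[OF assms] by simp
  also have "\<dots> = inner (idf R) (idf R)"
    using assms by (simp only: inner_mult_left) (simp add: orth_def)
  finally show ?thesis by (simp add: power2_norm_eq_inner[symmetric] norm_idf)
qed

lemma orth_proj:
  assumes "orth N R U" defines "P \<equiv> U * tr U"
  shows "tr P = P" "P * P = P" "dims P N N" "(norm P)\<^sup>2 = real R"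
proof -
  note U = assms(1)[unfolded orth_def]
  show "tr P = P" by (simp add: P_def)
  show "P * P = P" using orthD(3)[OF assms(1)] orthD(2)[OF assms(1)] by (metis P_def mult.assoc)
  show "dims P N N" unfolding P_def using U by (auto intro!: dims_mult)
  have "inner P P = inner (tr U * P) (tr U)" by (simp add: P_def inner_mult_left)
  also have "tr U * P = tr U" using U orthD(4)[OF assms(1)] unfolding P_def by (simp add: mult.assoc[symmetric])
  finally show "(norm P)\<^sup>2 = real R"
    using orth_norm[OF assms(1)] by (simp add: power2_norm_eq_inner)
qed

text \<open>Gram-Schmidt, one column per induction step. The frame must have exactly
  \<open>R\<close> columns even if \<open>l\<close> is rank deficient; when a column adds no new
  direction, an arbitrary unit vector orthogonal to the frame is appended instead, which exists
  because \<open>R \<le> N\<close>.\<close>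

lemma ex_orth_span:
  assumes "dims l N R" "R \<le> N"
  shows "\<exists>V. orth N R V \<and> V * (tr V * l) = l"
  using assms
proof (induction R arbitrary: l)
  case 0
  have "l = 0" using dims_entry[OF 0(1)] by (intro fmat_eqI) simp
  moreover have "orth N 0 0" unfolding orth_def by (simp, intro fmat_eqI, simp)
  ultimately show ?case by (intro exI[of _ 0]) simp
next
  case (Suc r)
  define l1 where "l1 = l * idf r"
  define c where "c = l * eunit r 0"
  define E where "E = eunit 0 r"
  have d: "dims l1 N r" "dims c N 1" "dims E 1 (Suc r)"
    using Suc.prems unfolding l1_def c_def E_def by (auto intro!: dims_mult)
  have "idf (Suc r) = idf r + eunit r 0 * eunit 0 r" by (rule fmat_eqI) auto
  then have "l * idf (Suc r) = l1 + c * E"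
    by (simp only: l1_def c_def E_def distrib_left mult.assoc)
  then have l: "l = l1 + c * E" using Suc.prems by simp
  obtain V where V: "orth N r V" "V * (tr V * l1) = l1"
    using Suc.IH[OF d(1)] Suc.prems by auto
  note V' = V(1)[unfolded orth_def]
  define Q where "Q = V * tr V"
  note Q = orth_proj[OF V(1), folded Q_def]
  have perp: "tr V * (x - Q * x) = 0" for x
    using orthD(5)[OF V(1)] by (simp add: right_diff_distrib Q_def mult.assoc)
  have "\<exists>v. dims v N 1 \<and> v \<noteq> 0 \<and> tr V * v = 0 \<and> (c - Q * c = v \<or> c - Q * c = 0)"
  proof (cases "c - Q * c = 0")
    case False
    then show ?thesis using perp[of c] d Q by (intro exI[of _ "c - Q * c"]) (auto intro!: dims_diff)
  next
    case True
    \<comment> \<open>If \<open>Q\<close> fixed every unit vector it would be \<open>idf N\<close>,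
      of squared norm \<open>N\<close>, whereas a projector of rank \<open>r\<close> has squared
      norm \<open>r\<close>, and \<open>r < N\<close>.\<close>
    have "\<exists>i<N. eunit i 0 - Q * eunit i 0 \<noteq> 0"
    proof (rule ccontr)
      assume H: "\<not> ?thesis"
      have "Q = idf N"
      proof (rule fmat_eqI)
        fix i j
        show "entry Q i j = entry (idf N) i j"
        proof (cases "i < N \<and> j < N")
          case True
          with H have "entry (eunit j 0) i 0 = entry (Q * eunit j 0) i 0" by auto
          with True show ?thesis by (auto split: if_splits)
        next
          case False
          then show ?thesis using dims_entry[OF Q(3) False] by auto
        qed
      qed
      then show False using Q(4) norm_idf[of N] Suc.prems by simp
    qed
    then obtain i where i: "i < N" "eunit i 0 - Q * eunit i 0 \<noteq> 0" by blast
    then show ?thesis using True perp Q(3)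
      by (intro exI[of _ "eunit i 0 - Q * eunit i 0"]) (auto intro!: dims_diff dims_mult)
  qed
  then obtain v where v: "dims v N 1" "v \<noteq> 0" "tr V * v = 0" "c - Q * c = v \<or> c - Q * c = 0" by blast
  define w where "w = v /\<^sub>R norm v"
  have dw: "dims w N 1" and nw: "norm w = 1" and vw: "v = norm v *\<^sub>R w"
    using v by (auto simp: w_def)
  have w: "dims w N 1" "tr w * w = idf 1" "tr V * w = 0"
    using dw nw gram_column[OF dw] v(3) by (auto simp: w_def)
  have wV: "tr w * V = 0" using w(3) by (metis tr_mult tr_real_vector(1,2))
  have wc: "w * (tr w * c) = c - Q * c"
  proof -
    have "tr w * (Q * c) = tr w * V * tr V * c" by (simp only: Q_def mult.assoc)
    then have "tr w * c = tr w * (c - Q * c)" using wV by (simp add: right_diff_distrib)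
    moreover have "tr w * v = norm v *\<^sub>R idf 1"
      using w(2) by (subst vw) simp
    moreover have "w * idf 1 = w" by (rule mult_idf[OF w(1)])
    ultimately show ?thesis using v(4) vw by auto
  qed
  have VE: "V * tr E = 0"
    by (rule fmat_eqI) (use V' in \<open>auto simp: E_def dims_def\<close>)
  then have EV: "E * tr V = 0" by (metis tr_mult tr_real_vector(1,2))
  have EE: "E * tr E = idf 1" "tr E * E = eunit r r" by (rule fmat_eqI; auto simp: E_def)+
  \<comment> \<open>Column \<open>r\<close> of \<open>V\<close> is zero and \<open>w * E\<close> is
    supported in column \<open>r\<close>, so the sum appends \<open>w\<close> to the frame.\<close>
  define V1 where "V1 = V + w * E"
  have VV: "V1 * tr V1 = Q + w * tr w"
  proof -
    have "V1 * tr V1 = Q + (V * tr E) * tr w + w * (E * tr V) + w * (E * tr E) * tr w"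
      by (simp add: V1_def Q_def algebra_simps)
    then show ?thesis using VE EV EE mult_idf[OF w(1)] by simp
  qed
  have "tr V1 * V1 = tr V * V + tr V * w * E + tr E * (tr w * V) + tr E * (tr w * w * E)"
    by (simp add: V1_def algebra_simps)
  also have "\<dots> = idf r + eunit r r"
    using V' w wV EE d(3) by simp
  also have "\<dots> = idf (Suc r)" by (rule fmat_eqI) auto
  finally have "orth N (Suc r) V1"
    using V' w d(3) unfolding orth_def V1_def by (auto intro!: dims_add dims_mult dest: dims_mono[of V N r N "Suc r"])
  moreover have "V1 * (tr V1 * l) = l"
  proof -
    have "tr w * l1 = tr w * V * (tr V * l1)" using V(2) by (simp add: mult.assoc)
    then have "tr w * l1 = 0" using wV by simp
    moreover have "Q * l1 = l1" using V(2) by (simp add: Q_def mult.assoc)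
    moreover have "V1 * (tr V1 * l) = Q * l1 + w * (tr w * l1) + (Q * c + w * (tr w * c)) * E"
      by (simp only: mult.assoc[symmetric] VV) (simp add: l algebra_simps)
    ultimately show ?thesis using wc l by simp
  qed
  ultimately show ?case by blast
qed

text \<open>The type \<open>fmat\<close> is infinite-dimensional, so closed and bounded sets need
  not be compact. Induction over the positions: releasing one more entry adds a segment, and a sum
  of two compact sets is compact.\<close>

lemma compact_fmat_box:
  assumes "finite P"
  shows "compact {A. \<forall>i j. (if (i, j) \<in> P then \<bar>entry A i j\<bar> \<le> C else entry A i j = 0)}"
    (is "compact (?S P)")
  using assms
proof (induction P)
  case empty
  have "A = 0" if "A \<in> ?S {}" for A using that by (intro fmat_eqI) simp
  then have "?S {} = {0}" by auto
  then show ?case by simp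
next
  case (insert p P)
  obtain a b where p: "p = (a, b)" by force
  let ?L = "(\<lambda>t. t *\<^sub>R eunit a b) ` {-C..C}"
  have eq: "?S (insert p P) = {x + y |x y. x \<in> ?S P \<and> y \<in> ?L}"
  proof (intro equalityI subsetI)
    fix A assume A: "A \<in> ?S (insert p P)"
    define t where "t = entry A a b"
    have "A = (A - t *\<^sub>R eunit a b) + t *\<^sub>R eunit a b" by simp
    moreover have "A - t *\<^sub>R eunit a b \<in> ?S P"
      using A insert(2) by (auto simp: p t_def)
    moreover have "\<bar>t\<bar> \<le> C"
      using A by (auto simp: t_def p dest: spec[of _ a])
    then have "t *\<^sub>R eunit a b \<in> ?L" by (auto simp: abs_le_iff)
    ultimately show "A \<in> {x + y |x y. x \<in> ?S P \<and> y \<in> ?L}" by blast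
  next
    fix A assume "A \<in> {x + y |x y. x \<in> ?S P \<and> y \<in> ?L}"
    then obtain x t where "A = x + t *\<^sub>R eunit a b" and x: "x \<in> ?S P" and t: "t \<in> {-C..C}" by blast
    then have "entry A i j = (if (i, j) = (a, b) then t else entry x i j)" for i j
      using insert(2) by (auto simp: p)
    then show "A \<in> ?S (insert p P)" using x t by (auto simp: p)
  qed
  have "compact ?L" by (intro compact_continuous_image continuous_intros) auto
  then show ?case unfolding eq by (rule compact_sums[OF insert.IH])
qed

lemma abs_entry_le_norm: "\<bar>entry A i j\<bar> \<le> norm A"
proof -
  have "entry A i j = inner A (eunit i j)"
    by (subst inner_fmat_entries[of _ "Suc i" "Suc j"])
      (auto simp: if_distrib dims_def if_distribR sum.If_cases cong: if_cong)
  moreover have "norm (eunit i j) = 1"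
    by (simp add: norm_eq_sqrt_inner inner_fmat_entries[of _ "Suc i" "Suc j"] dims_def if_distrib sum.If_cases cong: if_cong)
  ultimately show ?thesis using Cauchy_Schwarz_ineq2[of A "eunit i j"] by simp
qed

lemma compact_dims_norm_le: "compact {A. dims A m n \<and> norm A \<le> C}"
proof -
  let ?box = "{A. \<forall>i j. (if (i, j) \<in> {..<m} \<times> {..<n} then \<bar>entry A i j\<bar> \<le> C else entry A i j = 0)}"
  have "dims A m n \<and> norm A \<le> C \<longleftrightarrow> A \<in> ?box \<and> A \<in> cball 0 C" for A
  proof
    assume A: "dims A m n \<and> norm A \<le> C"
    then have "\<bar>entry A i j\<bar> \<le> C" for i j using abs_entry_le_norm[of A i j] by linarith
    then show "A \<in> ?box \<and> A \<in> cball 0 C" using A by (auto simp: dims_entry)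
  next
    assume A: "A \<in> ?box \<and> A \<in> cball 0 C"
    have "i < m \<and> j < n" if "entry A i j \<noteq> 0" for i j
    proof (rule ccontr)
      assume "\<not> (i < m \<and> j < n)"
      then have "(i, j) \<notin> {..<m} \<times> {..<n}" by simp
      with A that show False by (metis (mono_tags, lifting) mem_Collect_eq)
    qed
    moreover have "norm A \<le> C" using conjunct2[OF A] by simp
    ultimately show "dims A m n \<and> norm A \<le> C" by (simp only: dims_def) blast
  qed
  then have "{A. dims A m n \<and> norm A \<le> C} = ?box \<inter> cball 0 C" by blast
  then show ?thesis using compact_fmat_box[of "{..<m} \<times> {..<n}" C] by (simp only: compact_Int_closed closed_cball finite_cartesian_product finite_lessThan)
qed

lemma bounded_linear_tr: "bounded_linear tr"
  by (rule bounded_linear_intro[where K = 1]) auto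

lemmas continuous_on_tr [continuous_intros] = bounded_linear.continuous_on[OF bounded_linear_tr]

lemma compact_orth: "compact {U. orth N R U}"
proof -
  have "{U. orth N R U} = {U. dims U N R \<and> norm U \<le> sqrt (real R)} \<inter> {U. tr U * U = idf R}"
    using orth_norm by (auto simp: orth_def real_le_rsqrt)
  moreover have "closed {U. tr U * U = idf R}"
    by (intro closed_Collect_eq continuous_intros)
  ultimately show ?thesis using compact_dims_norm_le by (auto intro!: compact_Int_closed)
qed

section \<open>Squared distance to the matrices of rank at most \<open>R\<close>, and its
  minimisers\<close>

definition rank_dist :: "nat \<Rightarrow> nat \<Rightarrow> nat \<Rightarrow> fmat \<Rightarrow> real" where
  "rank_dist N T R Z = Inf {(norm (Z - l * tr f))\<^sup>2 | l f. dims l N R \<and> dims f T R}"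

lemma norm_residual_le:
  fixes P l f Z :: fmat
  assumes "tr P = P" "P * P = P" "P * l = l"
  shows "norm (Z - P * Z) \<le> norm (Z - l * f)"
proof -
  define r where "r = Z - P * Z"
  have eq: "Z - l * f = r + P * (Z - l * f)"
    using assms(3) by (simp add: r_def algebra_simps mult.assoc[symmetric])
  have "P * r = 0" using assms(2) by (simp add: r_def algebra_simps mult.assoc[symmetric])
  then have "inner r (P * (Z - l * f)) = 0" using assms(1) by (simp add: inner_mult_left)
  then have "(norm (Z - l * f))\<^sup>2 = (norm r)\<^sup>2 + (norm (P * (Z - l * f)))\<^sup>2"
    by (subst eq) (simp only: power2_norm_eq_inner inner_add_left inner_add_right inner_commute[of "P * (Z - l * f)" r])
  then have "(norm r)\<^sup>2 \<le> (norm (Z - l * f))\<^sup>2"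
    using zero_le_power2[of "norm (P * (Z - l * f))"] by linarith
  then have "norm r \<le> norm (Z - l * f)" by (rule power2_le_imp_le) (rule norm_ge_zero)
  then show ?thesis by (simp only: r_def)
qed

lemma rank_dist_le:
  assumes "dims Z N T" "orth N R U"
  shows "rank_dist N T R Z \<le> (norm (Z - U * tr U * Z))\<^sup>2"
  unfolding rank_dist_def
proof (rule cInf_lower)
  have "dims (tr Z * U) T R" using assms by (auto simp: orth_def intro!: dims_mult)
  moreover have "U * tr U * Z = U * tr (tr Z * U)" by (simp add: mult.assoc)
  ultimately show "(norm (Z - U * tr U * Z))\<^sup>2 \<in> {(norm (Z - l * tr f))\<^sup>2 | l f. dims l N R \<and> dims f T R}"
    using assms(2) unfolding orth_def by (intro CollectI exI[of _ U] exI[of _ "tr Z * U"]) auto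
qed (auto intro!: bdd_belowI[of _ 0])

text \<open>The residual can only shrink when \<open>l * tr f\<close> is replaced by the projection
  of \<open>Z\<close> onto a frame whose span contains the columns of \<open>l\<close>; so the
  infimum over factor pairs is governed by the compact set of frames.\<close>

lemma rank_dist_ge:
  assumes "R \<le> N" "\<And>V. orth N R V \<Longrightarrow> c \<le> (norm (Z - V * tr V * Z))\<^sup>2"
  shows "c \<le> rank_dist N T R Z"
  unfolding rank_dist_def
proof (rule cInf_greatest)
  show "{(norm (Z - l * tr f))\<^sup>2 | l f. dims l N R \<and> dims f T R} \<noteq> {}"
    using dims_zero by blast
  fix x assume "x \<in> {(norm (Z - l * tr f))\<^sup>2 | l f. dims l N R \<and> dims f T R}"
  then obtain l f where lf: "dims l N R" "x = (norm (Z - l * tr f))\<^sup>2" by blast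
  obtain V where V: "orth N R V" "V * (tr V * l) = l" using ex_orth_span[OF lf(1) assms(1)] by blast
  have "norm (Z - V * tr V * Z) \<le> norm (Z - l * tr f)"
    using orth_proj[OF V(1)] V(2) by (intro norm_residual_le) (auto simp: mult.assoc)
  then show "c \<le> x" using assms(2)[OF V(1)] lf(2)
    by (meson norm_ge_zero order_trans power_mono)
qed

text \<open>First order condition; \<open>t\<close> is the coefficient of the orthogonal projection
  of \<open>B\<close> onto the line of \<open>Y\<close>.\<close>

lemma inner_eq_0_of_minimal:
  fixes B Y :: "'a::real_inner"
  assumes "\<And>t. (norm B)\<^sup>2 \<le> (norm (B - t *\<^sub>R Y))\<^sup>2"
  shows "inner B Y = 0"
proof (cases "Y = 0")
  case False
  define t where "t = inner B Y / inner Y Y"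
  have "(norm (B - t *\<^sub>R Y))\<^sup>2 = (norm B)\<^sup>2 - 2 * t * inner B Y + t\<^sup>2 * inner Y Y"
    by (simp only: power2_norm_eq_inner) (simp add: algebra_simps inner_commute power2_eq_square)
  also have "t\<^sup>2 * inner Y Y = t * inner B Y" using False by (simp add: t_def power2_eq_square)
  finally have "t * inner B Y \<le> 0" using assms[of t] by simp
  then have "(inner B Y)\<^sup>2 / inner Y Y \<le> 0" by (simp add: t_def power2_eq_square)
  moreover have "0 < inner Y Y" using False by simp
  ultimately show ?thesis by (auto simp: divide_le_0_iff)
qed simp

text \<open>The third fact is stationarity in the left factor. It yields the orthogonality of
  residual and fit in the row direction; orthogonality in the column direction holds for any
  projection residual.\<close>

lemma ex_best_projection:
  assumes "R \<le> N" "dims Z N T"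
  obtains U where "orth N R U" "rank_dist N T R Z = (norm (Z - U * tr U * Z))\<^sup>2"
    "(Z - U * tr U * Z) * tr Z * U = 0"
proof -
  let ?\<phi> = "\<lambda>U. (norm (Z - U * tr U * Z))\<^sup>2"
  have "{U. orth N R U} \<noteq> {}" using ex_orth_span[of 0 N R] assms by auto
  moreover have "continuous_on {U. orth N R U} ?\<phi>" by (intro continuous_intros)
  ultimately obtain U where U: "orth N R U" "\<And>V. orth N R V \<Longrightarrow> ?\<phi> U \<le> ?\<phi> V"
    using continuous_attains_inf[OF compact_orth, of N R ?\<phi>] by blast
  have eq: "rank_dist N T R Z = ?\<phi> U"
    using rank_dist_ge[OF assms(1) U(2)] rank_dist_le[OF assms(2) U(1)] by (meson antisym)
  define B where "B = Z - U * tr U * Z"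
  define f where "f = tr Z * U"
  have d: "dims U N R" "dims f T R" "dims B N T"
    using U(1) assms unfolding f_def B_def orth_def by (auto intro!: dims_diff dims_mult)
  \<comment> \<open>The left factor is moved along \<open>B * f\<close>. The first order term is the
    inner product of \<open>B\<close> with \<open>B * f * tr f\<close>, that is the squared norm of
    \<open>B * f\<close>.\<close>
  have "(norm B)\<^sup>2 \<le> (norm (B - t *\<^sub>R (B * f * tr f)))\<^sup>2" for t
  proof -
    let ?l = "U + t *\<^sub>R (B * f)"
    have "dims ?l N R" using d by (auto intro!: dims_add dims_mult)
    moreover have "B - t *\<^sub>R (B * f * tr f) = Z - ?l * tr f"
      by (simp add: B_def f_def algebra_simps)
    ultimately have "rank_dist N T R Z \<le> (norm (B - t *\<^sub>R (B * f * tr f)))\<^sup>2"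
      unfolding rank_dist_def using d(2) by (intro cInf_lower) (auto intro!: bdd_belowI[of _ 0])
    then show ?thesis by (simp add: eq B_def)
  qed
  then have "inner B (B * f * tr f) = 0" by (rule inner_eq_0_of_minimal)
  then have "inner (B * f) (B * f) = 0" by (simp only: inner_mult_right tr_real_vector)
  then have "B * f = 0" by simp
  with U(1) eq show thesis by (intro that) (auto simp: B_def f_def mult.assoc)
qed

section \<open>Perturbation of the truncated residual\<close>

text \<open>A bound on the spectral norm, tested against matrices in Frobenius norm. In this form a
  product is estimated by the Frobenius norm of one factor and spectral bounds for the
  others.\<close>

definition op_bound :: "fmat \<Rightarrow> real \<Rightarrow> bool" where
  "op_bound A \<alpha> \<longleftrightarrow> 0 \<le> \<alpha> \<and> (\<forall>X. norm (A * X) \<le> \<alpha> * norm X)"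

lemma op_bound_norm: "op_bound A (norm A)"
  by (simp add: op_bound_def norm_mult_ineq)

lemma op_bound_mono: "op_bound A \<alpha> \<Longrightarrow> \<alpha> \<le> \<beta> \<Longrightarrow> op_bound A \<beta>"
  unfolding op_bound_def by (meson mult_right_mono norm_ge_zero order_trans)

lemma op_bound_add:
  assumes "op_bound A \<alpha>" "op_bound B \<beta>" shows "op_bound (A + B) (\<alpha> + \<beta>)"
  unfolding op_bound_def
proof (intro conjI allI)
  show "0 \<le> \<alpha> + \<beta>" using assms by (simp add: op_bound_def)
  fix X
  have "norm ((A + B) * X) \<le> norm (A * X) + norm (B * X)"
    unfolding distrib_right by (rule norm_triangle_ineq)
  moreover have "norm (A * X) \<le> \<alpha> * norm X" "norm (B * X) \<le> \<beta> * norm X"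
    using assms by (simp_all add: op_bound_def)
  ultimately show "norm ((A + B) * X) \<le> (\<alpha> + \<beta>) * norm X"
    unfolding distrib_right by linarith
qed

lemma op_bound_minus: "op_bound A \<alpha> \<Longrightarrow> op_bound (- A) \<alpha>"
  by (simp add: op_bound_def)

lemma op_bound_diff: "op_bound A \<alpha> \<Longrightarrow> op_bound B \<beta> \<Longrightarrow> op_bound (A - B) (\<alpha> + \<beta>)"
  using op_bound_add[of A \<alpha> "- B" \<beta>] op_bound_minus by simp

text \<open>Writing n for ||A' X|| and moving A' to the other side of the inner product gives n^2
  \<le> \<alpha> n ||X||; one factor n cancels.\<close>

lemma op_bound_tr:
  assumes "op_bound A \<alpha>" shows "op_bound (tr A) \<alpha>"
  unfolding op_bound_def
proof (intro conjI allI)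
  show a: "0 \<le> \<alpha>" using assms by (simp add: op_bound_def)
  fix X
  define n where "n = norm (tr A * X)"
  have "n * n = inner (tr A * X) (tr A * X)" by (simp only: n_def norm_eq_sqrt_inner) simp
  also have "\<dots> = inner (A * (tr A * X)) X" by (simp only: inner_mult_left tr_real_vector)
  also have "\<dots> \<le> norm (A * (tr A * X)) * norm X" by (rule norm_cauchy_schwarz)
  also have "\<dots> \<le> (\<alpha> * n) * norm X"
    using assms by (intro mult_right_mono) (simp_all add: op_bound_def n_def)
  finally have "n * n \<le> n * (\<alpha> * norm X)" by (simp only: mult_ac)
  moreover have "0 \<le> n" "0 \<le> \<alpha> * norm X" using a by (simp_all add: n_def)
  ultimately have "n \<le> \<alpha> * norm X" by (metis less_eq_real_def mult_le_cancel_left_pos)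
  then show "norm (tr A * X) \<le> \<alpha> * norm X" by (simp only: n_def)
qed

lemma norm_mult_op_bound_left:
  assumes "op_bound A \<alpha>" "norm X \<le> \<xi>" shows "norm (A * X) \<le> \<alpha> * \<xi>"
  using assms unfolding op_bound_def by (meson mult_left_mono order_trans)

lemma norm_mult_op_bound_right:
  assumes "op_bound A \<alpha>" "norm X \<le> \<xi>" shows "norm (X * A) \<le> \<xi> * \<alpha>"
  using norm_mult_op_bound_left[OF op_bound_tr[OF assms(1)], of "tr X" \<xi>] assms(2)
  by (metis mult.commute norm_tr tr_mult)

lemma op_bound_proj:
  assumes "tr P = P" "P * P = P" shows "op_bound P 1"
  unfolding op_bound_def
proof (intro conjI allI)
  fix X
  define n where "n = norm (P * X)"
  have "n * n = inner (P * X) (P * X)" by (simp only: n_def norm_eq_sqrt_inner) simp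
  also have "\<dots> = inner (P * P * X) X" by (simp only: inner_mult_left assms mult.assoc[symmetric])
  also have "\<dots> \<le> n * norm X" unfolding n_def assms by (rule norm_cauchy_schwarz)
  finally have "n \<le> norm X"
    by (metis n_def less_eq_real_def mult_le_cancel_left_pos norm_ge_zero)
  then show "norm (P * X) \<le> 1 * norm X" by (simp add: n_def)
qed simp

lemma proj_Pythagoras:
  assumes "tr P = P" "P * P = P"
  shows "(norm (X - P * X))\<^sup>2 = (norm X)\<^sup>2 - (norm (P * X))\<^sup>2"
proof -
  have "inner (P * X) (P * X) = inner (P * P * X) X" by (simp only: inner_mult_left assms mult.assoc[symmetric])
  then have *: "inner (P * X) (P * X) = inner (P * X) X" unfolding assms .
  show ?thesis
    unfolding power2_norm_eq_inner inner_diff_left inner_diff_right * inner_commute[of X "P * X"] by simp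
qed

lemma proj_compl_norm:
  assumes "tr P = P" "P * P = P"
  shows "norm (X - P * X) \<le> norm X"
  by (rule power2_le_imp_le) (simp_all add: proj_Pythagoras[OF assms])

lemma proj_inner:
  assumes "tr P = P" "P * P = P" "tr V = V" "V * V = V"
  shows "(norm (P * V))\<^sup>2 = inner P V"
proof -
  have "inner (P * V) (P * V) = inner (P * P * V) V"
    by (simp only: inner_mult_left assms mult.assoc[symmetric])
  also have "\<dots> = inner P (V * tr V)" unfolding assms(2) inner_mult_right tr_real_vector
    by (subst inner_commute) (simp only: inner_mult_right assms inner_commute)
  finally show ?thesis by (simp only: power2_norm_eq_inner assms)
qed

text \<open>Signal \<open>G\<close>, noise \<open>E\<close>, and \<open>K\<close> the Moore-Penrose
  inverse of \<open>G\<close>, given by the four Penrose equations. Then \<open>G * K\<close> and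
  \<open>K * G\<close> project onto the column and row space of \<open>G\<close>, and their squared
  norm \<open>R\<close> is the rank. The bound on \<open>K\<close> is in Frobenius norm, so every
  product with a factor \<open>K\<close> inherits a Frobenius bound. The factors \<open>l\<close>
  and \<open>g\<close> show that \<open>G * K * Z\<close> competes in \<open>rank_dist\<close>. The
  condition \<open>small\<close> separates the singular values of the signal from those of the
  noise.\<close>

locale factor_perturbation =
  fixes N T R :: nat and G K E l g :: fmat and s \<epsilon> :: real
  assumes R_le: "R \<le> N"
    and dG: "dims G N T" and dK: "dims K T N" and dE: "dims E N T"
    and GKG: "G * K * G = G" and KGK: "K * G * K = K"
    and trGK: "tr (G * K) = G * K" and trKG: "tr (K * G) = K * G"
    and GK: "G * K = l * tr g" and dl: "dims l N R" and dg: "dims g N R"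
    and nGK: "(norm (G * K))\<^sup>2 = real R" and nKG: "(norm (K * G))\<^sup>2 = real R"
    and s: "0 < s" and nK: "norm K \<le> 1 / s"
    and E: "op_bound E \<epsilon>" and small: "4 * ((3 * sqrt (real R) + 2) * \<epsilon>) \<le> s"
begin

definition "Z = G + E"
definition "P0 = G * K"
definition "Q0 = K * G"
definition "M0 = idf N - P0"
definition "N0 = idf T - Q0"
text \<open>A spectral norm bound for the residual \<open>B\<close> and for \<open>D = E - B\<close> below: optimality gives
  \<open>norm (G - P * G) \<le> 3 * sqrt R * \<epsilon>\<close>, to which passing from \<open>G\<close> to \<open>B\<close> and \<open>D\<close> adds at most
  \<open>2 * \<epsilon>\<close>.\<close>

definition "y = (3 * sqrt (real R) + 2) * \<epsilon>"

lemma P0: "tr P0 = P0" "P0 * P0 = P0" "P0 * G = G" "K * P0 = K" "dims P0 N N"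
  using GKG KGK trGK dG dK by (auto simp: P0_def mult.assoc)

lemma Q0: "tr Q0 = Q0" "Q0 * Q0 = Q0" "G * Q0 = G" "Q0 * K = K" "dims Q0 T T"
  using GKG KGK trKG dG dK by (auto simp: Q0_def mult.assoc)

lemma M0_mult: "dims X N m \<Longrightarrow> M0 * X = X - P0 * X"
  by (simp add: M0_def left_diff_distrib)

lemma mult_N0: "dims X m T \<Longrightarrow> X * N0 = X - X * Q0"
  by (simp add: N0_def right_diff_distrib)

lemma M0: "tr M0 = M0" "M0 * M0 = M0" "dims M0 N N" "M0 * G = 0"
proof -
  show d: "dims M0 N N" using P0 by (auto simp: M0_def)
  show "tr M0 = M0" using P0 by (simp add: M0_def)
  have "P0 * M0 = 0" using P0 by (simp add: M0_def right_diff_distrib)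
  then show "M0 * M0 = M0" using M0_mult[OF d] by simp
  show "M0 * G = 0" using M0_mult[OF dG] P0 by simp
qed

lemma N0: "tr N0 = N0" "N0 * N0 = N0" "dims N0 T T" "G * N0 = 0"
proof -
  show d: "dims N0 T T" using Q0 by (auto simp: N0_def)
  show "tr N0 = N0" using Q0 by (simp add: N0_def)
  have "N0 * Q0 = 0" using Q0 by (simp add: N0_def left_diff_distrib)
  then show "N0 * N0 = N0" using mult_N0[OF d] by simp
  show "G * N0 = 0" using mult_N0[OF dG] Q0 by simp
qed

lemma dZ: "dims Z N T" using dG dE by (auto simp: Z_def)

lemma eps: "0 \<le> \<epsilon>" using E by (simp add: op_bound_def)

lemma eps_y: "\<epsilon> \<le> y" "0 \<le> y" "sqrt (real R) * \<epsilon> * 3 \<le> y" "4 * y \<le> s"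
proof -
  have "0 \<le> sqrt (real R) * \<epsilon>" using eps by simp
  then show "\<epsilon> \<le> y" "0 \<le> y" "sqrt (real R) * \<epsilon> * 3 \<le> y"
    using eps unfolding y_def by (simp_all add: algebra_simps)
  show "4 * y \<le> s" using small by (simp add: y_def)
qed

end

text \<open>Below, \<open>Gh\<close> is the fitted matrix of rank at most \<open>R\<close>,
  \<open>B\<close> the residual, and \<open>D\<close> the error \<open>Gh - G\<close> of the fit, in
  the form \<open>E - B\<close>.\<close>

locale factor_minimizer = factor_perturbation +
  fixes U :: fmat
  assumes U: "orth N R U"
    and U_min: "rank_dist N T R Z = (norm (Z - U * tr U * Z))\<^sup>2"
    and U_crit: "(Z - U * tr U * Z) * tr Z * U = 0"
begin

definition "P = U * tr U"
definition "Gh = P * Z"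
definition "B = Z - Gh"
definition "D = E - B"

lemmas P = orth_proj[OF U, folded P_def]

lemma dB: "dims Gh N T" "dims B N T" "dims D N T"
  unfolding B_def D_def Gh_def using P dZ dE by auto

lemma rank_dist_Z: "rank_dist N T R Z = (norm B)\<^sup>2"
  using U_min by (simp add: B_def Gh_def P_def)

lemma Gh: "Gh = G + D" "P * Gh = Gh" "P * B = 0" "tr B * P = 0" "B * tr Gh = 0"
proof -
  show "Gh = G + D" by (simp add: D_def B_def Z_def)
  show PGh: "P * Gh = Gh" using P by (simp add: Gh_def mult.assoc[symmetric])
  then show "P * B = 0" by (simp add: B_def right_diff_distrib Gh_def)
  then have "tr (P * B) = 0" by simp
  then show "tr B * P = 0" using P by simp
  have "B * tr Gh = (Z - U * tr U * Z) * tr Z * U * tr U"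
    using P(1) unfolding Gh_def B_def tr_mult by (simp add: P_def mult.assoc)
  then show "B * tr Gh = 0" using U_crit by simp
qed

text \<open>From \<open>B * tr Gh = 0\<close> and \<open>Gh = G + D\<close> comes
  \<open>B * tr G = - (B * tr D)\<close>; multiplying by \<open>tr K\<close> turns
  \<open>tr G\<close> into \<open>Q0\<close>. The part of the residual in the row space of the
  signal is thus of second order. \<open>P0B\<close> is the mirror image.\<close>

lemma BQ0: "B * Q0 = - (B * tr D * tr K)"
proof -
  have "B * tr G = - (B * tr D)"
    using Gh(5) unfolding Gh(1) tr_real_vector distrib_left by (simp add: eq_neg_iff_add_eq_0)
  moreover have "B * Q0 = B * tr G * tr K"
    using Q0(1) unfolding Q0_def by (metis mult.assoc tr_mult)
  ultimately show ?thesis by simp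
qed

lemma P0B: "P0 * B = - (tr K * tr D * B)"
proof -
  have "tr Gh * B = tr Z * (P * B)" using P(1) by (simp add: Gh_def mult.assoc)
  then have "tr Gh * B = 0" by (simp add: Gh(3))
  then have "tr G * B = - (tr D * B)"
    unfolding Gh(1) tr_real_vector distrib_right by (simp add: eq_neg_iff_add_eq_0)
  moreover have "P0 * B = tr K * (tr G * B)"
    using P0(1) unfolding P0_def by (metis mult.assoc tr_mult)
  ultimately show ?thesis by (simp add: mult.assoc)
qed

text \<open>Since \<open>P\<close> fits at least as well as \<open>P0\<close>, the norm of
  \<open>P * Z\<close> is at least that of \<open>P0 * Z\<close>. Expanding both leaves x^2 \<le> 2
  a x + a^2 with x = ||G - P G|| and a = sqrt(R) \<epsilon>, hence x \<le> (1 + sqrt 2) a, rounded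
  up to 3 a.\<close>

lemma norm_G_residual: "norm (G - P * G) \<le> 3 * (sqrt (real R) * \<epsilon>)"
proof -
  define x where "x = norm (G - P * G)"
  define a where "a = sqrt (real R) * \<epsilon>"
  have a: "0 \<le> a" using eps by (simp add: a_def)
  have nP: "norm P \<le> sqrt (real R)" "norm Q0 \<le> sqrt (real R)"
    using P(4) nKG by (simp_all add: Q0_def real_le_rsqrt)
  have "rank_dist N T R Z \<le> (norm (Z - l * tr (tr Z * g)))\<^sup>2"
    unfolding rank_dist_def
  proof (rule cInf_lower)
    have "dims (tr Z * g) T R" using dZ dg by (intro dims_mult[of _ _ N]) auto
    then show "(norm (Z - l * tr (tr Z * g)))\<^sup>2 \<in> {(norm (Z - l * tr f))\<^sup>2 |l f. dims l N R \<and> dims f T R}"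
      using dl by blast
  qed (auto intro!: bdd_belowI[of _ 0])
  moreover have "l * tr (tr Z * g) = P0 * Z" by (simp add: P0_def GK mult.assoc)
  ultimately have "(norm (Z - P * Z))\<^sup>2 \<le> (norm (Z - P0 * Z))\<^sup>2"
    using rank_dist_Z by (simp add: B_def Gh_def)
  then have "(norm (P0 * Z))\<^sup>2 \<le> (norm (P * Z))\<^sup>2"
    unfolding proj_Pythagoras[OF P(1,2)] proj_Pythagoras[OF P0(1,2)] by simp
  moreover have "(norm (P0 * Z))\<^sup>2 = (norm G)\<^sup>2 + 2 * inner G E + (norm (P0 * E))\<^sup>2"
  proof -
    have "P0 * Z = G + P0 * E" using P0 by (simp add: Z_def distrib_left)
    moreover have "inner G (P0 * E) = inner G E" using P0 by (simp add: inner_mult_left)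
    ultimately show ?thesis
      by (simp only: power2_norm_eq_inner inner_add_left inner_add_right inner_commute[of "P0 * E" G])
  qed
  moreover have "(norm (P * Z))\<^sup>2 = (norm (P * G))\<^sup>2 + 2 * inner (P * G) E + (norm (P * E))\<^sup>2"
  proof -
    have "P * Z = P * G + P * E" by (simp add: Z_def distrib_left)
    moreover have "inner (P * G) (P * E) = inner (P * G) E"
      using P(1,2) by (simp add: inner_mult_left mult.assoc[symmetric])
    ultimately show ?thesis
      by (simp only: power2_norm_eq_inner inner_add_left inner_add_right inner_commute[of "P * E" "P * G"])
  qed
  moreover have "x\<^sup>2 = (norm G)\<^sup>2 - (norm (P * G))\<^sup>2"
    unfolding x_def by (rule proj_Pythagoras[OF P(1,2)])
  \<comment> \<open>The comparison as linear arithmetic over the squared norms; \<open>c\<close>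
    stands for the discarded ||P0 E||^2.\<close>
  moreover have "w \<le> 2 * d - 2 * b + h"
    if "u \<le> v" "u = a + 2 * b + c" "v = e + 2 * d + h" "w = a - e" "0 \<le> c" for u v w a b c d e h :: real
    using that by linarith
  ultimately have x2: "x\<^sup>2 \<le> 2 * inner (P * G - G) E + (norm (P * E))\<^sup>2"
    unfolding inner_diff_left right_diff_distrib using zero_le_power2 by blast
  \<comment> \<open>\<open>Q0\<close> can be inserted because \<open>G * Q0 = G\<close>; its rank
    \<open>R\<close> converts the spectral bound on \<open>E\<close> into a Frobenius bound on
    \<open>E * Q0\<close>.\<close>
  have "inner (P * G - G) E = inner E ((P * G - G) * Q0)"
    using Q0(3) by (simp add: left_diff_distrib mult.assoc inner_commute)
  also have "\<dots> = inner (E * Q0) (P * G - G)" using Q0(1) by (simp only: inner_mult_right)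
  also have "\<dots> \<le> norm (E * Q0) * norm (P * G - G)" by (rule norm_cauchy_schwarz)
  also have "\<dots> \<le> (\<epsilon> * sqrt (real R)) * x"
    unfolding x_def norm_minus_commute[of "P * G"]
    by (intro mult_right_mono norm_mult_op_bound_left[OF E] nP norm_ge_zero)
  finally have "inner (P * G - G) E \<le> a * x" by (simp only: a_def mult_ac)
  moreover have "norm (P * E) \<le> a"
    unfolding a_def by (rule norm_mult_op_bound_right[OF E nP(1)])
  then have "(norm (P * E))\<^sup>2 \<le> a\<^sup>2" by (simp add: power_mono)
  ultimately have "(x - a)\<^sup>2 \<le> 2 * a\<^sup>2" using x2 by (simp add: power2_diff algebra_simps)
  also have "\<dots> \<le> (2 * a)\<^sup>2" by (simp add: power_mult_distrib)
  finally have "x - a \<le> 2 * a" using a by (metis abs_le_square_iff abs_of_nonneg mult_nonneg_nonneg order_trans abs_ge_self zero_le_numeral)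
  then have "x \<le> 3 * a" by simp
  then show ?thesis by (simp only: x_def a_def)
qed

lemma op_bound_B: "op_bound B y" and op_bound_D: "op_bound D y" and op_bound_E: "op_bound E y"
proof -
  show "op_bound E y" using op_bound_mono[OF E eps_y(1)] .
  have "op_bound (G - P * G) (3 * (sqrt (real R) * \<epsilon>))"
    by (rule op_bound_mono[OF op_bound_norm norm_G_residual])
  moreover have "op_bound (E - P * E) \<epsilon>"
    unfolding op_bound_def
  proof (intro conjI allI)
    fix X
    have "norm ((E - P * E) * X) \<le> norm (E * X)"
      using proj_compl_norm[OF P(1,2), of "E * X"] by (simp add: left_diff_distrib mult.assoc)
    then show "norm ((E - P * E) * X) \<le> \<epsilon> * norm X" using E unfolding op_bound_def by (meson order_trans)
  qed (rule eps)
  moreover have "B = (G - P * G) + (E - P * E)"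
    by (simp add: B_def Gh_def Z_def distrib_left)
  ultimately have B: "op_bound B (3 * (sqrt (real R) * \<epsilon>) + \<epsilon>)" by (simp only: op_bound_add)
  then show "op_bound B y" by (rule op_bound_mono) (use eps in \<open>simp add: y_def algebra_simps\<close>)
  show "op_bound D y"
    unfolding D_def by (rule op_bound_mono[OF op_bound_diff[OF E B]]) (simp add: y_def algebra_simps)
qed

text \<open>The number R - <P, V> is the sum of the squared sines of the principal angles between
  the two ranges. Equal ranks make this gap symmetric in \<open>P\<close> and
  \<open>V\<close>.\<close>

lemma proj_gap:
  assumes "tr V = V" "V * V = V" "(norm V)\<^sup>2 = real R"
  shows "(norm (V - P * V))\<^sup>2 = real R - inner P V"
    and "(norm (P - V * P))\<^sup>2 = real R - inner P V"
    and "(norm (P - P * V))\<^sup>2 = real R - inner P V"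
    and "(norm (P - V))\<^sup>2 = 2 * (real R - inner P V)"
proof -
  note A = proj_inner[OF P(1,2) assms(1,2)] proj_inner[OF assms(1,2) P(1,2)]
  show "(norm (V - P * V))\<^sup>2 = real R - inner P V"
    using proj_Pythagoras[OF P(1,2), of V] A assms(3) by simp
  show 1: "(norm (P - V * P))\<^sup>2 = real R - inner P V"
    using proj_Pythagoras[OF assms(1,2), of P] A P(4) by (simp add: inner_commute)
  have "P - P * V = tr (P - V * P)" using P(1) assms(1) by simp
  then show "(norm (P - P * V))\<^sup>2 = real R - inner P V" using 1 by (simp only: norm_tr)
  show "(norm (P - V))\<^sup>2 = 2 * (real R - inner P V)"
    using P(4) assms(3) unfolding power2_norm_eq_inner inner_diff_left inner_diff_right
    by (simp add: inner_commute)
qed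

text \<open>By the symmetry of the gap, (1 - P0) P has the same norm as (1 - P) P0 = (G - P G) K,
  which the bound on the residual of \<open>G\<close> controls.\<close>

lemma norm_M0P: "norm (M0 * P) \<le> y / s"
proof -
  have "M0 * P = P - P0 * P" using M0_mult P(3) .
  then have "(norm (M0 * P))\<^sup>2 = (norm (P0 - P * P0))\<^sup>2"
    using proj_gap(1,2)[OF P0(1,2)] nGK by (simp add: P0_def)
  then have "norm (M0 * P) = norm (P0 - P * P0)" by simp
  also have "P0 - P * P0 = (G - P * G) * K" by (simp add: P0_def left_diff_distrib mult.assoc)
  also have "norm \<dots> \<le> norm (G - P * G) * norm K" by (rule norm_mult_ineq)
  also have "\<dots> \<le> y * (1 / s)"
    using norm_G_residual nK eps_y by (intro mult_mono) auto
  finally show ?thesis by simp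
qed

text \<open>A lower bound for the nonzero singular values of the fit. On the range of
  \<open>P\<close>, where W differs from P0 W by at most (y / s) ||W||, the matrix
  \<open>tr G\<close> is bounded below by \<open>s - y\<close>; passing from \<open>G\<close> to
  \<open>Gh\<close> costs another \<open>y\<close>.\<close>

lemma norm_P_le: "(s - 2 * y) * norm (P * X) \<le> norm (tr Gh * (P * X))"
proof -
  define W where "W = P * X"
  have PW: "P * W = W" using P(2) by (simp add: W_def mult.assoc[symmetric])
  have "M0 * W = M0 * P * W" using PW by (simp add: mult.assoc)
  moreover have "M0 * W = W - P0 * W"
    using M0_mult[OF P(3)] by (simp add: W_def mult.assoc[symmetric] left_diff_distrib)
  ultimately have "W = P0 * W + M0 * P * W" by (metis add.commute diff_add_cancel)
  then have "norm W \<le> norm (P0 * W) + norm (M0 * P * W)"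
    by (metis norm_triangle_ineq)
  also have "P0 * W = tr K * (tr G * W)"
    using P0(1) unfolding P0_def by (metis mult.assoc tr_mult)
  also have "norm \<dots> \<le> (1 / s) * norm (tr G * W)"
    using nK by (intro norm_mult_op_bound_left[OF op_bound_mono[OF op_bound_norm]]) auto
  also have "norm (M0 * P * W) \<le> y / s * norm W"
    by (rule norm_mult_op_bound_left[OF op_bound_mono[OF op_bound_norm norm_M0P] order_refl])
  finally have "norm W \<le> 1 / s * norm (tr G * W) + y / s * norm W" by simp
  then have "s * norm W \<le> norm (tr G * W) + y * norm W"
    using s by (simp add: field_simps)
  moreover have "norm (tr G * W) \<le> norm (tr Gh * W) + norm (tr D * W)"
    using norm_triangle_ineq4[of "tr Gh * W" "tr D * W"] by (simp add: Gh(1) distrib_right)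
  moreover have "norm (tr D * W) \<le> y * norm W"
    by (rule norm_mult_op_bound_left[OF op_bound_tr[OF op_bound_D] order_refl])
  ultimately have "(s - 2 * y) * norm W \<le> norm (tr Gh * W)" by (simp add: algebra_simps)
  then show ?thesis by (simp only: W_def)
qed

text \<open>Spectral gap: the squared lower bound for the nonzero singular values of
  \<open>Gh\<close> minus the squared upper bound for those of \<open>B\<close>. It is positive
  because 4 y \<le> s and s > 0.\<close>

definition "\<gamma> = (s - 2 * y)\<^sup>2 - y\<^sup>2"

lemma gamma_pos: "0 < \<gamma>"
proof -
  have "y < s - 2 * y" using eps_y s by linarith
  then have "y\<^sup>2 < (s - 2 * y)\<^sup>2" using eps_y(2) by (intro power_strict_mono) auto
  then show ?thesis by (simp add: \<gamma>_def)
qed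

text \<open>Both orthogonality relations kill the cross terms, so the loss of \<open>V\<close>
  exceeds that of \<open>P\<close> by ||Gh - V Gh||^2 - ||V B||^2. With \<tau> = R - <P, V>, the
  first term is at least (s - 2 y)^2 \<tau>, the second at most y^2 \<tau>, and ||P - V||^2 = 2
  \<tau>.\<close>

lemma residual_growth:
  assumes V: "tr V = V" "V * V = V" "(norm V)\<^sup>2 = real R"
  shows "(norm B)\<^sup>2 + \<gamma> / 2 * (norm (P - V))\<^sup>2 \<le> (norm (Z - V * Z))\<^sup>2"
proof -
  define \<tau> where "\<tau> = real R - inner P V"
  have BGh: "inner Gh B = 0" using Gh(2,3) P(1) by (metis inner_mult_left inner_commute inner_zero_left)
  have VV: "inner (V * Gh) (V * B) = 0"
  proof -
    have "inner (V * Gh) (V * B) = inner (V * V * Gh) B"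
      unfolding inner_mult_left V(1) by (simp only: mult.assoc)
    also have "\<dots> = inner B (V * Gh)" by (simp only: V(2) inner_commute)
    also have "\<dots> = inner (B * tr Gh) V" by (rule inner_mult_right)
    finally show ?thesis by (simp add: Gh(5))
  qed
  have Z: "Z = Gh + B" by (simp add: B_def)
  have "(norm Z)\<^sup>2 = (norm Gh)\<^sup>2 + (norm B)\<^sup>2"
    unfolding Z power2_norm_eq_inner inner_add_left inner_add_right inner_commute[of B Gh] BGh by simp
  moreover have "(norm (V * Z))\<^sup>2 = (norm (V * Gh))\<^sup>2 + (norm (V * B))\<^sup>2"
    unfolding Z power2_norm_eq_inner distrib_left inner_add_left inner_add_right
      inner_commute[of "V * B" "V * Gh"] VV by simp
  ultimately have eq: "(norm (Z - V * Z))\<^sup>2 = (norm B)\<^sup>2 + (norm (Gh - V * Gh))\<^sup>2 - (norm (V * B))\<^sup>2"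
    unfolding proj_Pythagoras[OF V(1,2)] by simp
  have "norm (Gh - V * Gh) = norm (tr Gh * (P * (P - P * V)))"
  proof -
    have "tr Gh * P = tr Gh" using Gh(2) P(1) by (metis tr_mult)
    then have "tr Gh * (P * (P - P * V)) = tr Gh - tr Gh * V"
      using P(2) by (simp add: right_diff_distrib mult.assoc[symmetric])
    also have "\<dots> = tr (Gh - V * Gh)" using V by simp
    finally show ?thesis by (simp only: norm_tr)
  qed
  moreover have "P * (P - P * V) = P - P * V" using P(2) by (simp add: right_diff_distrib mult.assoc[symmetric])
  ultimately have "(s - 2 * y) * norm (P - P * V) \<le> norm (Gh - V * Gh)"
    using norm_P_le[of "P - P * V"] by simp
  then have "((s - 2 * y) * norm (P - P * V))\<^sup>2 \<le> (norm (Gh - V * Gh))\<^sup>2"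
    using eps_y s by (intro power_mono) auto
  then have 1: "(s - 2 * y)\<^sup>2 * \<tau> \<le> (norm (Gh - V * Gh))\<^sup>2"
    using proj_gap(3)[OF V] by (simp add: power_mult_distrib \<tau>_def)
  have "norm (V * B) = norm (tr B * (V - P * V))"
  proof -
    have "tr B * (V - P * V) = tr (V * B)"
      using V Gh(4) by (simp add: right_diff_distrib mult.assoc[symmetric])
    then show ?thesis by (simp only: norm_tr)
  qed
  also have "\<dots> \<le> y * norm (V - P * V)"
    by (rule norm_mult_op_bound_left[OF op_bound_tr[OF op_bound_B] order_refl])
  finally have "(norm (V * B))\<^sup>2 \<le> (y * norm (V - P * V))\<^sup>2" by (intro power_mono) auto
  then have 2: "(norm (V * B))\<^sup>2 \<le> y\<^sup>2 * \<tau>"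
    using proj_gap(1)[OF V] by (simp add: power_mult_distrib \<tau>_def)
  have 3: "\<gamma> / 2 * (norm (P - V))\<^sup>2 = \<gamma> * \<tau>"
    using proj_gap(4)[OF V] by (simp add: \<tau>_def)
  have "\<gamma> * \<tau> = (s - 2 * y)\<^sup>2 * \<tau> - y\<^sup>2 * \<tau>" by (simp only: \<gamma>_def left_diff_distrib)
  then show ?thesis using 1 2 3 eq by linarith
qed

text \<open>Upper bound: keep \<open>P\<close> for the perturbed matrix. Lower bound: a competing
  \<open>V\<close> gains at most a cross term linear in ||P - V||, which the quadratic growth
  outweighs up to a multiple of ||H||^2. The constant may depend on \<open>Z\<close>, since only
  differentiability at \<open>Z\<close> is drawn from it.\<close>

lemma rank_dist_expansion:
  assumes H: "dims H N T"
  shows "\<bar>rank_dist N T R (Z + H) - rank_dist N T R Z - 2 * inner B H\<bar>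
    \<le> (1 + 2 * (norm Z)\<^sup>2 / \<gamma>) * (norm H)\<^sup>2"
proof -
  define C where "C = 2 * (norm Z)\<^sup>2 / \<gamma>"
  have C: "0 \<le> C" using gamma_pos by (simp add: C_def)
  have d: "dims (Z + H) N T" using dZ H by auto
  have up: "rank_dist N T R (Z + H) \<le> (norm B)\<^sup>2 + 2 * inner B H + (norm H)\<^sup>2"
  proof -
    have "rank_dist N T R (Z + H) \<le> (norm (Z + H - P * (Z + H)))\<^sup>2"
      using rank_dist_le[OF d U] by (simp add: P_def)
    also have "Z + H - P * (Z + H) = B + (H - P * H)"
      by (simp add: B_def Gh_def distrib_left)
    also have "(norm (B + (H - P * H)))\<^sup>2 = (norm B)\<^sup>2 + 2 * inner B H + (norm (H - P * H))\<^sup>2"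
    proof -
      have "inner B (P * H) = 0" using Gh(3) P(1) by (simp add: inner_mult_left)
      then have "inner B (H - P * H) = inner B H" by (simp add: inner_diff_right)
      then show ?thesis
        by (simp only: power2_norm_eq_inner inner_add_left inner_add_right inner_commute[of "H - P * H" B])
    qed
    also have "(norm (H - P * H))\<^sup>2 \<le> (norm H)\<^sup>2"
      using proj_compl_norm[OF P(1,2)] by (intro power_mono) auto
    finally show ?thesis by simp
  qed
  have low: "(norm B)\<^sup>2 + 2 * inner B H - C * (norm H)\<^sup>2 \<le> rank_dist N T R (Z + H)"
  proof (rule rank_dist_ge[OF R_le])
    fix V1 assume V1: "orth N R V1"
    define V where "V = V1 * tr V1"
    note V = orth_proj[OF V1, folded V_def]
    define p where "p = norm (P - V)"
    have "Z + H - V * (Z + H) = (Z - V * Z) + (H - V * H)" by (simp add: distrib_left)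
    moreover have "inner (Z - V * Z) (H - V * H) = inner (Z - V * Z) H"
    proof -
      have "V * (Z - V * Z) = 0" using V(2) by (simp add: right_diff_distrib mult.assoc[symmetric])
      then have "inner (Z - V * Z) (V * H) = 0" using V(1) by (simp add: inner_mult_left)
      then show ?thesis by (simp add: inner_diff_right)
    qed
    ultimately have 1: "(norm (Z + H - V * (Z + H)))\<^sup>2
        = (norm (Z - V * Z))\<^sup>2 + 2 * inner (Z - V * Z) H + (norm (H - V * H))\<^sup>2"
      by (simp only: power2_norm_eq_inner inner_add_left inner_add_right inner_commute[of "H - V * H" "Z - V * Z"])
    have 2: "inner (Z - V * Z) H = inner B H + inner ((P - V) * Z) H"
      by (simp add: B_def Gh_def left_diff_distrib inner_diff_left)
    have "\<bar>inner ((P - V) * Z) H\<bar> \<le> norm ((P - V) * Z) * norm H" by (rule Cauchy_Schwarz_ineq2)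
    also have "\<dots> \<le> p * norm Z * norm H"
      unfolding p_def by (intro mult_right_mono norm_mult_ineq) auto
    finally have 3: "- (p * norm Z * norm H) \<le> inner ((P - V) * Z) H" by linarith
    have 4: "\<gamma> / 2 * p\<^sup>2 - 2 * (p * norm Z * norm H) \<ge> - (C * (norm H)\<^sup>2)"
    proof -
      \<comment> \<open>Completing the square in \<open>p\<close> is the origin of the constant
        \<open>C\<close>.\<close>
      have "0 \<le> (\<gamma> * p - 2 * (norm Z * norm H))\<^sup>2 / (2 * \<gamma>)" using gamma_pos by simp
      also have "\<dots> = \<gamma> / 2 * p\<^sup>2 - 2 * (p * norm Z * norm H) + C * (norm H)\<^sup>2"
        using gamma_pos by (simp add: C_def power2_eq_square field_simps)
      finally show ?thesis by simp
    qed
    have "(norm B)\<^sup>2 + \<gamma> / 2 * p\<^sup>2 \<le> (norm (Z - V * Z))\<^sup>2"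
      unfolding p_def by (rule residual_growth[OF V(1,2,4)])
    then have "(norm B)\<^sup>2 + 2 * inner B H - C * (norm H)\<^sup>2 \<le> (norm (Z + H - V * (Z + H)))\<^sup>2"
      using 1 2 3 4 zero_le_power2[of "norm (H - V * H)"] by linarith
    then show "(norm B)\<^sup>2 + 2 * inner B H - C * (norm H)\<^sup>2 \<le> (norm (Z + H - V1 * tr V1 * (Z + H)))\<^sup>2"
      by (simp only: V_def)
  qed
  have "0 \<le> C * (norm H)\<^sup>2" using C by simp
  moreover have "0 \<le> (norm H)\<^sup>2" by simp
  ultimately have "\<bar>rank_dist N T R (Z + H) - (norm B)\<^sup>2 - 2 * inner B H\<bar> \<le> (norm H)\<^sup>2 + C * (norm H)\<^sup>2"
    using up low by arith
  then show ?thesis by (simp only: rank_dist_Z C_def distrib_right mult_1)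
qed

end

text \<open>A polynomial identity in a noncommutative algebra. \<open>B\<close> is split into four
  blocks by M, P on the left and N, Q on the right; the relations express the blocks through
  \<open>D\<close> and \<open>L\<close>, and \<open>E = D + B\<close> brings the quadratic terms
  back to \<open>E\<close>. Each of the eleven terms on the right is of third order, once
  \<open>P * B\<close>, \<open>B * Q\<close>, \<open>K * B\<close> and \<open>B * K\<close> are
  known to be of second order and \<open>L\<close> of first.\<close>

lemma residual_algebra:
  fixes B D E K L M N P Q :: fmat
  assumes ED: "E = D + B" and MB: "M * B = B - P * B" and BN: "B * N = B - B * Q"
    and MDN: "M * D * N = L * D * N" and L: "L = M * D * K - L * D * K + L * tr L"
    and PB': "P * B = - (tr K * tr D * B)" and BQ': "B * Q = - (B * tr D * tr K)"
  shows "B - (M * E * N - (M * E * K * E * N + tr K * tr E * M * E * N + M * E * N * tr E * tr K)) =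
      (M * (E * (K * B)) * N + M * (B * K * D) * N)
    + (tr K * (tr E * (L * D * N)) - tr K * (tr E * (P * B * N)) + tr (B * K) * B * N)
    + (L * D * N * tr E * tr K - M * (B * Q * tr E * tr K) + M * (B * tr (K * B)))
    + (L * D * K * D * N - L * tr L * D * N + P * B * Q)"
proof -
  define t1 where "t1 = M * (E * (K * B)) * N + M * (B * K * D) * N"
  define t2 where "t2 = tr K * (tr E * (L * D * N)) - tr K * (tr E * (P * B * N)) + tr (B * K) * B * N"
  define t3 where "t3 = L * D * N * tr E * tr K - M * (B * Q * tr E * tr K) + M * (B * tr (K * B))"
  have e1: "M * E * K * E * N = M * D * K * D * N + t1"
    unfolding t1_def by (simp add: ED algebra_simps)
  have e2: "tr K * tr E * M * E * N = t2 - P * B * N"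
  proof -
    have "M * E * N = L * D * N + (B - P * B) * N"
      unfolding MDN[symmetric] MB[symmetric] by (simp add: ED distrib_left distrib_right)
    then have "tr K * tr E * M * E * N = tr K * (tr E * (L * D * N + (B - P * B) * N))"
      by (simp only: mult.assoc)
    moreover have "tr K * (tr E * (B * N)) = tr (B * K) * B * N - P * B * N"
      unfolding PB' by (simp add: ED algebra_simps)
    ultimately show ?thesis unfolding t2_def
      by (simp only: distrib_left distrib_right left_diff_distrib right_diff_distrib mult.assoc)
        (simp add: algebra_simps)
  qed
  have e3: "M * E * N * tr E * tr K = t3 - M * B * Q"
  proof -
    have "M * E * N = L * D * N + M * (B - B * Q)"
      unfolding MDN[symmetric] BN[symmetric] by (simp add: ED distrib_left distrib_right mult.assoc)
    then have "M * E * N * tr E * tr K = (L * D * N + M * (B - B * Q)) * tr E * tr K"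
      by simp
    moreover have "M * B * tr E * tr K = M * (B * tr (K * B)) - M * B * Q"
      unfolding mult.assoc[of M B Q] BQ' by (simp add: ED algebra_simps)
    ultimately show ?thesis unfolding t3_def
      by (simp only: distrib_left distrib_right left_diff_distrib right_diff_distrib mult.assoc)
        (simp add: algebra_simps)
  qed
  have e4: "M * B * N = M * E * N - (M * D * K * D * N - L * D * K * D * N + L * tr L * D * N)"
  proof -
    have "M * B * N = M * E * N - L * D * N"
      unfolding MDN[symmetric] by (simp add: ED algebra_simps)
    also have "L * D * N = (M * D * K - L * D * K + L * tr L) * D * N"
      using L by simp
    also have "\<dots> = M * D * K * D * N - L * D * K * D * N + L * tr L * D * N"
      by (simp only: distrib_right left_diff_distrib)
    finally show ?thesis .
  qed
  have e5: "B = M * B * N + P * B * N + M * B * Q + P * B * Q"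
  proof -
    have "M * B * N + M * B * Q = M * B"
      unfolding mult.assoc BN by (simp add: algebra_simps)
    moreover have "P * B * N + P * B * Q = P * B"
      unfolding mult.assoc BN by (simp add: algebra_simps)
    moreover have "B = M * B + P * B" unfolding MB by simp
    ultimately show ?thesis by (metis add.assoc add.commute)
  qed
  show ?thesis unfolding t1_def[symmetric] t2_def[symmetric] t3_def[symmetric]
    unfolding e1 e2 e3 by (subst e5, subst e4) (simp add: algebra_simps)
qed

section \<open>The quadratic term and the size of the cubic remainder\<close>

context factor_perturbation
begin

text \<open>Up to sign the quadratic part of the residual. Paired with a regressor, its summands
  become, in reverse order, the three traces of \<open>CNT2\<close>.\<close>

definition second :: "fmat \<Rightarrow> fmat" where
  "second A = M0 * A * K * A * N0 + tr K * tr A * M0 * A * N0 + M0 * A * N0 * tr A * tr K"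

lemma op_bound_M0: "op_bound M0 1" and op_bound_N0: "op_bound N0 1"
  using op_bound_proj M0 N0 by blast+

lemma op_bound_K: "op_bound K (1 / s)" "op_bound (tr K) (1 / s)"
  using op_bound_mono[OF op_bound_norm nK] op_bound_tr by blast+

text \<open>Each of the nine terms of the difference has one factor \<open>K\<close>, which carries
  the Frobenius norm, and at least one factor \<open>H\<close>: six contain \<open>A\<close> once,
  three contain \<open>H\<close> twice. This is the price for evaluating the quadratic term at the
  errors instead of at \<open>E\<close>.\<close>

lemma norm_second_diff:
  assumes A: "op_bound A \<alpha>" and H: "norm H \<le> h"
  shows "norm (second (A + H) - second A) \<le> 3 / s * (2 * \<alpha> * h + h\<^sup>2)"
proof -
  note nl = norm_mult_op_bound_left and nr = norm_mult_op_bound_right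
  have oH: "op_bound H h" by (rule op_bound_mono[OF op_bound_norm H])
  note A' = op_bound_tr[OF A] and H' = op_bound_tr[OF oH]
  have nK': "norm (tr K) \<le> 1 / s" using nK by simp
  define w where "w = \<alpha> * h / s"
  define v where "v = h * h / s"
  have eq: "second (A + H) - second A =
      (M0 * (A * K * H) * N0 + M0 * (H * K * A) * N0 + M0 * (H * K * H) * N0)
    + (tr K * tr A * M0 * H * N0 + tr K * tr H * M0 * A * N0 + tr K * tr H * M0 * H * N0)
    + (M0 * (A * (N0 * (tr H * tr K))) + M0 * (H * (N0 * (tr A * tr K))) + M0 * (H * (N0 * (tr H * tr K))))"
    unfolding second_def by (simp add: algebra_simps)
  have 1: "norm (M0 * (A * K * H) * N0) \<le> w"
    using nr[OF op_bound_N0 nl[OF op_bound_M0 nr[OF oH nl[OF A nK]]]] by (simp add: w_def mult_ac)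
  have 2: "norm (M0 * (H * K * A) * N0) \<le> w"
    using nr[OF op_bound_N0 nl[OF op_bound_M0 nr[OF A nl[OF oH nK]]]] by (simp add: w_def mult_ac)
  have 3: "norm (M0 * (H * K * H) * N0) \<le> v"
    using nr[OF op_bound_N0 nl[OF op_bound_M0 nr[OF oH nl[OF oH nK]]]] by (simp add: v_def mult_ac)
  have 4: "norm (tr K * tr A * M0 * H * N0) \<le> w"
    using nr[OF op_bound_N0 nr[OF oH nr[OF op_bound_M0 nr[OF A' nK']]]] by (simp add: w_def mult_ac)
  have 5: "norm (tr K * tr H * M0 * A * N0) \<le> w"
    using nr[OF op_bound_N0 nr[OF A nr[OF op_bound_M0 nr[OF H' nK']]]] by (simp add: w_def mult_ac)
  have 6: "norm (tr K * tr H * M0 * H * N0) \<le> v"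
    using nr[OF op_bound_N0 nr[OF oH nr[OF op_bound_M0 nr[OF H' nK']]]] by (simp add: v_def mult_ac)
  have 7: "norm (M0 * (A * (N0 * (tr H * tr K)))) \<le> w"
    using nl[OF op_bound_M0 nl[OF A nl[OF op_bound_N0 nl[OF H' nK']]]] by (simp add: w_def mult_ac)
  have 8: "norm (M0 * (H * (N0 * (tr A * tr K)))) \<le> w"
    using nl[OF op_bound_M0 nl[OF oH nl[OF op_bound_N0 nl[OF A' nK']]]] by (simp add: w_def mult_ac)
  have 9: "norm (M0 * (H * (N0 * (tr H * tr K)))) \<le> v"
    using nl[OF op_bound_M0 nl[OF oH nl[OF op_bound_N0 nl[OF H' nK']]]] by (simp add: v_def mult_ac)
  have "norm (second (A + H) - second A) \<le> ((w + w) + v) + ((w + w) + v) + ((w + w) + v)"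
    unfolding eq by (intro norm_triangle_mono 1 2 3 4 5 6 7 8 9)
  also have "\<dots> = 3 / s * (2 * \<alpha> * h + h\<^sup>2)"
    by (simp add: w_def v_def power2_eq_square algebra_simps add_divide_distrib)
  finally show ?thesis .
qed

end

context factor_minimizer
begin

text \<open>The tilt of the fitted column space out of that of the signal; it is of first order in
  the noise.\<close>

definition "L = M0 * P"

text \<open>\<open>M0\<close> annihilates \<open>G\<close> from the left and \<open>N0\<close> from
  the right, so \<open>D\<close> and \<open>Gh\<close> are interchangeable next to either of them,
  while \<open>P\<close> fixes \<open>Gh\<close>.\<close>

lemma M0DN0: "M0 * D * N0 = L * D * N0"
proof -
  have "M0 * D * N0 = M0 * Gh * N0"
    using N0(4) M0(4) by (simp add: Gh(1) distrib_left)
  also have "\<dots> = L * Gh * N0" using Gh(2) by (simp add: L_def mult.assoc)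
  also have "\<dots> = L * D * N0" using N0(4) by (simp add: Gh(1) distrib_left distrib_right mult.assoc)
  finally show ?thesis .
qed

text \<open>Split L into L P0 + L M0. The first part follows from \<open>P * Gh = Gh\<close> after
  multiplication by \<open>K\<close>; the second is \<open>L * tr L\<close> because \<open>P\<close>
  is idempotent. The result is a fixed point equation with leading term
  \<open>M0 * D * K\<close>.\<close>

lemma L_eq: "L = M0 * D * K - L * D * K + L * tr L"
proof -
  have "L * M0 = L * tr L"
    using P(1,2) M0(1) by (simp add: L_def mult.assoc[symmetric]) (simp add: mult.assoc)
  moreover have "L * M0 = L - L * P0"
  proof -
    have "dims L N N" using M0(3) P(3) by (auto simp: L_def)
    then show ?thesis by (simp add: M0_def right_diff_distrib)
  qed
  moreover have "L * P0 = M0 * D * K - L * D * K"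
  proof -
    have "L * G = M0 * (P * Gh) - L * D"
      by (simp add: L_def Gh(1) distrib_left mult.assoc)
    also have "\<dots> = M0 * D - L * D" unfolding Gh(2) using M0(4) by (simp add: Gh(1) distrib_left)
    finally have "L * G * K = (M0 * D - L * D) * K" by simp
    then show ?thesis by (simp add: P0_def left_diff_distrib mult.assoc)
  qed
  ultimately show ?thesis by (metis add.commute diff_add_cancel)
qed

text \<open>\<open>P0 * B\<close> and \<open>B * Q0\<close> are of second order by the orthogonality
  relations; \<open>K * B\<close> and \<open>B * K\<close> inherit this through
  \<open>K = K * P0 = Q0 * K\<close>.\<close>

lemma norm_products:
  defines "k \<equiv> 1 / s"
  shows "norm L \<le> k * y"
    and "norm (P0 * B) \<le> k * y * y"
    and "norm (B * Q0) \<le> k * y * y"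
    and "norm (K * B) \<le> k * k * y * y"
    and "norm (B * K) \<le> k * k * y * y"
proof -
  note nl = norm_mult_op_bound_left and nr = norm_mult_op_bound_right
  have nK': "norm (tr K) \<le> k" using nK by (simp add: k_def)
  show "norm L \<le> k * y" using norm_M0P by (simp add: L_def k_def)
  show 1: "norm (P0 * B) \<le> k * y * y"
    unfolding P0B norm_minus_cancel by (rule nr[OF op_bound_B nr[OF op_bound_tr[OF op_bound_D] nK']])
  show 2: "norm (B * Q0) \<le> k * y * y"
    using nl[OF op_bound_B nl[OF op_bound_tr[OF op_bound_D] nK']] unfolding BQ0 norm_minus_cancel
    by (simp add: mult_ac)
  have "K * B = K * (P0 * B)" using P0(4) by (simp add: mult.assoc[symmetric])
  then show "norm (K * B) \<le> k * k * y * y"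
    using nl[OF op_bound_K(1) 1] by (simp add: k_def mult_ac)
  have "B * K = (B * Q0) * K" using Q0(4) by (simp add: mult.assoc)
  then show "norm (B * K) \<le> k * k * y * y"
    using nr[OF op_bound_K(1) 2] by (simp add: k_def mult_ac)
qed

text \<open>The constant 11 counts the remainder terms of \<open>residual_algebra\<close>, each of
  Frobenius norm at most y^3 / s^2.\<close>

lemma residual_expansion:
  "norm (B - (M0 * E * N0 - second E)) \<le> 11 * (y ^ 3 / s\<^sup>2)"
proof -
  note nl = norm_mult_op_bound_left and nr = norm_mult_op_bound_right
  note np = norm_products
  define z where "z = y ^ 3 / s\<^sup>2"
  have z: "z = 1 / s * (1 / s) * (y * y * y)"
    by (simp add: z_def power2_eq_square power3_eq_cube)
  have eq: "B - (M0 * E * N0 - second E) =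
      (M0 * (E * (K * B)) * N0 + M0 * (B * K * D) * N0)
    + (tr K * (tr E * (L * D * N0)) - tr K * (tr E * (P0 * B * N0)) + tr (B * K) * B * N0)
    + (L * D * N0 * tr E * tr K - M0 * (B * Q0 * tr E * tr K) + M0 * (B * tr (K * B)))
    + (L * D * K * D * N0 - L * tr L * D * N0 + P0 * B * Q0)"
    unfolding second_def
    by (rule residual_algebra[OF _ M0_mult[OF dB(2)] mult_N0[OF dB(2)] M0DN0 L_eq P0B BQ0]) (simp add: D_def)
  note oD = op_bound_D and oB = op_bound_B and oE = op_bound_E
  note oE' = op_bound_tr[OF oE] and oB' = op_bound_tr[OF oB] and oD' = op_bound_tr[OF oD]
  have bounds:
    "norm (M0 * (E * (K * B)) * N0) \<le> z"
    "norm (M0 * (B * K * D) * N0) \<le> z"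
    "norm (tr K * (tr E * (L * D * N0))) \<le> z"
    "norm (tr K * (tr E * (P0 * B * N0))) \<le> z"
    "norm (tr (B * K) * B * N0) \<le> z"
    "norm (L * D * N0 * tr E * tr K) \<le> z"
    "norm (M0 * (B * Q0 * tr E * tr K)) \<le> z"
    "norm (M0 * (B * tr (K * B))) \<le> z"
    "norm (L * D * K * D * N0) \<le> z"
    "norm (L * tr L * D * N0) \<le> z"
    "norm (P0 * B * Q0) \<le> z"
  proof -
    show "norm (M0 * (E * (K * B)) * N0) \<le> z"
      using nr[OF op_bound_N0 nl[OF op_bound_M0 nl[OF oE np(4)]]] by (simp add: z mult_ac)
    show "norm (M0 * (B * K * D) * N0) \<le> z"
      using nr[OF op_bound_N0 nl[OF op_bound_M0 nr[OF oD np(5)]]] by (simp add: z mult_ac)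
    show "norm (tr K * (tr E * (L * D * N0))) \<le> z"
      using nl[OF op_bound_K(2) nl[OF oE' nr[OF op_bound_N0 nr[OF oD np(1)]]]] by (simp add: z mult_ac)
    show "norm (tr K * (tr E * (P0 * B * N0))) \<le> z"
      using nl[OF op_bound_K(2) nl[OF oE' nr[OF op_bound_N0 np(2)]]] by (simp add: z mult_ac)
    have "norm (tr (B * K)) \<le> 1 / s * (1 / s) * y * y" using np(5) by (simp only: norm_tr)
    from nr[OF op_bound_N0 nr[OF oB this]] show "norm (tr (B * K) * B * N0) \<le> z" by (simp add: z mult_ac)
    show "norm (L * D * N0 * tr E * tr K) \<le> z"
      using nr[OF op_bound_K(2) nr[OF oE' nr[OF op_bound_N0 nr[OF oD np(1)]]]] by (simp add: z mult_ac)
    show "norm (M0 * (B * Q0 * tr E * tr K)) \<le> z"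
      using nl[OF op_bound_M0 nr[OF op_bound_K(2) nr[OF oE' np(3)]]] by (simp add: z mult_ac)
    have "norm (tr (K * B)) \<le> 1 / s * (1 / s) * y * y" using np(4) by (simp only: norm_tr)
    from nl[OF op_bound_M0 nl[OF oB this]] show "norm (M0 * (B * tr (K * B))) \<le> z" by (simp add: z mult_ac)
    show "norm (L * D * K * D * N0) \<le> z"
      using nr[OF op_bound_N0 nr[OF oD nr[OF op_bound_K(1) nr[OF oD np(1)]]]] by (simp add: z mult_ac)
    have "op_bound (tr L) (1 / s * y)" by (rule op_bound_tr[OF op_bound_mono[OF op_bound_norm np(1)]])
    from nr[OF op_bound_N0 nr[OF oD nr[OF this np(1)]]] show "norm (L * tr L * D * N0) \<le> z"
      by (simp add: z mult_ac)
    have "P0 * B * Q0 = - (tr K * (tr D * (B * Q0)))" unfolding P0B by (simp add: mult.assoc)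
    then show "norm (P0 * B * Q0) \<le> z"
      using nl[OF op_bound_K(2) nl[OF oD' np(3)]] by (simp add: z mult_ac)
  qed
  have "norm (B - (M0 * E * N0 - second E)) \<le> (z + z) + ((z + z) + z) + ((z + z) + z) + ((z + z) + z)"
    unfolding eq by (intro norm_triangle_mono norm_triangle_le_diff add_mono bounds)
  then show ?thesis by (simp add: z_def)
qed

end

context factor_perturbation
begin

text \<open>The minimising projector is eliminated here: what is exported is half the gradient of
  \<open>rank_dist\<close> at \<open>Z\<close> and its expansion. \<open>C\<close> is merely some
  constant, whereas the expansion error is explicit.\<close>

theorem residual_matrix:
  obtains B C where "dims B N T" "0 \<le> C"
    "\<And>H. dims H N T \<Longrightarrow>
      \<bar>rank_dist N T R (Z + H) - rank_dist N T R Z - 2 * inner B H\<bar> \<le> C * (norm H)\<^sup>2"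
    "norm (B - (M0 * E * N0 - second E)) \<le> 11 * (y ^ 3 / s\<^sup>2)"
proof -
  obtain U where U: "orth N R U" "rank_dist N T R Z = (norm (Z - U * tr U * Z))\<^sup>2"
    "(Z - U * tr U * Z) * tr Z * U = 0"
    using ex_best_projection[OF R_le dZ] by blast
  then interpret m: factor_minimizer N T R G K E l g s \<epsilon> U by unfold_locales
  have "0 \<le> 1 + 2 * (norm Z)\<^sup>2 / m.\<gamma>" using m.gamma_pos by (simp add: add_nonneg_nonneg)
  then show thesis
    using that[of m.B "1 + 2 * (norm Z)\<^sup>2 / m.\<gamma>"] m.dB(2) m.rank_dist_expansion m.residual_expansion
    by blast
qed

end

section \<open>Transfer from matrices\<close>

definition fmat_of_mat :: "real mat \<Rightarrow> fmat" where
  "fmat_of_mat A = Fmat (\<lambda>i j. if i < dim_row A \<and> j < dim_col A then A $$ (i, j) else 0)"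

lemma entry_fmat_of_mat: "entry (fmat_of_mat A) i j = (if i < dim_row A \<and> j < dim_col A then A $$ (i, j) else 0)"
  unfolding fmat_of_mat_def
  by (subst entry_Fmat[where n = "max (dim_row A) (dim_col A)"]) (auto split: if_splits)

lemma dims_fmat_of_mat [intro]: "A \<in> carrier_mat m n \<Longrightarrow> dims (fmat_of_mat A) m n"
  by (auto simp: dims_def entry_fmat_of_mat split: if_splits)

lemma fmat_of_mat_add:
  assumes "A \<in> carrier_mat m n" "B \<in> carrier_mat m n" shows "fmat_of_mat (A + B) = fmat_of_mat A + fmat_of_mat B"
  by (rule fmat_eqI) (use assms in \<open>auto simp: entry_fmat_of_mat\<close>)

lemma fmat_of_mat_diff:
  assumes "A \<in> carrier_mat m n" "B \<in> carrier_mat m n" shows "fmat_of_mat (A - B) = fmat_of_mat A - fmat_of_mat B"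
  by (rule fmat_eqI) (use assms in \<open>auto simp: entry_fmat_of_mat\<close>)

lemma fmat_of_mat_transpose: "fmat_of_mat (A\<^sup>T) = tr (fmat_of_mat A)"
  by (rule fmat_eqI) (auto simp: entry_fmat_of_mat)

lemma fmat_of_mat_one: "fmat_of_mat (1\<^sub>m n) = idf n"
  by (rule fmat_eqI) (auto simp: entry_fmat_of_mat)

lemma fmat_of_mat_mult:
  assumes A: "A \<in> carrier_mat m n" and B: "B \<in> carrier_mat n p"
  shows "fmat_of_mat (A * B) = fmat_of_mat A * fmat_of_mat B"
proof (rule fmat_eqI)
  fix i j
  have dA: "dims (fmat_of_mat A) m n" and dB: "dims (fmat_of_mat B) n p" using A B by auto
  show "entry (fmat_of_mat (A * B)) i j = entry (fmat_of_mat A * fmat_of_mat B) i j"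
  proof (cases "i < m \<and> j < p")
    case True
    then have "entry (fmat_of_mat (A * B)) i j = row A i \<bullet> col B j"
      using A B by (simp add: entry_fmat_of_mat)
    also have "\<dots> = (\<Sum>k<n. entry (fmat_of_mat A) i k * entry (fmat_of_mat B) k j)"
      unfolding scalar_prod_def using A B True
      by (intro sum.cong) (auto simp: entry_fmat_of_mat)
    finally show ?thesis by (simp add: entry_mult[OF disjI1[OF dA]])
  next
    case False
    then show ?thesis
      using dims_entry[OF dims_mult[OF dA dB], of i j] A B by (auto simp: entry_fmat_of_mat)
  qed
qed

lemma fmat_of_mat_inj:
  assumes "A \<in> carrier_mat m n" "B \<in> carrier_mat m n" "fmat_of_mat A = fmat_of_mat B" shows "A = B"
proof (rule eq_matI)
  fix i j assume "i < dim_row B" "j < dim_col B"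
  then show "A $$ (i, j) = B $$ (i, j)"
    using assms entry_fmat_of_mat[of A i j] entry_fmat_of_mat[of B i j] by auto
qed (use assms in auto)

definition mat_of_fmat :: "nat \<Rightarrow> nat \<Rightarrow> fmat \<Rightarrow> real mat" where
  "mat_of_fmat m n A = mat m n (\<lambda>(i, j). entry A i j)"

lemma mat_of_fmat_carrier [simp]: "mat_of_fmat m n A \<in> carrier_mat m n"
  by (simp add: mat_of_fmat_def)

lemma fmat_of_mat_mat_of_fmat: "dims A m n \<Longrightarrow> fmat_of_mat (mat_of_fmat m n A) = A"
  by (rule fmat_eqI) (auto simp: entry_fmat_of_mat mat_of_fmat_def dims_entry)

section \<open>Traces, norms and vectors in the embedded algebra\<close>

lemma mtrace_eq_inner:
  assumes "A \<in> carrier_mat n n" shows "mtrace A = inner (fmat_of_mat A) (idf n)"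
proof -
  have "inner (fmat_of_mat A) (idf n) = (\<Sum>i<n. \<Sum>j<n. if j = i then A $$ (i, i) else 0)"
    by (subst inner_fmat_entries[OF disjI2[OF dims_idf]], intro sum.cong refl)
      (use assms in \<open>auto simp: entry_fmat_of_mat\<close>)
  then show ?thesis using assms by (simp add: mtrace_def)
qed

lemma fro_norm_eq_norm: "fro_norm A = norm (fmat_of_mat A)"
proof -
  have "(norm (fmat_of_mat A))\<^sup>2 = (\<Sum>i<dim_row A. \<Sum>j<dim_col A. (A $$ (i, j))\<^sup>2)"
    by (subst power2_norm_fmat[of _ "dim_row A" "dim_col A"]) (auto simp: entry_fmat_of_mat dims_def split: if_splits)
  then show ?thesis unfolding fro_norm_def by (metis norm_ge_zero real_sqrt_unique)
qed

lemma inner_columns: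
  assumes "dims Y n m"
  shows "inner X Y = (\<Sum>j<m. inner (X * eunit j 0) (Y * eunit j 0))"
proof -
  have "inner X Y = (\<Sum>i<n. \<Sum>j<m. entry X i j * entry Y i j)"
    using assms by (intro inner_fmat_entries) auto
  also have "\<dots> = (\<Sum>j<m. \<Sum>i<n. entry X i j * entry Y i j)" by (rule sum.swap)
  also have "\<dots> = (\<Sum>j<m. inner (X * eunit j 0) (Y * eunit j 0))"
  proof (intro sum.cong refl)
    fix j assume "j \<in> {..<m}"
    have "dims (Y * eunit j 0) n 1" using assms by (intro dims_mult[of _ _ m _ "Suc j"]) auto
    then have "inner (X * eunit j 0) (Y * eunit j 0)
        = (\<Sum>i<n. \<Sum>k<1. entry (X * eunit j 0) i k * entry (Y * eunit j 0) i k)"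
      by (intro inner_fmat_entries) auto
    then show "(\<Sum>i<n. entry X i j * entry Y i j) = inner (X * eunit j 0) (Y * eunit j 0)" by simp
  qed
  finally show ?thesis .
qed

definition fmat_of_vec :: "real vec \<Rightarrow> fmat" where "fmat_of_vec v = fmat_of_mat (mat (dim_vec v) 1 (\<lambda>(i, _). v $ i))"

lemma entry_fmat_of_vec: "entry (fmat_of_vec v) i j = (if i < dim_vec v \<and> j = 0 then v $ i else 0)"
  by (auto simp: fmat_of_vec_def entry_fmat_of_mat)

lemma dims_fmat_of_vec: "v \<in> carrier_vec n \<Longrightarrow> dims (fmat_of_vec v) n 1"
  by (auto simp: dims_def entry_fmat_of_vec split: if_splits)

lemma norm_fmat_of_vec: "norm (fmat_of_vec v) = vnorm v"
proof -
  have "(norm (fmat_of_vec v))\<^sup>2 = v \<bullet> v"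
    by (subst power2_norm_fmat[OF dims_fmat_of_vec[OF carrier_vec_dim_vec]])
      (simp add: entry_fmat_of_vec scalar_prod_def power2_eq_square atLeast0LessThan)
  then show ?thesis unfolding vnorm_def by (metis norm_ge_zero real_sqrt_unique)
qed

lemma fmat_of_vec_mult:
  assumes "A \<in> carrier_mat m n" "v \<in> carrier_vec n"
  shows "fmat_of_vec (A *\<^sub>v v) = fmat_of_mat A * fmat_of_vec v"
proof (rule fmat_eqI)
  fix i j
  have d: "dims (fmat_of_mat A) m n" using assms by auto
  show "entry (fmat_of_vec (A *\<^sub>v v)) i j = entry (fmat_of_mat A * fmat_of_vec v) i j"
    using assms dims_entry[OF d]
    by (auto simp: entry_fmat_of_vec entry_mult[OF disjI1[OF d]] scalar_prod_def entry_fmat_of_mat atLeast0LessThan intro!: sum.cong)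
qed

lemma ex_fmat_of_vec:
  assumes "dims Y n 1" obtains v where "v \<in> carrier_vec n" "fmat_of_vec v = Y"
proof
  show "vec n (\<lambda>i. entry Y i 0) \<in> carrier_vec n" by simp
  show "fmat_of_vec (vec n (\<lambda>i. entry Y i 0)) = Y"
    by (rule fmat_eqI) (use assms in \<open>auto simp: entry_fmat_of_vec dims_entry\<close>)
qed

lemma spec_norm_upper:
  assumes "v \<in> carrier_vec (dim_col A)" "vnorm v \<le> 1"
  shows "vnorm (A *\<^sub>v v) \<le> spec_norm A"
  unfolding spec_norm_def
proof (rule cSup_upper)
  let ?S = "{vnorm (A *\<^sub>v v) | v. v \<in> carrier_vec (dim_col A) \<and> vnorm v \<le> 1}"
  have A: "A \<in> carrier_mat (dim_row A) (dim_col A)" by simp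
  show "vnorm (A *\<^sub>v v) \<in> ?S" using assms by blast
  show "bdd_above ?S"
  proof (rule bdd_aboveI)
    fix x assume "x \<in> ?S"
    then obtain v where v: "x = vnorm (A *\<^sub>v v)" "v \<in> carrier_vec (dim_col A)" "vnorm v \<le> 1" by auto
    have "x = norm (fmat_of_mat A * fmat_of_vec v)"
      unfolding v(1) norm_fmat_of_vec[symmetric] fmat_of_vec_mult[OF A v(2)] ..
    also have "\<dots> \<le> norm (fmat_of_mat A) * norm (fmat_of_vec v)" by (rule norm_mult_ineq)
    also have "\<dots> \<le> norm (fmat_of_mat A) * 1"
      using v(3) by (intro mult_left_mono) (auto simp: norm_fmat_of_vec)
    finally show "x \<le> norm (fmat_of_mat A)" by simp
  qed
qed

lemma spec_norm_bound:
  assumes A: "A \<in> carrier_mat m n" and Y: "dims Y n 1"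
  shows "norm (fmat_of_mat A * Y) \<le> spec_norm A * norm Y"
proof (cases "Y = 0")
  case False
  have "dims (Y /\<^sub>R norm Y) n 1" using Y by (rule dims_scaleR)
  then obtain v where v: "v \<in> carrier_vec n" "fmat_of_vec v = Y /\<^sub>R norm Y" by (rule ex_fmat_of_vec)
  have "vnorm v = norm (Y /\<^sub>R norm Y)" unfolding v(2)[symmetric] norm_fmat_of_vec ..
  then have "vnorm v \<le> 1" using False by simp
  then have "vnorm (A *\<^sub>v v) \<le> spec_norm A" using v(1) A by (intro spec_norm_upper) auto
  moreover have "vnorm (A *\<^sub>v v) = norm (fmat_of_mat A * Y) / norm Y"
    unfolding norm_fmat_of_vec[symmetric] fmat_of_vec_mult[OF A v(1)] v(2) by (simp add: field_simps)
  ultimately show ?thesis using False by (simp add: field_simps)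
qed simp

lemma spec_norm_nonneg: "0 \<le> spec_norm A"
proof -
  have "0 \<le> vnorm (A *\<^sub>v 0\<^sub>v (dim_col A))" unfolding norm_fmat_of_vec[symmetric] by (rule norm_ge_zero)
  also have "\<dots> \<le> spec_norm A" by (rule spec_norm_upper) (simp_all add: vnorm_def)
  finally show ?thesis .
qed

text \<open>\<open>spec_norm\<close> is a supremum over vectors, so \<open>X\<close> is treated
  column by column and the squares are added. Truncation by \<open>idf n\<close> removes the rows of
  \<open>X\<close> that do not contribute to the product.\<close>

lemma op_bound_spec_norm: "op_bound (fmat_of_mat A) (spec_norm A)"
  unfolding op_bound_def
proof (intro conjI allI)
  show nn: "0 \<le> spec_norm A" by (rule spec_norm_nonneg)
  fix X
  define n where "n = dim_col A"
  have A: "A \<in> carrier_mat (dim_row A) n" by (simp add: n_def)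
  obtain m where m: "dims X m m" using ex_dims by blast
  define Y where "Y = idf n * X"
  have dY: "dims Y n m" using m by (auto simp: Y_def)
  have AX: "fmat_of_mat A * X = fmat_of_mat A * Y" unfolding Y_def mult.assoc[symmetric] using A by (metis dims_fmat_of_mat mult_idf)
  have dAY: "dims (fmat_of_mat A * Y) (dim_row A) m" using dims_fmat_of_mat[OF A] dY by (rule dims_mult)
  have sq: "(norm W)\<^sup>2 = (\<Sum>j<m. (norm (W * eunit j 0))\<^sup>2)" if "dims W p m" for W p
    using inner_columns[OF that, of W] by (simp add: power2_norm_eq_inner)
  have "(norm (fmat_of_mat A * Y))\<^sup>2 = (\<Sum>j<m. (norm (fmat_of_mat A * (Y * eunit j 0)))\<^sup>2)"
    unfolding sq[OF dAY] by (simp add: mult.assoc)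
  also have "\<dots> \<le> (\<Sum>j<m. (spec_norm A * norm (Y * eunit j 0))\<^sup>2)"
  proof (intro sum_mono power_mono spec_norm_bound[OF A] norm_ge_zero)
    fix j show "dims (Y * eunit j 0) n 1" using dY by (intro dims_mult[of _ _ m _ "Suc j"]) auto
  qed
  also have "\<dots> = (spec_norm A * norm Y)\<^sup>2"
    unfolding power_mult_distrib sq[OF dY] by (simp add: sum_distrib_left)
  finally have "norm (fmat_of_mat A * Y) \<le> spec_norm A * norm Y" 
    by (rule power2_le_imp_le) (simp add: nn)
  also have "norm Y \<le> norm X"
  proof -
    have "op_bound (idf n) 1" by (rule op_bound_proj[OF tr_idf idf_mult[OF dims_idf]])
    then show ?thesis by (simp add: Y_def op_bound_def)
  qed
  finally show "norm (fmat_of_mat A * X) \<le> spec_norm A * norm X" using nn AX by (simp add: mult_left_mono)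
qed

text \<open>\<open>pinv\<close> is a definite description. Any candidate \<open>C\<close> satisfies
  \<open>A * C * A = A\<close>, and cancelling the invertible \<open>A\<close> on both sides
  identifies it with \<open>B\<close>.\<close>

lemma pinv_eq:
  assumes A: "A \<in> carrier_mat n n" and B: "B \<in> carrier_mat n n"
    and AB: "A * B = 1\<^sub>m n" and BA: "B * A = 1\<^sub>m n"
  shows "pinv A = B"
  unfolding pinv_def
proof (rule the_equality)
  show "B \<in> carrier_mat (dim_col A) (dim_row A) \<and> A * B * A = A \<and> B * A * B = B \<and>
      (A * B)\<^sup>T = A * B \<and> (B * A)\<^sup>T = B * A"
    using assms by auto
next
  fix C assume C: "C \<in> carrier_mat (dim_col A) (dim_row A) \<and> A * C * A = A \<and> C * A * C = C \<and>
      (A * C)\<^sup>T = A * C \<and> (C * A)\<^sup>T = C * A"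
  then have Cc: "C \<in> carrier_mat n n" using A by auto
  have f: "fmat_of_mat A * fmat_of_mat B = idf n" "fmat_of_mat B * fmat_of_mat A = idf n"
    using fmat_of_mat_mult[OF A B] fmat_of_mat_mult[OF B A] AB BA fmat_of_mat_one by simp_all
  have "fmat_of_mat A * fmat_of_mat C * fmat_of_mat A = fmat_of_mat A"
    using C fmat_of_mat_mult[OF A Cc] fmat_of_mat_mult[OF mult_carrier_mat[OF A Cc] A] by simp
  then have "fmat_of_mat B * (fmat_of_mat A * fmat_of_mat C * fmat_of_mat A) * fmat_of_mat B = fmat_of_mat B * fmat_of_mat A * fmat_of_mat B" by simp
  then have "(fmat_of_mat B * fmat_of_mat A) * fmat_of_mat C * (fmat_of_mat A * fmat_of_mat B) = fmat_of_mat B * (fmat_of_mat A * fmat_of_mat B)" by (simp only: mult.assoc)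
  then have "fmat_of_mat C = fmat_of_mat B" using dims_fmat_of_mat[OF Cc] dims_fmat_of_mat[OF B] by (simp add: f)
  then show "C = B" using fmat_of_mat_inj[OF Cc B] by simp
qed

text \<open>The lower bound makes \<open>lam\<close> injective, so its Gram matrix is invertible
  with inverse \<open>pinv\<close>. The norm bound on W lam' arises by inserting this very matrix
  into the lower bound: lam W lam' is a projector of squared norm \<open>R\<close>. For this the
  bound is assumed for matrices \<open>Y\<close> of every width.\<close>

lemma gram_inverse:
  assumes l: "lam \<in> carrier_mat n R" and c: "0 < c"
    and low: "\<forall>Y m. dims Y R m \<longrightarrow> c * (norm Y)\<^sup>2 \<le> (norm (fmat_of_mat lam * Y))\<^sup>2"
  defines "W \<equiv> fmat_of_mat (pinv (lam\<^sup>T * lam))"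
  shows "pinv (lam\<^sup>T * lam) \<in> carrier_mat R R"
    and "dims W R R" and "tr W = W"
    and "W * (tr (fmat_of_mat lam) * fmat_of_mat lam) = idf R"
    and "(norm (W * tr (fmat_of_mat lam)))\<^sup>2 \<le> real R / c"
    and "(norm (fmat_of_mat lam * (W * tr (fmat_of_mat lam))))\<^sup>2 = real R"
proof -
  define A where "A = lam\<^sup>T * lam"
  have lT: "lam\<^sup>T \<in> carrier_mat R n" using l by simp
  have A: "A \<in> carrier_mat R R" using l unfolding A_def by auto
  have fA: "fmat_of_mat A = tr (fmat_of_mat lam) * fmat_of_mat lam" using fmat_of_mat_mult[OF lT l] by (simp add: A_def fmat_of_mat_transpose)
  have "det A \<noteq> 0"
  proof
    assume "det A = 0"
    then obtain v where v: "v \<in> carrier_vec R" "v \<noteq> 0\<^sub>v R" "A *\<^sub>v v = 0\<^sub>v R"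
      using det_0_iff_vec_prod_zero_field[OF A] by blast
    have "fmat_of_mat A * fmat_of_vec v = fmat_of_vec (0\<^sub>v R)" using fmat_of_vec_mult[OF A v(1)] v(3) by simp
    also have "\<dots> = 0" by (rule fmat_eqI) (auto simp: entry_fmat_of_vec)
    finally have "inner (fmat_of_mat lam * fmat_of_vec v) (fmat_of_mat lam * fmat_of_vec v) = 0"
      unfolding fA by (simp add: inner_mult_left mult.assoc)
    then have "(norm (fmat_of_mat lam * fmat_of_vec v))\<^sup>2 = 0" by (simp add: power2_norm_eq_inner)
    with low[rule_format, OF dims_fmat_of_vec[OF v(1)]] c have "(norm (fmat_of_vec v))\<^sup>2 \<le> 0"
      by (simp add: mult_le_0_iff)
    then have "fmat_of_vec v = 0" by simp
    then have "v $ i = 0" if "i < R" for i using entry_fmat_of_vec[of v i 0] v(1) that by simp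
    then have "v = 0\<^sub>v R" using v(1) by (intro eq_vecI) auto
    with v(2) show False by simp
  qed
  then have "A \<in> Units (ring_mat TYPE(real) R ())" by (rule det_non_zero_imp_unit[OF A])
  then obtain B where B: "B \<in> carrier_mat R R" "A * B = 1\<^sub>m R" "B * A = 1\<^sub>m R"
    unfolding Units_def ring_mat_def by auto
  have pB: "pinv (lam\<^sup>T * lam) = B" unfolding A_def[symmetric] by (rule pinv_eq[OF A B])
  then show "pinv (lam\<^sup>T * lam) \<in> carrier_mat R R" using B by simp
  have W: "W = fmat_of_mat B" by (simp add: W_def pB)
  show dW: "dims W R R" unfolding W using B by auto
  have WA: "W * fmat_of_mat A = idf R" "fmat_of_mat A * W = idf R"
    using fmat_of_mat_mult[OF A B(1)] fmat_of_mat_mult[OF B(1) A] B fmat_of_mat_one by (simp_all add: W)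
  then show WA': "W * (tr (fmat_of_mat lam) * fmat_of_mat lam) = idf R" by (simp add: fA)
  have "tr (fmat_of_mat A * W) = idf R" using WA by simp
  then have "tr W * fmat_of_mat A = idf R" by (simp add: fA)
  then have "tr W * fmat_of_mat A * W = W" using dW by simp
  moreover have "tr W * (fmat_of_mat A * W) = tr W" using WA dW by simp
  ultimately show tW: "tr W = W" by (simp add: mult.assoc)
  define V where "V = W * tr (fmat_of_mat lam)"
  have dl: "dims (fmat_of_mat lam) n R" using l by auto
  have dV: "dims V R n" using dW dl by (auto simp: V_def)
  have Vl: "V * fmat_of_mat lam = idf R" using WA' by (simp add: V_def mult.assoc)
  have "inner (fmat_of_mat lam * V) (fmat_of_mat lam * V) = inner (tr (fmat_of_mat lam) * (fmat_of_mat lam * V)) V" by (rule inner_mult_left)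
  also have "tr (fmat_of_mat lam) * (fmat_of_mat lam * V) = fmat_of_mat A * W * tr (fmat_of_mat lam)" by (simp add: fA V_def mult.assoc)
  also have "\<dots> = tr (fmat_of_mat lam)" using WA dl by simp
  also have "inner (tr (fmat_of_mat lam)) V = inner V (idf R * tr (fmat_of_mat lam))"
    using dl by (simp add: inner_commute)
  also have "\<dots> = inner (V * fmat_of_mat lam) (idf R)" by (simp add: inner_mult_right)
  finally have nP: "(norm (fmat_of_mat lam * V))\<^sup>2 = real R"
    unfolding Vl power2_norm_eq_inner norm_idf[of R, unfolded power2_norm_eq_inner] .
  then show "(norm (fmat_of_mat lam * (W * tr (fmat_of_mat lam))))\<^sup>2 = real R" by (simp only: V_def)
  have "c * (norm V)\<^sup>2 \<le> real R" using low[rule_format, OF dV] nP by simp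
  then show "(norm (W * tr (fmat_of_mat lam)))\<^sup>2 \<le> real R / c"
    using c by (simp add: V_def field_simps)
qed

lemma fmat_of_mat_Mproj:
  assumes l: "lam \<in> carrier_mat n R" and p: "pinv (lam\<^sup>T * lam) \<in> carrier_mat R R"
  shows "Mproj lam \<in> carrier_mat n n"
    and "fmat_of_mat (Mproj lam) = idf n - fmat_of_mat lam * (fmat_of_mat (pinv (lam\<^sup>T * lam)) * tr (fmat_of_mat lam))"
proof -
  have lT: "lam\<^sup>T \<in> carrier_mat R n" and lp: "lam * pinv (lam\<^sup>T * lam) \<in> carrier_mat n R"
    using l p by auto
  have lpl: "lam * pinv (lam\<^sup>T * lam) * lam\<^sup>T \<in> carrier_mat n n"
    by (rule mult_carrier_mat[OF lp lT])
  show "Mproj lam \<in> carrier_mat n n" using l lpl unfolding Mproj_def by (intro minus_carrier_mat)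
  have "fmat_of_mat (lam * pinv (lam\<^sup>T * lam) * lam\<^sup>T) = fmat_of_mat lam * (fmat_of_mat (pinv (lam\<^sup>T * lam)) * tr (fmat_of_mat lam))"
    unfolding fmat_of_mat_mult[OF lp lT] fmat_of_mat_mult[OF l p] fmat_of_mat_transpose by (rule mult.assoc)
  then show "fmat_of_mat (Mproj lam) = idf n - fmat_of_mat lam * (fmat_of_mat (pinv (lam\<^sup>T * lam)) * tr (fmat_of_mat lam))"
    using l fmat_of_mat_diff[OF one_carrier_mat lpl] by (simp add: Mproj_def fmat_of_mat_one)
qed

lemma fmat_of_mat_bdotX:
  fixes b :: "real^'k"
  assumes "\<And>k. X k \<in> carrier_mat N T"
  shows "bdotX N T b X \<in> carrier_mat N T"
    and "fmat_of_mat (bdotX N T b X) = (\<Sum>k\<in>UNIV. b $ k *\<^sub>R fmat_of_mat (X k))"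
proof -
  show c: "bdotX N T b X \<in> carrier_mat N T" by (simp add: bdotX_def)
  have es: "entry (sum g S) i j = (\<Sum>k\<in>S. entry (g k) i j)" for g i j and S :: "'k set"
    by (induction S rule: infinite_finite_induct) auto
  show "fmat_of_mat (bdotX N T b X) = (\<Sum>k\<in>UNIV. b $ k *\<^sub>R fmat_of_mat (X k))"
  proof (rule fmat_eqI)
    fix i j
    have "entry (fmat_of_mat (X k)) i j = (if i < N \<and> j < T then X k $$ (i, j) else 0)" for k
      using assms[of k] by (auto simp: entry_fmat_of_mat)
    moreover have "entry (fmat_of_mat (bdotX N T b X)) i j
        = (if i < N \<and> j < T then \<Sum>k\<in>UNIV. b $ k * X k $$ (i, j) else 0)"
      by (simp add: entry_fmat_of_mat bdotX_def)
    ultimately show "entry (fmat_of_mat (bdotX N T b X)) i j = entry (\<Sum>k\<in>UNIV. b $ k *\<^sub>R fmat_of_mat (X k)) i j"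
      by (cases "i < N \<and> j < T")
        (simp_all only: es entry_real_vector if_True if_False simp_thms mult_zero_right sum.neutral_const)
  qed
qed

text \<open>Factor pairs of the two formats correspond to each other, and the nonnegative factor 1 /
  (NT), being monotone and continuous, passes through the infimum.\<close>

lemma LNT_eq_rank_dist:
  assumes "Y - bdotX N T b X \<in> carrier_mat N T"
  shows "LNT N T R Y X b = 1 / (real N * real T) * rank_dist N T R (fmat_of_mat (Y - bdotX N T b X))"
proof -
  define c where "c = 1 / (real N * real T)"
  have c: "0 \<le> c" by (simp add: c_def)
  define Z where "Z = Y - bdotX N T b X"
  define S where "S = {(norm (fmat_of_mat Z - l * tr f))\<^sup>2 | l f. dims l N R \<and> dims f T R}"
  have Z: "Z \<in> carrier_mat N T" using assms by (simp add: Z_def)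
  have eq: "fro_norm (Z - lam * f\<^sup>T) = norm (fmat_of_mat Z - fmat_of_mat lam * tr (fmat_of_mat f))"
    if "lam \<in> carrier_mat N R" "f \<in> carrier_mat T R" for lam f
  proof -
    have fT: "f\<^sup>T \<in> carrier_mat R T" using that by simp
    show ?thesis
      unfolding fro_norm_eq_norm fmat_of_mat_diff[OF Z mult_carrier_mat[OF that(1) fT]] fmat_of_mat_mult[OF that(1) fT] fmat_of_mat_transpose ..
  qed
  have "{c * (fro_norm (Z - lam * f\<^sup>T))\<^sup>2 | lam f. lam \<in> carrier_mat N R \<and> f \<in> carrier_mat T R} = (*) c ` S"
  proof (intro equalityI subsetI)
    fix x assume "x \<in> {c * (fro_norm (Z - lam * f\<^sup>T))\<^sup>2 | lam f. lam \<in> carrier_mat N R \<and> f \<in> carrier_mat T R}"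
    then obtain lam f where "lam \<in> carrier_mat N R" "f \<in> carrier_mat T R" "x = c * (fro_norm (Z - lam * f\<^sup>T))\<^sup>2" by blast
    moreover from this have "(norm (fmat_of_mat Z - fmat_of_mat lam * tr (fmat_of_mat f)))\<^sup>2 \<in> S" unfolding S_def by blast
    ultimately show "x \<in> (*) c ` S" using eq by (metis imageI)
  next
    fix x assume "x \<in> (*) c ` S"
    then obtain l f where lf: "dims l N R" "dims f T R" "x = c * (norm (fmat_of_mat Z - l * tr f))\<^sup>2"
      unfolding S_def by blast
    then have "x = c * (fro_norm (Z - mat_of_fmat N R l * (mat_of_fmat T R f)\<^sup>T))\<^sup>2"
      using eq[OF mat_of_fmat_carrier mat_of_fmat_carrier] by (simp add: fmat_of_mat_mat_of_fmat)
    then show "x \<in> {c * (fro_norm (Z - lam * f\<^sup>T))\<^sup>2 | lam f. lam \<in> carrier_mat N R \<and> f \<in> carrier_mat T R}"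
      using mat_of_fmat_carrier by blast
  qed
  moreover have "Inf ((*) c ` S) = c * Inf S"
  proof -
    have "S \<noteq> {}" unfolding S_def using dims_zero by blast
    moreover have "bdd_below S" unfolding S_def by (auto intro!: bdd_belowI[of _ 0])
    ultimately show ?thesis
      using c continuous_at_Inf_mono[of "(*) c" S] by (simp add: mono_def mult_left_mono continuous_at_imp_continuous_at_within)
  qed
  ultimately show ?thesis
    unfolding LNT_def rank_dist_def S_def Z_def c_def by simp
qed

text \<open>Size and image in one judgement, so that the long products in \<open>WNT\<close> and
  \<open>CNT\<close> are translated by repeated application of introduction rules.\<close>

definition represents :: "real mat \<Rightarrow> nat \<Rightarrow> nat \<Rightarrow> fmat \<Rightarrow> bool" where
  "represents A m n F \<longleftrightarrow> A \<in> carrier_mat m n \<and> fmat_of_mat A = F"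

lemma represents_mult: "represents A m n F \<Longrightarrow> represents B n p G \<Longrightarrow> represents (A * B) m p (F * G)"
  by (auto simp: represents_def fmat_of_mat_mult)

lemma represents_transpose: "represents A m n F \<Longrightarrow> represents (A\<^sup>T) n m (tr F)"
  by (auto simp: represents_def fmat_of_mat_transpose)

lemma mtrace_represents: "represents A n n F \<Longrightarrow> mtrace A = inner F (idf n)"
  by (auto simp: represents_def mtrace_eq_inner)

text \<open>Cyclic invariance of the trace, in the form that isolates a regressor standing in the
  middle of a product.\<close>

lemma inner_mult3_idf:
  assumes "dims C m n" shows "inner (A * B * C) (idf n) = inner (tr A * tr C) B"
proof -
  have "inner (A * B * C) (idf n) = inner (idf n * tr C) (A * B)"
    by (subst inner_commute) (rule inner_mult_right)
  also have "\<dots> = inner (tr A * tr C) B" using assms by (simp add: inner_mult_left)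
  finally show ?thesis .
qed

lemma inner_mult2_idf:
  assumes "dims A n m" shows "inner (A * B) (idf n) = inner (tr A) B"
proof -
  have "inner (A * B) (idf n) = inner (tr A * idf n) B"
    by (subst inner_commute) (rule inner_mult_left)
  then show ?thesis using assms by simp
qed

lemma has_derivative_quadratic_bound:
  fixes \<phi> :: "'a::real_normed_vector \<Rightarrow> 'b::real_normed_vector"
  assumes l: "bounded_linear l"
    and bnd: "\<And>h. norm (\<phi> (b + h) - \<phi> b - l h) \<le> C * (norm h)\<^sup>2"
  shows "(\<phi> has_derivative l) (at b)"
  unfolding has_derivative_at
proof (intro conjI l)
  have *: "norm (norm (\<phi> (b + h) - \<phi> b - l h) / norm h) \<le> \<bar>C\<bar> * norm h" for h
  proof (cases "h = 0")
    case False
    have "norm (\<phi> (b + h) - \<phi> b - l h) \<le> \<bar>C\<bar> * (norm h)\<^sup>2"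
      using bnd[of h] by (meson abs_ge_self mult_right_mono order_trans zero_le_power2)
    with False show ?thesis by (simp add: divide_le_eq power2_eq_square mult.assoc)
  qed simp
  have "((\<lambda>h. \<bar>C\<bar> * norm h) \<longlongrightarrow> 0) (at (0 :: 'a))"
    by (intro tendsto_mult_right_zero tendsto_norm_zero tendsto_ident_at)
  then show "((\<lambda>h. norm (\<phi> (b + h) - \<phi> b - l h) / norm h) \<longlongrightarrow> 0) (at 0)"
    by (rule Lim_null_comparison[OF always_eventually[OF allI[OF *]]])
qed

lemma norm_sum_scaleR_le:
  fixes v :: "real^'k" and F :: "'k \<Rightarrow> 'a::real_normed_vector"
  assumes "\<And>k. norm (F k) \<le> C"
  shows "norm (\<Sum>k\<in>UNIV. v $ k *\<^sub>R F k) \<le> real CARD('k) * C * norm v"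
proof -
  have "norm (\<Sum>k\<in>UNIV. v $ k *\<^sub>R F k) \<le> (\<Sum>k\<in>(UNIV::'k set). norm v * C)"
  proof (rule sum_norm_le)
    fix k
    show "norm (v $ k *\<^sub>R F k) \<le> norm v * C"
      unfolding norm_scaleR using assms[of k] component_le_norm_cart[of v k]
      by (intro mult_mono) auto
  qed
  then show ?thesis by (simp add: mult_ac)
qed

lemma norm_vec_le_card:
  fixes g :: "real^'k"
  assumes "\<And>k. \<bar>g $ k\<bar> \<le> C" shows "norm g \<le> real CARD('k) * C"
proof -
  have "norm g \<le> (\<Sum>k\<in>UNIV. \<bar>g $ k\<bar>)" by (rule norm_le_l1_cart)
  also have "\<dots> \<le> (\<Sum>k\<in>(UNIV::'k set). C)" by (intro sum_mono assms)
  finally show ?thesis by simp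
qed

text \<open>The deterministic core at a fixed \<open>b\<close>. Here \<open>x * m\<close> bounds the
  regressors, \<open>\<alpha>\<close> the spectral norm of the errors and \<open>h\<close> the
  Frobenius norm of (b - b0) X, so \<open>\<alpha> + h\<close> is the noise level. In the bound for
  \<open>g\<close> the first summand is the shift of the quadratic term from E to e, the second the
  cubic remainder. The \<open>R + 1\<close> keeps \<open>s\<close> meaningful for
  \<open>R = 0\<close>.\<close>

lemma score_expansion:
  fixes X :: "'k::finite \<Rightarrow> real mat" and b b0 :: "real^'k" and lam f e :: "real mat"
    and N T R :: nat and c x \<alpha> h s m :: real
  assumes X: "\<And>k. X k \<in> carrier_mat N T" and e: "e \<in> carrier_mat N T"
    and lam: "lam \<in> carrier_mat N R" and f: "f \<in> carrier_mat T R"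
    and RN: "R \<le> N" and N: "0 < N" and T: "0 < T" and c: "0 < c"
    and low_lam: "\<forall>Y p. dims Y R p \<longrightarrow> c * real N * (norm Y)\<^sup>2 \<le> (norm (fmat_of_mat lam * Y))\<^sup>2"
    and low_f: "\<forall>Y p. dims Y R p \<longrightarrow> c * real T * (norm Y)\<^sup>2 \<le> (norm (fmat_of_mat f * Y))\<^sup>2"
    and m: "m = sqrt (real N * real T)"
    and nX: "\<And>k. norm (fmat_of_mat (X k)) \<le> x * m"
    and \<alpha>: "spec_norm e \<le> \<alpha>"
    and h: "real CARD('k) * (x * m) * norm (b - b0) \<le> h"
    and s: "s = c * m / (real R + 1)"
    and small: "4 * ((3 * sqrt (real R) + 2) * (\<alpha> + h)) \<le> s"
  defines "Y \<equiv> bdotX N T b0 X + lam * f\<^sup>T + e"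
  shows "\<exists>g :: real^'k.
      (RNT N T R b0 X lam f e has_derivative (\<lambda>h. g \<bullet> h)) (at b) \<and>
      (LNT N T R Y X has_derivative (\<lambda>h. (2 *\<^sub>R (WNT N T X lam f *v (b - b0))
          - (2 / m) *\<^sub>R CNT N T X lam f e + (1 / (real N * real T)) *\<^sub>R g) \<bullet> h)) (at b) \<and>
      norm g \<le> real CARD('k) * (2 * (x * m) * (3 / s * (2 * \<alpha> * h + h\<^sup>2)
          + 11 * (((3 * sqrt (real R) + 2) * (\<alpha> + h)) ^ 3 / s\<^sup>2)))"
proof -
  define d where "d = b - b0"
  have m0: "0 < m" and m2: "m\<^sup>2 = real N * real T" using N T by (simp_all add: m)
  have s0: "0 < s" using c m0 by (simp add: s)
  have cN: "0 < c * real N" "0 < c * real T" using c N T by auto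
  define pl where "pl = pinv (lam\<^sup>T * lam)"
  define pf where "pf = pinv (f\<^sup>T * f)"
  define Wl where "Wl = fmat_of_mat pl"
  define Wf where "Wf = fmat_of_mat pf"
  define l where "l = fmat_of_mat lam"
  define F where "F = fmat_of_mat f"
  note gl = gram_inverse[OF lam cN(1) low_lam, folded pl_def, folded Wl_def l_def]
  note gf = gram_inverse[OF f cN(2) low_f, folded pf_def, folded Wf_def F_def]
  have dl: "dims l N R" and dF: "dims F T R" using lam f by (auto simp: l_def F_def)
  \<comment> \<open>\<open>Vl\<close> and \<open>Vf\<close> are left inverses of \<open>l\<close>
    and \<open>F\<close>, and \<open>K\<close> below is the Moore-Penrose inverse of
    \<open>l * tr F\<close>, equal to F (F'F)^(-1) (l'l)^(-1) l'.\<close>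
  define Vl where "Vl = Wl * tr l"
  define Vf where "Vf = Wf * tr F"
  have dV: "dims Vl R N" "dims Vf R T" using gl(2) gf(2) dl dF by (auto simp: Vl_def Vf_def)
  have trV: "tr Vl = l * Wl" "tr Vf = F * Wf" by (simp_all add: Vl_def Vf_def gl gf)
  have Vl: "Vl * l = idf R" and Vf: "Vf * F = idf R" using gl(4) gf(4) by (simp_all add: Vl_def Vf_def mult.assoc)
  have Vl': "tr l * tr Vl = idf R" and Vf': "tr F * tr Vf = idf R"
    using Vl Vf tr_idf by (metis tr_mult)+
  define G where "G = l * tr F"
  define K where "K = tr Vf * Vl"
  define Xf where "Xf = (\<lambda>k. fmat_of_mat (X k))"
  define \<Delta> where "\<Delta> = (\<Sum>k\<in>UNIV. d $ k *\<^sub>R Xf k)"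
  define ef where "ef = fmat_of_mat e"
  define E where "E = ef - \<Delta>"
  have dX: "dims (Xf k) N T" for k using X by (auto simp: Xf_def)
  have de: "dims ef N T" using e by (auto simp: ef_def)
  have d\<Delta>: "dims \<Delta> N T" unfolding \<Delta>_def by (intro dims_sum dims_scaleR dX)
  have GK: "G * K = l * Vl"
  proof -
    have "G * K = l * (tr F * tr Vf) * Vl" by (simp only: G_def K_def mult.assoc)
    then show ?thesis unfolding Vf' using dl by simp
  qed
  have KG: "K * G = tr Vf * tr F"
  proof -
    have "K * G = tr Vf * (Vl * l) * tr F" by (simp only: G_def K_def mult.assoc)
    moreover have "tr Vf * idf R = tr Vf" using dV(2) by (intro mult_idf[of _ T]) simp
    ultimately show ?thesis unfolding Vl by simp
  qed
  have trGK: "tr (l * Vl) = l * Vl" by (simp add: Vl_def gl(3) mult.assoc)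
  have trKG: "tr (tr Vf * tr F) = tr Vf * tr F"
    by (simp only: tr_mult tr_real_vector) (simp add: Vf_def gf(3) mult.assoc)
  have h0: "0 \<le> h"
  proof -
    have "0 \<le> x * m" using nX norm_ge_zero order_trans by blast
    then have "0 \<le> real CARD('k) * (x * m) * norm (b - b0)" by simp
    then show ?thesis using h by linarith
  qed
  have n\<Delta>: "norm \<Delta> \<le> h"
    unfolding \<Delta>_def using norm_sum_scaleR_le[of Xf "x * m" d] nX h by (fastforce simp: Xf_def d_def)
  have op_bound_e: "op_bound ef \<alpha>" unfolding ef_def by (rule op_bound_mono[OF op_bound_spec_norm \<alpha>])
  have nK: "norm K \<le> 1 / s"
  proof -
    have "norm K \<le> norm (tr Vf) * norm Vl" unfolding K_def by (rule norm_mult_ineq)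
    also have "\<dots> = norm Vf * norm Vl" by simp
    also have "\<dots> \<le> sqrt (real R / (c * real T)) * sqrt (real R / (c * real N))"
    proof (rule mult_mono)
      show "norm Vf \<le> sqrt (real R / (c * real T))" using gf(5) by (intro real_le_rsqrt) (simp add: Vf_def)
      show "norm Vl \<le> sqrt (real R / (c * real N))" using gl(5) by (intro real_le_rsqrt) (simp add: Vl_def)
    qed (use c in auto)
    also have "\<dots> = sqrt ((real R)\<^sup>2 / (c\<^sup>2 * (real N * real T)))"
      by (simp add: real_sqrt_mult[symmetric] power2_eq_square mult_ac)
    also have "\<dots> = real R / (c * m)"
      using c by (simp add: real_sqrt_divide real_sqrt_mult m)
    also have "\<dots> \<le> 1 / s" using c m0 by (simp add: s divide_simps)
    finally show ?thesis .
  qed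
  interpret p: factor_perturbation N T R G K E l "tr Vl" s "\<alpha> + h"
  proof
    show "G * K * G = G"
    proof -
      have "G * K * G = l * (Vl * l) * tr F" unfolding GK by (simp only: G_def mult.assoc)
      then show ?thesis unfolding Vl using dl by (simp add: G_def)
    qed
    show "K * G * K = K"
    proof -
      have "K * G * K = tr Vf * (tr F * tr Vf) * Vl" unfolding KG by (simp only: K_def mult.assoc)
      moreover have "tr Vf * (tr F * tr Vf) = tr Vf" unfolding Vf' using dV(2) by (intro mult_idf[of _ T]) simp
      ultimately show ?thesis by (simp add: K_def)
    qed
    show "dims G N T" using dl dF by (auto simp: G_def)
    show "dims K T N" using dV by (auto simp: K_def)
    show "dims E N T" using de d\<Delta> by (auto simp: E_def)
    show "tr (G * K) = G * K" unfolding GK by (rule trGK)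
    show "tr (K * G) = K * G" unfolding KG by (rule trKG)
    show "G * K = l * tr (tr Vl)" by (simp add: GK)
    show "dims (tr Vl) N R" using dV by simp
    show "(norm (G * K))\<^sup>2 = real R" unfolding GK using gl(6) by (simp add: Vl_def)
    have "norm (K * G) = norm (tr (F * Vf))" by (simp add: KG)
    then show "(norm (K * G))\<^sup>2 = real R" using gf(6) by (simp only: norm_tr Vf_def)
    show "op_bound E (\<alpha> + h)" unfolding E_def
      by (rule op_bound_diff[OF op_bound_e op_bound_mono[OF op_bound_norm n\<Delta>]])
  qed (use RN dl s0 nK small in auto)
  obtain B C where BC: "dims B N T" "0 \<le> C"
    "\<And>H. dims H N T \<Longrightarrow>
      \<bar>rank_dist N T R (p.Z + H) - rank_dist N T R p.Z - 2 * inner B H\<bar> \<le> C * (norm H)\<^sup>2"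
    "norm (B - (p.M0 * E * p.N0 - p.second E)) \<le> 11 * (p.y ^ 3 / s\<^sup>2)"
    using p.residual_matrix by blast
  have cpl: "pl \<in> carrier_mat R R" and cpf: "pf \<in> carrier_mat R R" using gl(1) gf(1) by auto
  have M0: "p.M0 = fmat_of_mat (Mproj lam)" "Mproj lam \<in> carrier_mat N N"
    using fmat_of_mat_Mproj[OF lam gl(1)[unfolded pl_def]]
    by (simp_all add: p.M0_def p.P0_def GK Vl_def Wl_def pl_def l_def)
  have "tr Vf * tr F = F * Vf" using trKG by simp
  then have N0: "p.N0 = fmat_of_mat (Mproj f)" "Mproj f \<in> carrier_mat T T"
    using fmat_of_mat_Mproj[OF f gf(1)[unfolded pf_def]]
    by (simp_all add: p.N0_def p.Q0_def KG Vf_def Wf_def pf_def F_def)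
  have r: "represents (Mproj lam) N N p.M0" "represents (Mproj f) T T p.N0" "\<And>k. represents (X k) N T (Xf k)"
    "represents e N T ef" "represents lam N R l" "represents f T R F" "represents pl R R Wl" "represents pf R R Wf"
    using M0 N0 X e lam f cpl cpf by (simp_all add: represents_def Xf_def ef_def l_def F_def Wl_def Wf_def)
  \<comment> \<open>The tails of the three traces in \<open>CNT2\<close> collapse to
    \<open>K\<close> or its transpose.\<close>
  have KF: "Q * F * Wf * Wl * tr l = Q * K" for Q by (simp add: K_def Vl_def trV mult.assoc)
  have tK: "Q * l * Wl * Wf * tr F = Q * tr K" for Q by (simp add: K_def Vf_def trV mult.assoc)
  have dK: "dims K T N" using dV by (auto simp: K_def)
  have W: "WNT N T X lam f $ i $ j = 1 / m\<^sup>2 * inner (p.M0 * Xf i * p.N0) (Xf j)" for i j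
  proof -
    have r1: "represents (Mproj f * (X i)\<^sup>T * Mproj lam * X j) T T (p.N0 * tr (Xf i) * p.M0 * Xf j)"
      by (rule represents_mult represents_transpose r)+
    have "dims (p.N0 * tr (Xf i) * p.M0) T N"
      using p.M0(3) p.N0(3) dX de by (auto intro!: dims_mult)
    from inner_mult2_idf[OF this, of "Xf j"] mtrace_represents[OF r1]
    have "mtrace (Mproj f * (X i)\<^sup>T * Mproj lam * X j) = inner (p.M0 * Xf i * p.N0) (Xf j)"
      by (simp add: p.M0(1) p.N0(1) mult.assoc)
    then show ?thesis by (simp add: WNT_def m2)
  qed
  have C1: "CNT1 N T X lam f e $ k = 1 / m * inner (p.M0 * ef * p.N0) (Xf k)" for k
  proof -
    have r1: "represents (Mproj f * e\<^sup>T * Mproj lam * X k) T T (p.N0 * tr ef * p.M0 * Xf k)"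
      by (rule represents_mult represents_transpose r)+
    have "dims (p.N0 * tr ef * p.M0) T N"
      using p.M0(3) p.N0(3) dX de by (auto intro!: dims_mult)
    from inner_mult2_idf[OF this, of "Xf k"] mtrace_represents[OF r1]
    have "mtrace (Mproj f * e\<^sup>T * Mproj lam * X k) = inner (p.M0 * ef * p.N0) (Xf k)"
      by (simp add: p.M0(1) p.N0(1) mult.assoc)
    then show ?thesis by (simp add: CNT1_def m)
  qed
  have C2: "CNT2 N T X lam f e $ k = - (1 / m) * inner (p.second ef) (Xf k)" for k
  proof -
    have "represents (e * Mproj f * e\<^sup>T * Mproj lam * X k * f * pf * pl * lam\<^sup>T) N N
        (ef * p.N0 * tr ef * p.M0 * Xf k * F * Wf * Wl * tr l)"
      by (rule represents_mult represents_transpose r)+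
    from mtrace_represents[OF this, unfolded KF]
    have 1: "mtrace (e * Mproj f * e\<^sup>T * Mproj lam * X k * f * pf * pl * lam\<^sup>T)
        = inner (p.M0 * ef * p.N0 * tr ef * tr K) (Xf k)"
      using inner_mult3_idf[OF dK, of "ef * p.N0 * tr ef * p.M0" "Xf k"]
      unfolding KF by (simp add: p.M0(1) p.N0(1) mult.assoc)
    have "represents (e\<^sup>T * Mproj lam * e * Mproj f * (X k)\<^sup>T * lam * pl * pf * f\<^sup>T) T T
        (tr ef * p.M0 * ef * p.N0 * tr (Xf k) * l * Wl * Wf * tr F)"
      by (rule represents_mult represents_transpose r)+
    from mtrace_represents[OF this, unfolded tK]
    have "mtrace (e\<^sup>T * Mproj lam * e * Mproj f * (X k)\<^sup>T * lam * pl * pf * f\<^sup>T)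
        = inner (tr ef * p.M0 * ef * p.N0 * tr (Xf k) * tr K) (idf T)"
      by (simp only: mult.assoc)
    also have "\<dots> = inner (tr (tr K * tr ef * p.M0 * ef * p.N0)) (tr (Xf k))"
      by (subst inner_mult3_idf[of _ N]) (simp_all add: dK p.M0(1) p.N0(1) mult.assoc)
    finally have 2: "mtrace (e\<^sup>T * Mproj lam * e * Mproj f * (X k)\<^sup>T * lam * pl * pf * f\<^sup>T)
        = inner (tr K * tr ef * p.M0 * ef * p.N0) (Xf k)" by (simp only: inner_tr)
    have "represents (e\<^sup>T * Mproj lam * X k * Mproj f * e\<^sup>T * lam * pl * pf * f\<^sup>T) T T
        (tr ef * p.M0 * Xf k * p.N0 * tr ef * l * Wl * Wf * tr F)"
      by (rule represents_mult represents_transpose r)+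
    from mtrace_represents[OF this, unfolded tK]
    have "mtrace (e\<^sup>T * Mproj lam * X k * Mproj f * e\<^sup>T * lam * pl * pf * f\<^sup>T)
        = inner (tr ef * p.M0 * Xf k * (p.N0 * tr ef * tr K)) (idf T)"
      by (simp only: mult.assoc)
    also have "\<dots> = inner (p.M0 * ef * K * ef * p.N0) (Xf k)"
    proof -
      have "dims (p.N0 * tr ef * tr K) T T" using p.N0(3) de dK by (intro dims_mult[of _ _ N] dims_mult[of _ _ T]) auto
      then show ?thesis
        by (subst inner_mult3_idf) (simp_all add: p.M0(1) p.N0(1) mult.assoc)
    qed
    finally have 3: "mtrace (e\<^sup>T * Mproj lam * X k * Mproj f * e\<^sup>T * lam * pl * pf * f\<^sup>T)
        = inner (p.M0 * ef * K * ef * p.N0) (Xf k)" .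
    show ?thesis
      unfolding CNT2_def vec_lambda_beta pl_def[symmetric] pf_def[symmetric] 1 2 3 m[symmetric]
      by (simp add: p.second_def inner_add_left algebra_simps)
  qed
  define W where "W = WNT N T X lam f"
  define CC where "CC = CNT N T X lam f e"
  have Wsym: "W $ i $ j = W $ j $ i" for i j
  proof -
    have "inner (p.M0 * Xf i * p.N0) (Xf j) = inner (p.M0 * Xf i) (Xf j * p.N0)"
      by (simp add: inner_mult_right p.N0(1))
    also have "\<dots> = inner (Xf j * p.N0) (p.M0 * Xf i)" by (rule inner_commute)
    also have "\<dots> = inner (p.M0 * Xf j * p.N0) (Xf i)" by (simp add: inner_mult_left p.M0(1) mult.assoc)
    finally show ?thesis by (simp add: W_def W)
  qed
  have Wd: "(W *v d) $ k = 1 / m\<^sup>2 * inner (p.M0 * \<Delta> * p.N0) (Xf k)" for k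
  proof -
    have "(W *v d) $ k = (\<Sum>j\<in>UNIV. W $ j $ k * d $ j)"
      by (simp add: matrix_vector_mult_def Wsym[of k])
    also have "\<dots> = (\<Sum>j\<in>UNIV. 1 / m\<^sup>2 * inner (p.M0 * (d $ j *\<^sub>R Xf j) * p.N0) (Xf k))"
      by (intro sum.cong refl) (simp add: W_def W mult_ac)
    also have "\<dots> = 1 / m\<^sup>2 * inner (p.M0 * \<Delta> * p.N0) (Xf k)"
      by (simp only: \<Delta>_def sum_distrib_left sum_distrib_right inner_sum_left)
    finally show ?thesis .
  qed
  define u where "u = (\<chi> k. inner B (Xf k))"
  define L where "L = LNT N T R Y X"
  have YL: "L v = 1 / m\<^sup>2 * rank_dist N T R (p.Z - (\<Sum>k\<in>UNIV. (v - b) $ k *\<^sub>R Xf k))" for v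
  proof -
    note bX = fmat_of_mat_bdotX[OF X]
    have fT: "f\<^sup>T \<in> carrier_mat R T" using f by simp
    have lf: "lam * f\<^sup>T \<in> carrier_mat N T" by (rule mult_carrier_mat[OF lam fT])
    have Y1: "bdotX N T b0 X + lam * f\<^sup>T \<in> carrier_mat N T" using bX(1) lf by (intro add_carrier_mat)
    have Y2: "Y \<in> carrier_mat N T" unfolding Y_def using e by (intro add_carrier_mat)
    have Y3: "Y - bdotX N T v X \<in> carrier_mat N T" using bX(1) by (intro minus_carrier_mat)
    have "fmat_of_mat (Y - bdotX N T v X) = (\<Sum>k\<in>UNIV. b0 $ k *\<^sub>R Xf k) + G + ef - (\<Sum>k\<in>UNIV. v $ k *\<^sub>R Xf k)"
      unfolding fmat_of_mat_diff[OF Y2 bX(1)] unfolding Y_def fmat_of_mat_add[OF Y1 e] fmat_of_mat_add[OF bX(1) lf] fmat_of_mat_mult[OF lam fT]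
        fmat_of_mat_transpose bX(2) by (simp only: Xf_def G_def l_def F_def ef_def)
    also have "\<dots> = p.Z - (\<Sum>k\<in>UNIV. (v - b) $ k *\<^sub>R Xf k)"
    proof -
      have pZ: "p.Z = G + (ef - \<Delta>)" unfolding p.Z_def by (simp only: E_def)
      have sd: "(\<Sum>k\<in>UNIV. (v - w) $ k *\<^sub>R Xf k) = (\<Sum>k\<in>UNIV. v $ k *\<^sub>R Xf k) - (\<Sum>k\<in>UNIV. w $ k *\<^sub>R Xf k)" for v w :: "real^'k"
        by (simp add: scaleR_left_diff_distrib sum_subtractf)
      show ?thesis unfolding pZ unfolding \<Delta>_def d_def sd by simp
    qed
    finally show ?thesis using LNT_eq_rank_dist[OF Y3] by (simp add: L_def m2)
  qed
  have derL: "(L has_derivative (\<lambda>h. (- (2 / m\<^sup>2)) *\<^sub>R u \<bullet> h)) (at b)"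
  proof (rule has_derivative_quadratic_bound)
    show "bounded_linear (\<lambda>h. (- (2 / m\<^sup>2)) *\<^sub>R u \<bullet> h)" by (rule bounded_linear_inner_right)
    fix v :: "real^'k"
    define H where "H = - (\<Sum>k\<in>UNIV. v $ k *\<^sub>R Xf k)"
    have dH: "dims H N T" unfolding H_def by (intro dims_uminus dims_sum dims_scaleR dX)
    have nH: "norm H \<le> real CARD('k) * (x * m) * norm v"
      unfolding H_def norm_minus_cancel by (rule norm_sum_scaleR_le) (use nX in \<open>simp add: Xf_def\<close>)
    have uv: "u \<bullet> v = - inner B H"
      by (simp add: u_def inner_vec_def H_def inner_sum_right mult_ac)
    have "L (b + v) - L b - (- (2 / m\<^sup>2)) *\<^sub>R u \<bullet> v
        = 1 / m\<^sup>2 * (rank_dist N T R (p.Z + H) - rank_dist N T R p.Z - 2 * inner B H)"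
      unfolding YL inner_scaleR_left uv by (simp add: H_def algebra_simps)
    then have "norm (L (b + v) - L b - (- (2 / m\<^sup>2)) *\<^sub>R u \<bullet> v)
        \<le> 1 / m\<^sup>2 * (C * (norm H)\<^sup>2)"
      using BC(3)[OF dH] by (simp add: abs_mult mult_left_mono divide_right_mono)
    also have "\<dots> \<le> 1 / m\<^sup>2 * (C * (real CARD('k) * (x * m) * norm v)\<^sup>2)"
      using nH BC(2) by (intro mult_left_mono power_mono) auto
    also have "\<dots> = (1 / m\<^sup>2 * (C * (real CARD('k) * (x * m))\<^sup>2)) * (norm v)\<^sup>2"
      by (simp add: power_mult_distrib)
    finally show "norm (L (b + v) - L b - (- (2 / m\<^sup>2)) *\<^sub>R u \<bullet> v)
        \<le> (1 / m\<^sup>2 * (C * (real CARD('k) * (x * m))\<^sup>2)) * (norm v)\<^sup>2" .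
  qed
  \<comment> \<open>Forced by the definition of \<open>RNT\<close>: \<open>- 2 *\<^sub>R u\<close>
    is the gradient of NT times \<open>L\<close>, the other two terms are those of the linear and
    quadratic corrections.\<close>
  define g where "g = - 2 *\<^sub>R u + (2 * m) *\<^sub>R CC - (2 * m\<^sup>2) *\<^sub>R (W *v d)"
  have derR: "(RNT N T R b0 X lam f e has_derivative (\<lambda>h. g \<bullet> h)) (at b)"
  proof -
    have Rf: "RNT N T R b0 X lam f e = (\<lambda>v. m\<^sup>2 * (L v - L b0 + 2 / m * ((v - b0) \<bullet> CC) - (v - b0) \<bullet> (W *v (v - b0))))"
      by (rule ext) (simp add: RNT_def L_def Y_def CC_def W_def m2 m Let_def)
    have sym: "d \<bullet> (W *v v) = v \<bullet> (W *v d)" for v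
    proof -
      have "d \<bullet> (W *v v) = (\<Sum>i\<in>UNIV. \<Sum>j\<in>UNIV. d $ i * (W $ i $ j * v $ j))"
        by (simp add: inner_vec_def matrix_vector_mult_def sum_distrib_left)
      also have "\<dots> = (\<Sum>j\<in>UNIV. \<Sum>i\<in>UNIV. d $ i * (W $ i $ j * v $ j))" by (rule sum.swap)
      also have "\<dots> = v \<bullet> (W *v d)"
        by (simp add: inner_vec_def matrix_vector_mult_def sum_distrib_left Wsym mult_ac)
      finally show ?thesis .
    qed
    have "((\<lambda>v. m\<^sup>2 * (L v - L b0 + 2 / m * ((v - b0) \<bullet> CC) - (v - b0) \<bullet> (W *v (v - b0)))) has_derivative
      (\<lambda>v. m\<^sup>2 * ((- (2 / m\<^sup>2)) *\<^sub>R u \<bullet> v + 2 / m * (v \<bullet> CC) - (d \<bullet> (W *v v) + v \<bullet> (W *v d))))) (at b)"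
      unfolding d_def using m0 by (auto intro!: derivative_eq_intros derL bounded_linear.has_derivative[OF matrix_vector_mul_bounded_linear])
    moreover have "m\<^sup>2 * ((- (2 / m\<^sup>2)) *\<^sub>R u \<bullet> v + 2 / m * (v \<bullet> CC) - (d \<bullet> (W *v v) + v \<bullet> (W *v d))) = g \<bullet> v" for v
      unfolding sym g_def using m0
      by (simp add: inner_diff_left inner_add_left algebra_simps power2_eq_square inner_commute)
    ultimately show ?thesis unfolding Rf by simp
  qed
  have derL': "2 *\<^sub>R (W *v d) - (2 / m) *\<^sub>R CC + (1 / (real N * real T)) *\<^sub>R g = (- (2 / m\<^sup>2)) *\<^sub>R u"
    unfolding g_def m2[symmetric] using m0
    by (simp add: scaleR_add_right scaleR_diff_right power2_eq_square field_simps)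
  have bound: "\<bar>g $ k\<bar> \<le> 2 * (x * m) * (3 / s * (2 * \<alpha> * h + h\<^sup>2) + 11 * (p.y ^ 3 / s\<^sup>2))" for k
  proof -
    define D1 where "D1 = B - (p.M0 * E * p.N0 - p.second E)"
    define D2 where "D2 = p.second E - p.second ef"
    have D2: "norm D2 \<le> 3 / s * (2 * \<alpha> * h + h\<^sup>2)"
      using p.norm_second_diff[OF op_bound_e, of "- \<Delta>" h] n\<Delta> by (simp add: D2_def E_def)
    have "g $ k = - 2 * inner B (Xf k) + 2 * inner (p.M0 * ef * p.N0 - p.second ef) (Xf k)
        - 2 * inner (p.M0 * \<Delta> * p.N0) (Xf k)"
      unfolding g_def using m0
      by (simp add: Wd u_def CC_def CNT_def C1 C2 inner_diff_left field_simps)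
    \<comment> \<open>\<open>W\<close> contributes the linear term at \<Delta> and
      \<open>CNT1\<close> the one at \<open>ef\<close>; since \<open>E = ef - \<Delta>\<close> they
      combine to the linear part of \<open>B\<close> and cancel. The shift \<open>D2\<close> and the
      expansion error \<open>D1\<close> remain.\<close>
    also have "\<dots> = 2 * inner (D2 - D1) (Xf k)"
      by (simp add: D1_def D2_def E_def inner_diff_left inner_add_left left_diff_distrib right_diff_distrib)
    finally have "\<bar>g $ k\<bar> = 2 * \<bar>inner (D2 - D1) (Xf k)\<bar>" by simp
    also have "\<dots> \<le> 2 * (norm (D2 - D1) * norm (Xf k))"
      using Cauchy_Schwarz_ineq2[of "D2 - D1" "Xf k"] by simp
    also have "\<dots> \<le> 2 * ((3 / s * (2 * \<alpha> * h + h\<^sup>2) + 11 * (p.y ^ 3 / s\<^sup>2)) * (x * m))"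
    proof -
      have "norm (D2 - D1) \<le> 3 / s * (2 * \<alpha> * h + h\<^sup>2) + 11 * (p.y ^ 3 / s\<^sup>2)"
        using norm_triangle_ineq4[of D2 D1] D2 BC(4) unfolding D1_def by linarith
      moreover have "norm (Xf k) \<le> x * m" using nX by (simp add: Xf_def)
      ultimately have "norm (D2 - D1) * norm (Xf k) \<le> (3 / s * (2 * \<alpha> * h + h\<^sup>2) + 11 * (p.y ^ 3 / s\<^sup>2)) * (x * m)"
        by (meson mult_mono norm_ge_zero order_trans)
      then show ?thesis by simp
    qed
    finally show ?thesis by (simp only: mult_ac)
  qed
  have "norm g \<le> real CARD('k) * (2 * (x * m) * (3 / s * (2 * \<alpha> * h + h\<^sup>2) + 11 * (p.y ^ 3 / s\<^sup>2)))"
    by (rule norm_vec_le_card[OF bound])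
  then show ?thesis
    using derR derL derL' unfolding L_def W_def CC_def d_def p.y_def by (intro exI[of _ g]) simp
qed

section \<open>Events with probability approaching one\<close>

text \<open>Inner probability is not additive, so calculations are carried out with measurable sets
  of nearly full probability inside the events.\<close>

lemma (in prob_space) wpa1_iff:
  "wpa1 M P \<longleftrightarrow>
    (\<forall>\<delta>>0. \<forall>\<^sub>F n in sequentially. \<exists>A\<in>sets M. A \<subseteq> {\<omega>\<in>space M. P n \<omega>} \<and> 1 - \<delta> < prob A)"
proof -
  let ?S = "\<lambda>n. {A\<in>sets M. A \<subseteq> {\<omega>\<in>space M. P n \<omega>}}"
  have bdd: "bdd_above (prob ` ?S n)" for n
    by (intro bdd_aboveI[of _ 1]) auto
  have ne: "prob ` ?S n \<noteq> {}" for n by (auto intro!: exI[of _ "{}"])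
  have le1: "inner_prob M {\<omega>\<in>space M. P n \<omega>} \<le> 1" for n
    unfolding inner_prob_def by (rule cSup_least[OF ne]) auto
  have "1 - \<delta> < inner_prob M {\<omega>\<in>space M. P n \<omega>} \<longleftrightarrow>
      (\<exists>A\<in>sets M. A \<subseteq> {\<omega>\<in>space M. P n \<omega>} \<and> 1 - \<delta> < prob A)" for n \<delta>
    unfolding inner_prob_def less_cSup_iff[OF ne bdd] by auto
  moreover have "wpa1 M P \<longleftrightarrow> (\<forall>\<delta>>0. \<forall>\<^sub>F n in sequentially. 1 - \<delta> < inner_prob M {\<omega>\<in>space M. P n \<omega>})"
  proof
    assume "wpa1 M P"
    then have lim: "(\<lambda>n. inner_prob M {\<omega>\<in>space M. P n \<omega>}) \<longlonglongrightarrow> 1" by (simp add: wpa1_def)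
    show "\<forall>\<delta>>0. \<forall>\<^sub>F n in sequentially. 1 - \<delta> < inner_prob M {\<omega>\<in>space M. P n \<omega>}"
      using order_tendstoD(1)[OF lim] by auto
  next
    assume H: "\<forall>\<delta>>0. \<forall>\<^sub>F n in sequentially. 1 - \<delta> < inner_prob M {\<omega>\<in>space M. P n \<omega>}"
    show "wpa1 M P" unfolding wpa1_def
    proof (rule order_tendstoI)
      fix a :: real assume "a < 1"
      then show "\<forall>\<^sub>F n in sequentially. a < inner_prob M {\<omega>\<in>space M. P n \<omega>}"
        using H[rule_format, of "1 - a"] by simp
    next
      fix a :: real assume "1 < a"
      then show "\<forall>\<^sub>F n in sequentially. inner_prob M {\<omega>\<in>space M. P n \<omega>} < a"
        using le1 by (intro always_eventually allI) (meson le_less_trans)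
    qed
  qed
  ultimately show ?thesis by simp
qed

lemma (in prob_space) wpa1_mono:
  assumes "wpa1 M P" "\<forall>\<^sub>F n in sequentially. \<forall>\<omega>\<in>space M. P n \<omega> \<longrightarrow> Q n \<omega>"
  shows "wpa1 M Q"
  unfolding wpa1_iff
proof (intro allI impI)
  fix \<delta> :: real assume "0 < \<delta>"
  then have "\<forall>\<^sub>F n in sequentially. \<exists>A\<in>sets M. A \<subseteq> {\<omega>\<in>space M. P n \<omega>} \<and> 1 - \<delta> < prob A"
    using assms(1) unfolding wpa1_iff by blast
  with assms(2) show "\<forall>\<^sub>F n in sequentially. \<exists>A\<in>sets M. A \<subseteq> {\<omega>\<in>space M. Q n \<omega>} \<and> 1 - \<delta> < prob A"
    by eventually_elim blast
qed

text \<open>Each measurable witness misses less than \<delta> / 2, so their intersection misses less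
  than \<delta>.\<close>

lemma (in prob_space) wpa1_conj:
  assumes "wpa1 M P" "wpa1 M Q" shows "wpa1 M (\<lambda>n \<omega>. P n \<omega> \<and> Q n \<omega>)"
  unfolding wpa1_iff
proof (intro allI impI)
  fix \<delta> :: real assume \<delta>: "0 < \<delta>"
  have "\<forall>\<^sub>F n in sequentially. \<exists>A\<in>sets M. A \<subseteq> {\<omega>\<in>space M. P n \<omega>} \<and> 1 - \<delta> / 2 < prob A"
    "\<forall>\<^sub>F n in sequentially. \<exists>A\<in>sets M. A \<subseteq> {\<omega>\<in>space M. Q n \<omega>} \<and> 1 - \<delta> / 2 < prob A"
    using assms \<delta> unfolding wpa1_iff by (meson half_gt_zero)+
  then show "\<forall>\<^sub>F n in sequentially. \<exists>A\<in>sets M. A \<subseteq> {\<omega>\<in>space M. P n \<omega> \<and> Q n \<omega>} \<and> 1 - \<delta> < prob A"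
  proof eventually_elim
    case (elim n)
    then obtain A B where A: "A \<in> sets M" "A \<subseteq> {\<omega>\<in>space M. P n \<omega>}" "1 - \<delta> / 2 < prob A"
      and B: "B \<in> sets M" "B \<subseteq> {\<omega>\<in>space M. Q n \<omega>}" "1 - \<delta> / 2 < prob B" by blast
    have "prob (A \<union> B) = prob A + prob (B - A)" using A(1) B(1) by (rule finite_measure_Union')
    moreover have "prob (B - A) = prob B - prob (A \<inter> B)"
      using finite_measure_Diff'[OF B(1) A(1)] by (simp add: Int_commute)
    moreover have "prob (A \<union> B) \<le> 1" by (rule prob_le_1)
    ultimately have "1 - \<delta> < prob (A \<inter> B)" using A(3) B(3) by argo
    moreover have "A \<inter> B \<in> sets M" using A(1) B(1) by blast
    moreover have "A \<inter> B \<subseteq> {\<omega>\<in>space M. P n \<omega> \<and> Q n \<omega>}" using A(2) B(2) by blast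
    ultimately show ?case by blast
  qed
qed

lemma (in prob_space) wpa1_ball:
  assumes "finite I" "\<And>i. i \<in> I \<Longrightarrow> wpa1 M (P i)"
  shows "wpa1 M (\<lambda>n \<omega>. \<forall>i\<in>I. P i n \<omega>)"
  using assms
proof (induction I)
  case empty
  have "1 - \<delta> < prob (space M)" if "0 < \<delta>" for \<delta> using that by (simp add: prob_space)
  then show ?case unfolding wpa1_iff
    by (intro allI impI always_eventually bexI[of _ "space M"]) auto
next
  case (insert i I)
  have "wpa1 M (\<lambda>n \<omega>. P i n \<omega> \<and> (\<forall>i\<in>I. P i n \<omega>))"
    by (rule wpa1_conj) (use insert in auto)
  then show ?case by simp
qed

section \<open>Uniform lower bounds from convergence of the Gram matrices\<close>

lemma inner_fmat_of_vec:
  assumes "v \<in> carrier_vec n" "w \<in> carrier_vec n" shows "inner (fmat_of_vec v) (fmat_of_vec w) = v \<bullet> w"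
  by (subst inner_fmat_entries[OF disjI1[OF dims_fmat_of_vec[OF assms(1)]]])
    (use assms in \<open>simp add: entry_fmat_of_vec scalar_prod_def atLeast0LessThan\<close>)

text \<open>A form positive on the compact unit sphere of columns has a positive minimum there;
  homogeneity and then summation over columns extend the bound to matrices of any width.\<close>

lemma pos_def_mat_coercive:
  assumes S: "S \<in> carrier_mat R R" and pd: "pos_def_mat S"
  obtains c where "0 < c" "\<And>Y p. dims Y R p \<Longrightarrow> c * (norm Y)\<^sup>2 \<le> inner Y (fmat_of_mat S * Y)"
proof -
  have pos: "0 < inner Y (fmat_of_mat S * Y)" if Y: "dims Y R 1" "Y \<noteq> 0" for Y
  proof -
    obtain v where v: "v \<in> carrier_vec R" "fmat_of_vec v = Y" using ex_fmat_of_vec[OF Y(1)] by blast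
    have "fmat_of_vec (0\<^sub>v R) = 0" by (rule fmat_eqI) (auto simp: entry_fmat_of_vec)
    then have "v \<noteq> 0\<^sub>v R" using v(2) Y(2) by blast
    then have "0 < v \<bullet> (S *\<^sub>v v)" using pd S v(1) unfolding pos_def_mat_def by auto
    moreover have "S *\<^sub>v v \<in> carrier_vec R" using S by (metis mult_mat_vec_carrier v(1))
    ultimately show ?thesis
      unfolding v(2)[symmetric] fmat_of_vec_mult[OF S v(1), symmetric] by (simp add: inner_fmat_of_vec[OF v(1)])
  qed
  define U where "U = {Y. dims Y R 1 \<and> norm Y \<le> 1} \<inter> {Y. norm Y = 1}"
  have "closed {Y :: fmat. norm Y = 1}" by (intro closed_Collect_eq continuous_intros)
  then have cU: "compact U" unfolding U_def by (intro compact_Int_closed compact_dims_norm_le)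
  obtain c where c: "0 < c" "\<And>Y. Y \<in> U \<Longrightarrow> c \<le> inner Y (fmat_of_mat S * Y)"
  proof (cases "U = {}")
    \<comment> \<open>The sphere is empty when \<open>R = 0\<close>; any positive constant
      serves.\<close>
    case True
    then show thesis using that[of 1] by auto
  next
    case False
    have "continuous_on U (\<lambda>Y. inner Y (fmat_of_mat S * Y))" by (intro continuous_intros)
    then obtain Y0 where Y0: "Y0 \<in> U" "\<And>Y. Y \<in> U \<Longrightarrow> inner Y0 (fmat_of_mat S * Y0) \<le> inner Y (fmat_of_mat S * Y)"
      using continuous_attains_inf[OF cU False, of "\<lambda>Y. inner Y (fmat_of_mat S * Y)"] by blast
    moreover have "Y0 \<noteq> 0" "dims Y0 R 1" using Y0(1) by (auto simp: U_def)
    ultimately show thesis using that[of "inner Y0 (fmat_of_mat S * Y0)"] pos by blast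
  qed
  have col: "c * (norm Y)\<^sup>2 \<le> inner Y (fmat_of_mat S * Y)" if Y: "dims Y R 1" for Y
  proof (cases "Y = 0")
    case False
    define n where "n = norm Y"
    have n: "0 < n" using False by (simp add: n_def)
    have "dims (Y /\<^sub>R n) R 1" using Y by (rule dims_scaleR)
    then have "Y /\<^sub>R n \<in> U" using False by (simp add: U_def n_def)
    from c(2)[OF this] have "c \<le> inner Y (fmat_of_mat S * Y) / n\<^sup>2"
      by (simp add: power2_eq_square divide_inverse mult_ac)
    then show ?thesis using n by (simp add: field_simps n_def)
  qed simp
  show thesis
  proof (rule that[OF c(1)])
    fix Y p assume Y: "dims Y R p"
    have dSY: "dims (fmat_of_mat S * Y) R p" using S Y by (auto intro!: dims_mult)
    have "(norm Y)\<^sup>2 = (\<Sum>j<p. (norm (Y * eunit j 0))\<^sup>2)"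
      using inner_columns[OF Y, of Y] by (simp add: power2_norm_eq_inner)
    then have "c * (norm Y)\<^sup>2 = (\<Sum>j<p. c * (norm (Y * eunit j 0))\<^sup>2)" by (simp add: sum_distrib_left)
    also have "\<dots> \<le> (\<Sum>j<p. inner (Y * eunit j 0) (fmat_of_mat S * (Y * eunit j 0)))"
    proof (intro sum_mono col)
      fix j show "dims (Y * eunit j 0) R 1" using Y by (intro dims_mult[of _ _ p _ "Suc j"]) auto
    qed
    also have "\<dots> = inner Y (fmat_of_mat S * Y)" by (simp only: inner_columns[OF dSY] mult.assoc)
    finally show "c * (norm Y)\<^sup>2 \<le> inner Y (fmat_of_mat S * Y)" .
  qed
qed

text \<open>Half of the coercivity constant of the limit \<open>S\<close> is spent on the deviation
  of the scaled Gram matrix, whose Frobenius norm is at most R \<tau> \<le> c. Both constants depend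
  on \<open>S\<close> only and hence are common to the whole sequence.\<close>

lemma gram_coercive:
  assumes S: "S \<in> carrier_mat R R" and pd: "pos_def_mat S"
  obtains c \<tau> where "0 < c" "0 < \<tau>"
    "\<And>N lam. 0 < N \<Longrightarrow> lam \<in> carrier_mat N R \<Longrightarrow>
      (\<forall>i\<in>{..<R}. \<forall>j\<in>{..<R}. \<bar>(lam\<^sup>T * lam) $$ (i, j) / real N - S $$ (i, j)\<bar> < \<tau>) \<Longrightarrow>
      \<forall>Y p. dims Y R p \<longrightarrow> c * real N * (norm Y)\<^sup>2 \<le> (norm (fmat_of_mat lam * Y))\<^sup>2"
proof -
  obtain c0 where c0: "0 < c0" "\<And>Y p. dims Y R p \<Longrightarrow> c0 * (norm Y)\<^sup>2 \<le> inner Y (fmat_of_mat S * Y)"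
    using pos_def_mat_coercive[OF assms] by blast
  define c where "c = c0 / 2"
  define \<tau> where "\<tau> = c / (real R + 1)"
  have c: "0 < c" "0 < \<tau>" using c0 by (simp_all add: c_def \<tau>_def)
  show thesis
  proof (rule that[OF c], intro allI impI)
    fix N :: nat and lam :: "real mat" and Y p
    assume N: "0 < N" and lam: "lam \<in> carrier_mat N R" and Y: "dims Y R p"
      and close: "\<forall>i\<in>{..<R}. \<forall>j\<in>{..<R}. \<bar>(lam\<^sup>T * lam) $$ (i, j) / real N - S $$ (i, j)\<bar> < \<tau>"
    define D where "D = fmat_of_mat (lam\<^sup>T * lam) /\<^sub>R real N - fmat_of_mat S"
    have lT: "lam\<^sup>T \<in> carrier_mat R N" using lam by simp
    have ll: "lam\<^sup>T * lam \<in> carrier_mat R R" by (rule mult_carrier_mat[OF lT lam])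
    have dD: "dims D R R" unfolding D_def using ll S by auto
    have "(norm D)\<^sup>2 = (\<Sum>i<R. \<Sum>j<R. (entry D i j)\<^sup>2)" by (rule power2_norm_fmat[OF dD])
    also have "\<dots> \<le> (\<Sum>i<R. \<Sum>j<R. \<tau>\<^sup>2)"
    proof (intro sum_mono)
      fix i j assume ij: "i \<in> {..<R}" "j \<in> {..<R}"
      then have "entry D i j = (lam\<^sup>T * lam) $$ (i, j) / real N - S $$ (i, j)"
        using carrier_matD[OF ll] carrier_matD[OF S] unfolding D_def
        by (simp only: entry_real_vector entry_fmat_of_mat lessThan_iff) (simp add: divide_inverse_commute)
      then have "\<bar>entry D i j\<bar> \<le> \<tau>" using close ij by (metis less_eq_real_def)
      then show "(entry D i j)\<^sup>2 \<le> \<tau>\<^sup>2" using c(2) by (simp add: abs_le_square_iff[symmetric])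
    qed
    also have "\<dots> = (real R * \<tau>)\<^sup>2" by (simp add: power2_eq_square)
    finally have "norm D \<le> real R * \<tau>" by (rule power2_le_imp_le) (use c in simp)
    also have "\<dots> \<le> c" using c by (simp add: \<tau>_def divide_simps)
    finally have D: "norm D \<le> c" .
    have "\<bar>inner Y (D * Y)\<bar> \<le> norm Y * norm (D * Y)" by (rule Cauchy_Schwarz_ineq2)
    also have "\<dots> \<le> norm Y * (c * norm Y)"
      using norm_mult_op_bound_left[OF op_bound_mono[OF op_bound_norm D] order_refl] by (intro mult_left_mono) auto
    finally have 1: "\<bar>inner Y (D * Y)\<bar> \<le> c * (norm Y)\<^sup>2" by (simp add: power2_eq_square mult_ac)
    have "fmat_of_mat (lam\<^sup>T * lam) = tr (fmat_of_mat lam) * fmat_of_mat lam" by (simp add: fmat_of_mat_mult[OF lT lam] fmat_of_mat_transpose)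
    then have "tr (fmat_of_mat lam) * fmat_of_mat lam = real N *\<^sub>R (D + fmat_of_mat S)" using N by (simp add: D_def)
    then have "inner Y (tr (fmat_of_mat lam) * fmat_of_mat lam * Y) = real N * (inner Y (D * Y) + inner Y (fmat_of_mat S * Y))"
      by (simp add: inner_add_right distrib_right)
    moreover have "inner Y (tr (fmat_of_mat lam) * fmat_of_mat lam * Y) = (norm (fmat_of_mat lam * Y))\<^sup>2"
      unfolding power2_norm_eq_inner mult.assoc by (simp add: inner_mult_left[of Y])
    ultimately have 2: "(norm (fmat_of_mat lam * Y))\<^sup>2 = real N * (inner Y (D * Y) + inner Y (fmat_of_mat S * Y))"
      by simp
    have "c * (norm Y)\<^sup>2 \<le> inner Y (D * Y) + inner Y (fmat_of_mat S * Y)"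
      using 1 c0(2)[OF Y] unfolding c_def by (simp add: abs_le_iff)
    then have "real N * (c * (norm Y)\<^sup>2) \<le> (norm (fmat_of_mat lam * Y))\<^sup>2"
      unfolding 2 by (rule mult_left_mono) simp
    then show "c * real N * (norm Y)\<^sup>2 \<le> (norm (fmat_of_mat lam * Y))\<^sup>2"
      by (simp only: mult.assoc mult.left_commute)
  qed
qed

section \<open>Rates in powers of sqrt(NT), and the limit theorem\<close>

lemma cube_sum_le:
  fixes a b :: real assumes "0 \<le> a" "0 \<le> b" shows "(a + b) ^ 3 \<le> 4 * (a ^ 3 + b ^ 3)"
proof -
  have "4 * (a ^ 3 + b ^ 3) - (a + b) ^ 3 = 3 * ((a + b) * (a - b)\<^sup>2)"
    by (simp add: power2_eq_square power3_eq_cube algebra_simps)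
  moreover have "0 \<le> 3 * ((a + b) * (a - b)\<^sup>2)" using assms by simp
  ultimately show ?thesis by linarith
qed

text \<open>With m = sqrt(NT) and \<mu> = m^(2/3) the error part of the cubic term is (\<zeta>
  \<mu>)^3 / m^2 = \<zeta>^3 \<le> \<zeta>; this is where the rate of the error norm enters. All
  other terms are at most multiples of \<zeta> m \<delta>: they contain m \<delta> together with
  \<zeta> or with further powers of \<delta>, and \<delta> \<le> \<zeta> \<le> 1. The sum is a
  multiple of \<zeta> (1 + m \<delta>).\<close>

lemma score_bound_rate:
  fixes x q r c \<zeta> m \<delta> \<mu> k :: real
  assumes pos: "0 \<le> x" "0 \<le> q" "0 \<le> r" "0 < c" "0 \<le> k"
    and \<zeta>: "0 < \<zeta>" "\<zeta> \<le> 1" and m: "1 \<le> m" and \<delta>: "0 \<le> \<delta>" "\<delta> \<le> \<zeta>"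
    and \<mu>: "0 \<le> \<mu>" "\<mu> \<le> m" "\<mu> ^ 3 = m\<^sup>2"
  defines "h \<equiv> q * m * \<delta>"
  shows "k * (2 * (x * m) * (3 / (c * m) * (2 * (\<zeta> * \<mu>) * h + h\<^sup>2)
      + 11 * ((r * (\<zeta> * \<mu> + h)) ^ 3 / (c * m)\<^sup>2)))
    \<le> (k * (2 * x * (3 / c * (2 * q + q\<^sup>2) + 44 * r ^ 3 / c\<^sup>2 * (1 + q ^ 3)))) * \<zeta> * (m * (1 + m * \<delta>))"
proof -
  define w where "w = \<zeta> * (1 + m * \<delta>)"
  have m0: "0 < m" using m by simp
  have h0: "0 \<le> h" using pos m0 \<delta> by (simp add: h_def)
  have md: "m * \<delta> \<le> 1 + m * \<delta>" "0 \<le> m * \<delta>" using m0 \<delta> by simp_all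
  have \<zeta>m: "\<zeta> * (m * \<delta>) \<le> w" unfolding w_def using \<zeta> md by (intro mult_left_mono) auto
  have "2 * (\<zeta> * \<mu>) * h + h\<^sup>2 \<le> c * m * (1 / c * (2 * q + q\<^sup>2) * (\<zeta> * (m * \<delta>)))"
  proof -
    have "2 * (\<zeta> * \<mu>) * h \<le> 2 * (\<zeta> * m) * h"
      using \<mu> \<zeta> h0 by (intro mult_right_mono mult_left_mono) auto
    moreover have "h\<^sup>2 \<le> q\<^sup>2 * m\<^sup>2 * (\<zeta> * \<delta>)"
    proof -
      have "\<delta> * \<delta> \<le> \<zeta> * \<delta>" using \<delta> by (intro mult_right_mono) auto
      then have "q\<^sup>2 * m\<^sup>2 * (\<delta> * \<delta>) \<le> q\<^sup>2 * m\<^sup>2 * (\<zeta> * \<delta>)" by (intro mult_left_mono) auto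
      then show ?thesis by (simp add: h_def power2_eq_square mult_ac)
    qed
    moreover have "c * m * (1 / c * (2 * q + q\<^sup>2) * (\<zeta> * (m * \<delta>))) = 2 * (\<zeta> * m) * h + q\<^sup>2 * m\<^sup>2 * (\<zeta> * \<delta>)"
      using pos by (simp add: h_def power2_eq_square algebra_simps)
    ultimately show ?thesis by linarith
  qed
  then have "3 / (c * m) * (2 * (\<zeta> * \<mu>) * h + h\<^sup>2) \<le> 3 / (c * m) * (c * m * (1 / c * (2 * q + q\<^sup>2) * (\<zeta> * (m * \<delta>))))"
    using pos m0 by (intro mult_left_mono) auto
  also have "\<dots> = 3 / c * (2 * q + q\<^sup>2) * (\<zeta> * (m * \<delta>))" using pos m0 by simp
  also have "\<dots> \<le> 3 / c * (2 * q + q\<^sup>2) * w" using pos \<zeta>m by (intro mult_left_mono) auto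
  finally have 1: "3 / (c * m) * (2 * (\<zeta> * \<mu>) * h + h\<^sup>2) \<le> 3 / c * (2 * q + q\<^sup>2) * w" .
  \<comment> \<open>The factor 4 of this inequality turns the constant 11 into 44.\<close>
  have "(\<zeta> * \<mu> + h) ^ 3 \<le> 4 * ((\<zeta> * \<mu>) ^ 3 + h ^ 3)"
    using \<zeta> \<mu> h0 by (intro cube_sum_le) auto
  also have "\<dots> \<le> 4 * m\<^sup>2 * ((1 + q ^ 3) * w)"
  proof -
    have z3: "\<zeta> ^ 3 \<le> \<zeta>" using \<zeta> power_decreasing[of 1 3 \<zeta>] by simp
    have "\<delta> ^ 3 \<le> \<zeta> * \<delta>"
    proof -
      have "\<delta> * \<delta> \<le> \<zeta> * 1" using \<delta> \<zeta> by (intro mult_mono) auto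
      then have "(\<delta> * \<delta>) * \<delta> \<le> \<zeta> * \<delta>" using \<delta> by (intro mult_right_mono) auto
      then show ?thesis by (simp add: power3_eq_cube)
    qed
    then have "h ^ 3 \<le> q ^ 3 * m ^ 3 * (\<zeta> * \<delta>)"
      unfolding h_def power_mult_distrib using pos m0 by (intro mult_left_mono) auto
    also have "\<dots> = m\<^sup>2 * (q ^ 3 * (\<zeta> * (m * \<delta>)))" by (simp add: power2_eq_square power3_eq_cube)
    also have "\<dots> \<le> m\<^sup>2 * (q ^ 3 * w)" using \<zeta>m pos by (intro mult_left_mono) auto
    finally have a: "h ^ 3 \<le> m\<^sup>2 * (q ^ 3 * w)" .
    have "(\<zeta> * \<mu>) ^ 3 = \<zeta> ^ 3 * m\<^sup>2" by (simp add: power_mult_distrib \<mu>)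
    also have "\<dots> \<le> w * m\<^sup>2"
    proof (rule mult_right_mono)
      have "\<zeta> * 1 \<le> w" unfolding w_def using \<zeta> md by (intro mult_left_mono) auto
      then show "\<zeta> ^ 3 \<le> w" using z3 by linarith
    qed simp
    finally have b: "(\<zeta> * \<mu>) ^ 3 \<le> w * m\<^sup>2" .
    show ?thesis using a b by (simp add: algebra_simps)
  qed
  finally have "r ^ 3 * (\<zeta> * \<mu> + h) ^ 3 / (c * m)\<^sup>2 \<le> r ^ 3 * (4 * m\<^sup>2 * ((1 + q ^ 3) * w)) / (c * m)\<^sup>2"
    using pos by (intro divide_right_mono mult_left_mono) auto
  also have "\<dots> = 4 * r ^ 3 / c\<^sup>2 * (1 + q ^ 3) * w" using m0 by (simp add: power_mult_distrib)
  finally have 2: "11 * ((r * (\<zeta> * \<mu> + h)) ^ 3 / (c * m)\<^sup>2) \<le> 44 * r ^ 3 / c\<^sup>2 * (1 + q ^ 3) * w"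
    by (simp add: power_mult_distrib)
  have "k * (2 * (x * m) * (3 / (c * m) * (2 * (\<zeta> * \<mu>) * h + h\<^sup>2)
      + 11 * ((r * (\<zeta> * \<mu> + h)) ^ 3 / (c * m)\<^sup>2)))
    \<le> k * (2 * (x * m) * (3 / c * (2 * q + q\<^sup>2) * w + 44 * r ^ 3 / c\<^sup>2 * (1 + q ^ 3) * w))"
    using 1 2 pos m0 by (intro mult_left_mono add_mono) auto
  also have "\<dots> = (k * (2 * x * (3 / c * (2 * q + q\<^sup>2) + 44 * r ^ 3 / c\<^sup>2 * (1 + q ^ 3)))) * \<zeta> * (m * (1 + m * \<delta>))"
    by (simp add: w_def algebra_simps)
  finally show ?thesis .
qed

lemma powr_two_thirds:
  fixes m :: real
  assumes "1 \<le> m"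
  shows "0 \<le> m powr (2 / 3)" "m powr (2 / 3) \<le> m" "(m powr (2 / 3)) ^ 3 = m\<^sup>2"
proof -
  show "0 \<le> m powr (2 / 3)" by simp
  have "m powr (2 / 3) \<le> m powr 1" using assms by (intro powr_mono) auto
  then show "m powr (2 / 3) \<le> m" using assms by simp
  have "(m powr (2 / 3)) ^ 3 = (m powr (2 / 3)) powr real 3"
    using assms by (subst powr_realpow) auto
  also have "\<dots> = m powr (2 / 3 * real 3)" by (rule powr_powr)
  also have "\<dots> = m powr real 2" by simp
  also have "\<dots> = m\<^sup>2" using assms by (subst powr_realpow) auto
  finally show "(m powr (2 / 3)) ^ 3 = m\<^sup>2" .
qed

text \<open>The supremum is expressed by a bound for every \<open>b\<close> in the ball, and the
  existence of both gradients is part of the event, whose inner probability tends to one.\<close>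

theorem theorem6:
  fixes M :: "'a measure"
    and N T :: "nat \<Rightarrow> nat"
    and \<kappa> :: real
    and R :: nat
    and b0 :: "real^'k"
    and X :: "nat \<Rightarrow> 'a \<Rightarrow> 'k \<Rightarrow> real mat"
    and lam0 f0 e :: "nat \<Rightarrow> 'a \<Rightarrow> real mat"
  assumes prob: "prob_space M"
    and N_lim: "filterlim N at_top sequentially"
    and T_lim: "filterlim T at_top sequentially"
    and kappa_pos: "0 < \<kappa>"
    and ratio: "(\<lambda>n. real (N n) / real (T n)) \<longlonglongrightarrow> \<kappa>\<^sup>2"
    and dims: "\<And>n \<omega> k. \<omega> \<in> space M \<Longrightarrow>
        X n \<omega> k \<in> carrier_mat (N n) (T n) \<and> e n \<omega> \<in> carrier_mat (N n) (T n) \<and>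
        lam0 n \<omega> \<in> carrier_mat (N n) R \<and> f0 n \<omega> \<in> carrier_mat (T n) R"
    and A1_lam: "\<exists>S \<in> carrier_mat R R. pos_def_mat S \<and>
        (\<forall>i<R. \<forall>j<R. plim_to M
            (\<lambda>n \<omega>. ((lam0 n \<omega>)\<^sup>T * lam0 n \<omega>) $$ (i, j) / real (N n)) (S $$ (i, j)))"
    and A1_f: "\<exists>S \<in> carrier_mat R R. pos_def_mat S \<and>
        (\<forall>i<R. \<forall>j<R. plim_to M
            (\<lambda>n \<omega>. ((f0 n \<omega>)\<^sup>T * f0 n \<omega>) $$ (i, j) / real (T n)) (S $$ (i, j)))"
    and A3star: "small_op M (\<lambda>n \<omega>. spec_norm (e n \<omega>)) (\<lambda>n. real (N n) powr (2 / 3))"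
    and A4i: "\<exists>S :: real^'k^'k. pos_def_cart S \<and>
        (\<forall>k1 k2. plim_to M
            (\<lambda>n \<omega>. (1 / (real (N n) * real (T n))) *
                (\<Sum>i<N n. \<Sum>t<T n. X n \<omega> k1 $$ (i, t) * X n \<omega> k2 $$ (i, t)))
            (S $ k1 $ k2))"
  shows "\<forall>\<eta> :: nat \<Rightarrow> real. \<eta> \<longlonglongrightarrow> 0 \<longrightarrow> (\<forall>\<epsilon>>0. wpa1 M (\<lambda>n \<omega>.
     \<forall>b :: real^'k. norm (b - b0) \<le> \<eta> n \<longrightarrow>
       (\<exists>g :: real^'k.
          (RNT (N n) (T n) R b0 (X n \<omega>) (lam0 n \<omega>) (f0 n \<omega>) (e n \<omega>)
             has_derivative (\<lambda>h. g \<bullet> h)) (at b) \<and>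
          (LNT (N n) (T n) R (bdotX (N n) (T n) b0 (X n \<omega>) + lam0 n \<omega> * (f0 n \<omega>)\<^sup>T + e n \<omega>)
               (X n \<omega>)
             has_derivative (\<lambda>h.
               (2 *\<^sub>R (WNT (N n) (T n) (X n \<omega>) (lam0 n \<omega>) (f0 n \<omega>) *v (b - b0))
                - (2 / sqrt (real (N n) * real (T n))) *\<^sub>R
                    CNT (N n) (T n) (X n \<omega>) (lam0 n \<omega>) (f0 n \<omega>) (e n \<omega>)
                + (1 / (real (N n) * real (T n))) *\<^sub>R g) \<bullet> h)) (at b) \<and>
          norm g / (sqrt (real (N n) * real (T n)) *
                    (1 + sqrt (real (N n) * real (T n)) * norm (b - b0))) \<le> \<epsilon>)))"
proof (intro allI impI)
  fix \<eta> :: "nat \<Rightarrow> real" and \<epsilon> :: real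
  assume \<eta>: "\<eta> \<longlonglongrightarrow> 0" and \<epsilon>: "0 < \<epsilon>"
  interpret prob_space M by (rule prob)
  obtain Sl where Sl: "Sl \<in> carrier_mat R R" "pos_def_mat Sl"
    "\<And>i j. i < R \<Longrightarrow> j < R \<Longrightarrow> plim_to M (\<lambda>n \<omega>. ((lam0 n \<omega>)\<^sup>T * lam0 n \<omega>) $$ (i, j) / real (N n)) (Sl $$ (i, j))"
    using A1_lam by blast
  obtain Sf where Sf: "Sf \<in> carrier_mat R R" "pos_def_mat Sf"
    "\<And>i j. i < R \<Longrightarrow> j < R \<Longrightarrow> plim_to M (\<lambda>n \<omega>. ((f0 n \<omega>)\<^sup>T * f0 n \<omega>) $$ (i, j) / real (T n)) (Sf $$ (i, j))"
    using A1_f by blast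
  obtain SX :: "real^'k^'k" where SX: "\<And>k1 k2. plim_to M
            (\<lambda>n \<omega>. (1 / (real (N n) * real (T n))) *
                (\<Sum>i<N n. \<Sum>t<T n. X n \<omega> k1 $$ (i, t) * X n \<omega> k2 $$ (i, t)))
            (SX $ k1 $ k2)"
    using A4i by blast
  obtain cl \<tau>l where cl: "0 < cl" "0 < \<tau>l"
    "\<And>N lam. 0 < N \<Longrightarrow> lam \<in> carrier_mat N R \<Longrightarrow>
      (\<forall>i\<in>{..<R}. \<forall>j\<in>{..<R}. \<bar>(lam\<^sup>T * lam) $$ (i, j) / real N - Sl $$ (i, j)\<bar> < \<tau>l) \<Longrightarrow>
      \<forall>Y p. dims Y R p \<longrightarrow> cl * real N * (norm Y)\<^sup>2 \<le> (norm (fmat_of_mat lam * Y))\<^sup>2"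
    using gram_coercive[OF Sl(1,2)] by blast
  obtain cf \<tau>f where cf: "0 < cf" "0 < \<tau>f"
    "\<And>N lam. 0 < N \<Longrightarrow> lam \<in> carrier_mat N R \<Longrightarrow>
      (\<forall>i\<in>{..<R}. \<forall>j\<in>{..<R}. \<bar>(lam\<^sup>T * lam) $$ (i, j) / real N - Sf $$ (i, j)\<bar> < \<tau>f) \<Longrightarrow>
      \<forall>Y p. dims Y R p \<longrightarrow> cf * real N * (norm Y)\<^sup>2 \<le> (norm (fmat_of_mat lam * Y))\<^sup>2"
    using gram_coercive[OF Sf(1,2)] by blast
  define c where "c = min cl cf"
  define c' where "c' = c / (real R + 1)"
  define r where "r = 3 * sqrt (real R) + 2"
  \<comment> \<open>On \<open>good\<close> the mean square of each regressor is within 1 of its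
    limit \<open>SX $ k $ k\<close>, hence at most \<open>x\<close>; as \<open>x \<ge> 1\<close>,
    the root mean square is at most \<open>x\<close> as well.\<close>
  define x where "x = 1 + (\<Sum>k\<in>UNIV. \<bar>SX $ k $ k\<bar>)"
  define kk where "kk = real CARD('k)"
  define q where "q = kk * x"
  define Ct where "Ct = kk * (2 * x * (3 / c' * (2 * q + q\<^sup>2) + 44 * r ^ 3 / c'\<^sup>2 * (1 + q ^ 3)))"
  \<comment> \<open>Three demands: powers of \<zeta> stay below \<zeta>; the noise condition 4 r (1
    + q) \<zeta> \<le> c' holds; and the final bound satisfies Ct \<zeta> \<le> \<epsilon>.\<close>
  define \<zeta> where "\<zeta> = min 1 (min (c' / (4 * r * (1 + q))) (\<epsilon> / (Ct + 1)))"
  \<comment> \<open>Eventually N / T < \<kappa>^2 + 1, whence N \<le> A sqrt(NT); this converts the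
    rate N^(2/3) into (NT)^(1/3).\<close>
  define A where "A = max 1 (\<kappa>\<^sup>2 + 1)"
  have c: "0 < c" "0 < c'" "c \<le> cl" "c \<le> cf" using cl cf by (simp_all add: c_def c'_def)
  have r: "0 < r" by (simp add: r_def add_nonneg_pos)
  have x: "1 \<le> x" by (simp add: x_def sum_nonneg)
  have kk: "0 \<le> kk" by (simp add: kk_def)
  have q: "0 \<le> q" using x kk by (simp add: q_def)
  have Ct: "0 \<le> Ct" using x kk q c r by (simp add: Ct_def)
  have \<zeta>: "0 < \<zeta>" "\<zeta> \<le> 1" using c r q \<epsilon> Ct by (simp_all add: \<zeta>_def add_pos_nonneg add_nonneg_pos)
  have \<zeta>c: "4 * r * (1 + q) * \<zeta> \<le> c'"
  proof -
    have "\<zeta> \<le> c' / (4 * r * (1 + q))" by (simp add: \<zeta>_def)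
    moreover have "0 < 4 * r * (1 + q)" using r q by (simp add: add_pos_nonneg)
    ultimately show ?thesis by (simp add: pos_le_divide_eq mult.commute)
  qed
  have \<zeta>\<epsilon>: "Ct * \<zeta> \<le> \<epsilon>"
  proof -
    have "\<zeta> \<le> \<epsilon> / (Ct + 1)" by (simp add: \<zeta>_def)
    then have "(Ct + 1) * \<zeta> \<le> \<epsilon>" using Ct by (simp add: pos_le_divide_eq mult.commute)
    then show ?thesis using \<zeta> by (simp add: algebra_simps)
  qed
  have A: "1 \<le> A" by (simp add: A_def)
  \<comment> \<open>The event that carries the argument. It involves neither \<open>b\<close> nor
    \<eta>, so uniformity over the shrinking ball is automatic. The threshold
    \<open>\<zeta> / A\<close> anticipates the change of rate from N to m.\<close>
  define good where "good = (\<lambda>n \<omega>.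
      (\<forall>i\<in>{..<R}. \<forall>j\<in>{..<R}. \<bar>((lam0 n \<omega>)\<^sup>T * lam0 n \<omega>) $$ (i, j) / real (N n) - Sl $$ (i, j)\<bar> < \<tau>l)
    \<and> (\<forall>i\<in>{..<R}. \<forall>j\<in>{..<R}. \<bar>((f0 n \<omega>)\<^sup>T * f0 n \<omega>) $$ (i, j) / real (T n) - Sf $$ (i, j)\<bar> < \<tau>f)
    \<and> (\<forall>k\<in>UNIV. \<bar>(1 / (real (N n) * real (T n))) *
          (\<Sum>i<N n. \<Sum>t<T n. X n \<omega> k $$ (i, t) * X n \<omega> k $$ (i, t)) - SX $ k $ k\<bar> < 1)
    \<and> \<bar>spec_norm (e n \<omega>) / real (N n) powr (2 / 3) - 0\<bar> < \<zeta> / A)"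
  have wgood: "wpa1 M good"
    unfolding good_def
  proof (intro wpa1_conj)
    show "wpa1 M (\<lambda>n \<omega>. \<forall>i\<in>{..<R}. \<forall>j\<in>{..<R}. \<bar>((lam0 n \<omega>)\<^sup>T * lam0 n \<omega>) $$ (i, j) / real (N n) - Sl $$ (i, j)\<bar> < \<tau>l)"
      by (rule wpa1_ball[OF finite_lessThan], rule wpa1_ball[OF finite_lessThan])
        (use Sl(3) cl(2) in \<open>auto simp: plim_to_def\<close>)
    show "wpa1 M (\<lambda>n \<omega>. \<forall>i\<in>{..<R}. \<forall>j\<in>{..<R}. \<bar>((f0 n \<omega>)\<^sup>T * f0 n \<omega>) $$ (i, j) / real (T n) - Sf $$ (i, j)\<bar> < \<tau>f)"
      by (rule wpa1_ball[OF finite_lessThan], rule wpa1_ball[OF finite_lessThan])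
        (use Sf(3) cf(2) in \<open>auto simp: plim_to_def\<close>)
    show "wpa1 M (\<lambda>n \<omega>. \<forall>k\<in>UNIV. \<bar>(1 / (real (N n) * real (T n))) *
          (\<Sum>i<N n. \<Sum>t<T n. X n \<omega> k $$ (i, t) * X n \<omega> k $$ (i, t)) - SX $ k $ k\<bar> < 1)"
    proof (rule wpa1_ball[OF finite_class.finite_UNIV])
      fix k :: 'k
      show "wpa1 M (\<lambda>n \<omega>. \<bar>(1 / (real (N n) * real (T n))) *
          (\<Sum>i<N n. \<Sum>t<T n. X n \<omega> k $$ (i, t) * X n \<omega> k $$ (i, t)) - SX $ k $ k\<bar> < 1)"
        by (rule SX[of k k, unfolded plim_to_def, rule_format]) simp
    qed
    have "0 < \<zeta> / A" using \<zeta> A by simp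
    then show "wpa1 M (\<lambda>n \<omega>. \<bar>spec_norm (e n \<omega>) / real (N n) powr (2 / 3) - 0\<bar> < \<zeta> / A)"
      using A3star unfolding small_op_def plim_to_def by blast
  qed
  have evR: "\<forall>\<^sub>F n in sequentially. max R 1 \<le> N n" using N_lim unfolding filterlim_at_top by blast
  have evT: "\<forall>\<^sub>F n in sequentially. 1 \<le> T n" using T_lim by (simp add: filterlim_at_top)
  have ev\<eta>: "\<forall>\<^sub>F n in sequentially. \<eta> n < \<zeta>" using order_tendstoD(2)[OF \<eta> \<zeta>(1)] .
  have evA: "\<forall>\<^sub>F n in sequentially. real (N n) / real (T n) < \<kappa>\<^sup>2 + 1"
    using order_tendstoD(2)[OF ratio, of "\<kappa>\<^sup>2 + 1"] by simp
  show "wpa1 M (\<lambda>n \<omega>.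
     \<forall>b :: real^'k. norm (b - b0) \<le> \<eta> n \<longrightarrow>
       (\<exists>g :: real^'k.
          (RNT (N n) (T n) R b0 (X n \<omega>) (lam0 n \<omega>) (f0 n \<omega>) (e n \<omega>)
             has_derivative (\<lambda>h. g \<bullet> h)) (at b) \<and>
          (LNT (N n) (T n) R (bdotX (N n) (T n) b0 (X n \<omega>) + lam0 n \<omega> * (f0 n \<omega>)\<^sup>T + e n \<omega>)
               (X n \<omega>)
             has_derivative (\<lambda>h.
               (2 *\<^sub>R (WNT (N n) (T n) (X n \<omega>) (lam0 n \<omega>) (f0 n \<omega>) *v (b - b0))
                - (2 / sqrt (real (N n) * real (T n))) *\<^sub>R
                    CNT (N n) (T n) (X n \<omega>) (lam0 n \<omega>) (f0 n \<omega>) (e n \<omega>)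
                + (1 / (real (N n) * real (T n))) *\<^sub>R g) \<bullet> h)) (at b) \<and>
          norm g / (sqrt (real (N n) * real (T n)) *
                    (1 + sqrt (real (N n) * real (T n)) * norm (b - b0))) \<le> \<epsilon>))"
  proof (rule wpa1_mono[OF wgood], use evR evT ev\<eta> evA in eventually_elim, intro ballI impI allI)
    fix n \<omega> and b :: "real^'k"
    assume n: "max R 1 \<le> N n" "1 \<le> T n" "\<eta> n < \<zeta>" "real (N n) / real (T n) < \<kappa>\<^sup>2 + 1"
      and \<omega>: "\<omega> \<in> space M" and g: "good n \<omega>" and b: "norm (b - b0) \<le> \<eta> n"
    define m where "m = sqrt (real (N n) * real (T n))"
    define \<delta> where "\<delta> = norm (b - b0)"
    define \<mu> where "\<mu> = m powr (2 / 3)"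
    define h where "h = q * m * \<delta>"
    have NT: "1 \<le> real (N n)" "1 \<le> real (T n)" using n by auto
    have m2: "m\<^sup>2 = real (N n) * real (T n)" using NT by (simp add: m_def)
    have m1: "1 \<le> m"
    proof -
      have "1 * 1 \<le> real (N n) * real (T n)" using NT by (intro mult_mono) auto
      then show ?thesis by (simp add: m_def)
    qed
    have \<delta>: "0 \<le> \<delta>" "\<delta> \<le> \<zeta>" using b n by (simp_all add: \<delta>_def)
    note D = dims[OF \<omega>, of n]
    have low_l: "\<forall>Y p. dims Y R p \<longrightarrow> c * real (N n) * (norm Y)\<^sup>2 \<le> (norm (fmat_of_mat (lam0 n \<omega>) * Y))\<^sup>2"
    proof (intro allI impI)
      fix Y p assume Y: "dims Y R p"
      have "cl * real (N n) * (norm Y)\<^sup>2 \<le> (norm (fmat_of_mat (lam0 n \<omega>) * Y))\<^sup>2"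
        using cl(3)[of "N n" "lam0 n \<omega>"] n D g Y unfolding good_def by auto
      moreover have "c * real (N n) * (norm Y)\<^sup>2 \<le> cl * real (N n) * (norm Y)\<^sup>2"
        using c by (intro mult_right_mono) auto
      ultimately show "c * real (N n) * (norm Y)\<^sup>2 \<le> (norm (fmat_of_mat (lam0 n \<omega>) * Y))\<^sup>2" by linarith
    qed
    have low_f: "\<forall>Y p. dims Y R p \<longrightarrow> c * real (T n) * (norm Y)\<^sup>2 \<le> (norm (fmat_of_mat (f0 n \<omega>) * Y))\<^sup>2"
    proof (intro allI impI)
      fix Y p assume Y: "dims Y R p"
      have "cf * real (T n) * (norm Y)\<^sup>2 \<le> (norm (fmat_of_mat (f0 n \<omega>) * Y))\<^sup>2"
        using cf(3)[of "T n" "f0 n \<omega>"] n D g Y unfolding good_def by auto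
      moreover have "c * real (T n) * (norm Y)\<^sup>2 \<le> cf * real (T n) * (norm Y)\<^sup>2"
        using c by (intro mult_right_mono) auto
      ultimately show "c * real (T n) * (norm Y)\<^sup>2 \<le> (norm (fmat_of_mat (f0 n \<omega>) * Y))\<^sup>2" by linarith
    qed
    have nX: "norm (fmat_of_mat (X n \<omega> k)) \<le> x * m" for k
    proof (rule power2_le_imp_le)
      define s where "s = (\<Sum>i<N n. \<Sum>t<T n. X n \<omega> k $$ (i, t) * X n \<omega> k $$ (i, t))"
      have cX: "X n \<omega> k \<in> carrier_mat (N n) (T n)" using dims[OF \<omega>] by blast
      have "(norm (fmat_of_mat (X n \<omega> k)))\<^sup>2 = s"
        unfolding power2_norm_fmat[OF dims_fmat_of_mat[OF cX]] s_def
        using cX by (intro sum.cong refl) (auto simp: entry_fmat_of_mat power2_eq_square)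
      moreover have "s \<le> x * m\<^sup>2"
      proof -
        have "\<bar>SX $ k $ k\<bar> \<le> (\<Sum>k\<in>UNIV. \<bar>SX $ k $ k\<bar>)"
          by (rule member_le_sum) auto
        moreover have "\<bar>1 / m\<^sup>2 * s - SX $ k $ k\<bar> < 1" using g unfolding good_def m2 s_def by blast
        ultimately have "1 / m\<^sup>2 * s \<le> x" unfolding x_def by linarith
        then show ?thesis using m1 by (simp add: divide_le_eq)
      qed
      moreover have "x * m\<^sup>2 \<le> (x * m)\<^sup>2"
      proof -
        have "x * 1 \<le> x * x" using x by (intro mult_left_mono) auto
        then have "x * m\<^sup>2 \<le> x * x * m\<^sup>2" by (intro mult_right_mono) auto
        then show ?thesis by (simp add: power2_eq_square mult_ac)
      qed
      ultimately show "(norm (fmat_of_mat (X n \<omega> k)))\<^sup>2 \<le> (x * m)\<^sup>2" by linarith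
      show "0 \<le> x * m" using x m1 by simp
    qed
    have NA: "real (N n) \<le> A * m"
    proof (rule power2_le_imp_le)
      have "real (N n) \<le> A * real (T n)"
      proof -
        have "real (N n) \<le> (\<kappa>\<^sup>2 + 1) * real (T n)" using n(4) NT by (simp add: divide_less_eq)
        also have "\<dots> \<le> A * real (T n)" by (intro mult_right_mono) (auto simp: A_def)
        finally show ?thesis .
      qed
      then have "real (N n) * real (N n) \<le> real (N n) * (A * real (T n))" by (intro mult_left_mono) auto
      also have "\<dots> = A * m\<^sup>2" by (simp add: m2)
      also have "\<dots> \<le> A\<^sup>2 * m\<^sup>2"
      proof (intro mult_right_mono)
        show "A \<le> A\<^sup>2" using A mult_left_mono[of 1 A A] by (simp add: power2_eq_square)
      qed simp
      finally show "(real (N n))\<^sup>2 \<le> (A * m)\<^sup>2" by (simp add: power2_eq_square mult_ac)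
      show "0 \<le> A * m" using A m1 by simp
    qed
    have \<alpha>: "spec_norm (e n \<omega>) \<le> \<zeta> * \<mu>"
    proof -
      have Np: "0 < real (N n) powr (2 / 3)" using NT by simp
      have "\<bar>spec_norm (e n \<omega>) / real (N n) powr (2 / 3) - 0\<bar> < \<zeta> / A" using g unfolding good_def by blast
      then have "spec_norm (e n \<omega>) / real (N n) powr (2 / 3) \<le> \<zeta> / A" by linarith
      then have 1: "spec_norm (e n \<omega>) \<le> \<zeta> / A * real (N n) powr (2 / 3)" using Np by (simp add: pos_divide_le_eq)
      \<comment> \<open>As \<open>A \<ge> 1\<close>, the power A^(2/3) is at most A, and this A
        cancels against the threshold in \<open>good\<close>.\<close>
      have "real (N n) powr (2 / 3) \<le> (A * m) powr (2 / 3)" using NA NT by (intro powr_mono2) auto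
      also have "(A * m) powr (2 / 3) = A powr (2 / 3) * \<mu>" using A m1 by (simp add: powr_mult \<mu>_def)
      also have "A powr (2 / 3) * \<mu> \<le> A * \<mu>"
        using powr_two_thirds[OF A] by (intro mult_right_mono) (auto simp: \<mu>_def)
      finally have "\<zeta> / A * real (N n) powr (2 / 3) \<le> \<zeta> / A * (A * \<mu>)"
        using A \<zeta> by (intro mult_left_mono) auto
      also have "\<dots> = \<zeta> * \<mu>" using A by simp
      finally show ?thesis using 1 by linarith
    qed
    have h: "real CARD('k) * (x * m) * norm (b - b0) \<le> h" by (simp add: h_def q_def kk_def \<delta>_def)
    have small: "4 * ((3 * sqrt (real R) + 2) * (\<zeta> * \<mu> + h)) \<le> c * m / (real R + 1)"
    proof -
      \<comment> \<open>The error part uses \<mu> \<le> m. In the regressor part the shrinking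
        radius enters: \<delta> \<le> \<eta> n < \<zeta> keeps \<beta> close enough for the spectral
        gap to survive.\<close>
      have "\<zeta> * \<mu> + h \<le> \<zeta> * m + q * m * \<zeta>"
        unfolding h_def using powr_two_thirds(2)[OF m1] \<zeta> \<delta> q m1
        by (intro add_mono mult_left_mono) (auto simp: \<mu>_def)
      also have "\<dots> = (1 + q) * \<zeta> * m" by (simp add: algebra_simps)
      finally have "4 * (r * (\<zeta> * \<mu> + h)) \<le> 4 * (r * ((1 + q) * \<zeta> * m))"
        using r by (intro mult_left_mono) auto
      also have "\<dots> = (4 * r * (1 + q) * \<zeta>) * m" by simp
      also have "\<dots> \<le> c' * m" using \<zeta>c m1 by (intro mult_right_mono) auto
      finally show ?thesis by (simp add: r_def c'_def)
    qed
    obtain g :: "real^'k" where g: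
      "(RNT (N n) (T n) R b0 (X n \<omega>) (lam0 n \<omega>) (f0 n \<omega>) (e n \<omega>) has_derivative (\<lambda>h. g \<bullet> h)) (at b)"
      "(LNT (N n) (T n) R (bdotX (N n) (T n) b0 (X n \<omega>) + lam0 n \<omega> * (f0 n \<omega>)\<^sup>T + e n \<omega>) (X n \<omega>)
          has_derivative (\<lambda>h. (2 *\<^sub>R (WNT (N n) (T n) (X n \<omega>) (lam0 n \<omega>) (f0 n \<omega>) *v (b - b0))
          - (2 / m) *\<^sub>R CNT (N n) (T n) (X n \<omega>) (lam0 n \<omega>) (f0 n \<omega>) (e n \<omega>)
          + (1 / (real (N n) * real (T n))) *\<^sub>R g) \<bullet> h)) (at b)"
      "norm g \<le> real CARD('k) * (2 * (x * m) * (3 / (c * m / (real R + 1)) * (2 * (\<zeta> * \<mu>) * h + h\<^sup>2)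
          + 11 * (((3 * sqrt (real R) + 2) * (\<zeta> * \<mu> + h)) ^ 3 / (c * m / (real R + 1))\<^sup>2)))"
      using score_expansion[where X = "X n \<omega>" and e = "e n \<omega>" and lam = "lam0 n \<omega>" and f = "f0 n \<omega>"
          and N = "N n" and T = "T n" and R = R and c = c and x = x and \<alpha> = "\<zeta> * \<mu>" and h = h
          and s = "c * m / (real R + 1)" and m = m and b = b and ?b0.0 = b0]
        D dims[OF \<omega>] n c(1) low_l low_f m_def nX \<alpha> h small by auto
    have "norm g \<le> kk * (2 * (x * m) * (3 / (c' * m) * (2 * (\<zeta> * \<mu>) * h + h\<^sup>2)
          + 11 * ((r * (\<zeta> * \<mu> + h)) ^ 3 / (c' * m)\<^sup>2)))"
      using g(3) by (simp add: c'_def r_def kk_def)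
    also have "\<dots> \<le> Ct * \<zeta> * (m * (1 + m * \<delta>))"
      unfolding Ct_def h_def
      by (rule score_bound_rate) (use x q r c kk \<zeta> m1 \<delta> powr_two_thirds[OF m1] in \<open>auto simp: \<mu>_def\<close>)
    also have "\<dots> \<le> \<epsilon> * (m * (1 + m * \<delta>))"
      using \<zeta>\<epsilon> m1 \<delta> by (intro mult_right_mono) auto
    finally have "norm g \<le> \<epsilon> * (m * (1 + m * \<delta>))" .
    moreover have "0 < m * (1 + m * \<delta>)" using m1 \<delta> by (intro mult_pos_pos add_pos_nonneg) auto
    ultimately have "norm g / (m * (1 + m * \<delta>)) \<le> \<epsilon>" by (simp add: pos_divide_le_eq)
    then show "\<exists>g :: real^'k.
          (RNT (N n) (T n) R b0 (X n \<omega>) (lam0 n \<omega>) (f0 n \<omega>) (e n \<omega>)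
             has_derivative (\<lambda>h. g \<bullet> h)) (at b) \<and>
          (LNT (N n) (T n) R (bdotX (N n) (T n) b0 (X n \<omega>) + lam0 n \<omega> * (f0 n \<omega>)\<^sup>T + e n \<omega>)
               (X n \<omega>)
             has_derivative (\<lambda>h.
               (2 *\<^sub>R (WNT (N n) (T n) (X n \<omega>) (lam0 n \<omega>) (f0 n \<omega>) *v (b - b0))
                - (2 / sqrt (real (N n) * real (T n))) *\<^sub>R
                    CNT (N n) (T n) (X n \<omega>) (lam0 n \<omega>) (f0 n \<omega>) (e n \<omega>)
                + (1 / (real (N n) * real (T n))) *\<^sub>R g) \<bullet> h)) (at b) \<and>
          norm g / (sqrt (real (N n) * real (T n)) *
                    (1 + sqrt (real (N n) * real (T n)) * norm (b - b0))) \<le> \<epsilon>"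
      using g(1,2) unfolding m_def \<delta>_def by blast
  qed
qed

end
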